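(* Any finite abelian group $G$ satisfies $$ 2\log_3|G|\;\le\;\kappa(G)\;\le\;14\log_2|G|+7s^2-4s, $$ where $s$ is the number of invariant factors of $G$.
   Context: A finite abelian group decomposes as $G=\mathbb Z_{n_1}\oplus\dots\oplus\mathbb Z_{n_s}$ with $n_1\ge 2$ and $n_1|n_2|\cdots|n_s$; these uniquely determined numbers are the invariant factors of $G$, and $s$ is their number. All simplicial complexes are finite. The simplicial complexity $\kappa(G)$ of a finitely presentable group $G$ is the minimal number of $2$-simplices of a connected simplicial complex of dimension at most $2$ with fundamental group $G$. *)

theory Defs
  imports "HOL-Analysis.Analysis" "HOL-Algebra.Product_Groups"
begin

definition loops_at :: "'a::topological_space set \<Rightarrow> 'a \<Rightarrow> (real \<Rightarrow> 'a) set" where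
  "loops_at S x = {p. path p \<and> path_image p \<subseteq> S \<and> pathstart p = x \<and> pathfinish p = x}"

definition loop_homotopy :: "'a::topological_space set \<Rightarrow> 'a \<Rightarrow> ((real \<Rightarrow> 'a) \<times> (real \<Rightarrow> 'a)) set" where
  "loop_homotopy S x = {(p, q). p \<in> loops_at S x \<and> q \<in> loops_at S x \<and> homotopic_paths S p q}"

definition fundamental_group :: "'a::topological_space set \<Rightarrow> 'a \<Rightarrow> (real \<Rightarrow> 'a) set monoid" where
  "fundamental_group S x =
     \<lparr>carrier = loops_at S x // loop_homotopy S x,
      monoid.mult = (\<lambda>A B. \<Union>p\<in>A. \<Union>q\<in>B. loop_homotopy S x `` {p +++ q}),
      one = loop_homotopy S x `` {\<lambda>_. x}\<rparr>"

text \<open>Vertices are natural numbers; up to isomorphism this covers every finite abstract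
  simplicial complex. Simplices are nonempty, and a simplex with \<open>k + 1\<close> vertices has
  dimension \<open>k\<close>.\<close>

definition finite_abstract_complex :: "nat set set \<Rightarrow> bool" where
  "finite_abstract_complex K \<longleftrightarrow>
     finite K \<and>
     (\<forall>\<sigma>\<in>K. finite \<sigma> \<and> \<sigma> \<noteq> {}) \<and>
     (\<forall>\<sigma>\<in>K. \<forall>\<tau>. \<tau> \<subseteq> \<sigma> \<and> \<tau> \<noteq> {} \<longrightarrow> \<tau> \<in> K)"

text \<open>Points of the realization are given by barycentric coordinates. The topology is the
  subspace topology of the product topology on \<open>nat \<Rightarrow> real\<close>; a finite complex involves only
  finitely many coordinates, so this is the usual Euclidean one.\<close>

definition geometric_realization :: "nat set set \<Rightarrow> (nat \<Rightarrow> real) set" where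
  "geometric_realization K =
     {x. (\<forall>v. 0 \<le> x v) \<and> {v. x v \<noteq> 0} \<in> K \<and> (\<Sum>v | x v \<noteq> 0. x v) = 1}"

text \<open>For a connected complex the choice of base point is immaterial.\<close>

definition has_fundamental_group :: "nat set set \<Rightarrow> ('a, 'b) monoid_scheme \<Rightarrow> bool" where
  "has_fundamental_group K G \<longleftrightarrow>
     (\<exists>x\<in>geometric_realization K. fundamental_group (geometric_realization K) x \<cong> G)"

definition simplicial_complexity :: "('a, 'b) monoid_scheme \<Rightarrow> nat" where
  "simplicial_complexity G =
     (LEAST n. \<exists>K. finite_abstract_complex K \<and> (\<forall>\<sigma>\<in>K. card \<sigma> \<le> 3) \<and>
        connected (geometric_realization K) \<and> has_fundamental_group K G \<and>
        card {\<sigma>\<in>K. card \<sigma> = 3} = n)"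

text \<open>The empty list is admitted: it is the list of invariant factors of the trivial group.\<close>

definition invariant_factors :: "('a, 'b) monoid_scheme \<Rightarrow> nat list \<Rightarrow> bool" where
  "invariant_factors G ns \<longleftrightarrow>
     (\<forall>n\<in>set ns. 2 \<le> n) \<and> sorted_wrt (dvd) ns \<and>
     G \<cong> sum_group {..<length ns} (\<lambda>i. integer_mod_group (ns ! i))"

definition num_invariant_factors :: "('a, 'b) monoid_scheme \<Rightarrow> nat" where
  "num_invariant_factors G = (THE s. \<exists>ns. invariant_factors G ns \<and> length ns = s)"

end

theory Submission
  imports Defs "Jordan_Normal_Form.Determinant" "HOL-Number_Theory.Number_Theory"
begin

text \<open>Lower bound: fix a spanning tree of the 1-skeleton of a complex with fundamental group \<open>G\<close>.
  Pushing loops onto edges shows that \<open>G\<close> is generated by its edges; the tree edges and the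
  boundaries of the triangles are relations. An integer cocycle that vanishes on the tree is zero, as
  its reductions modulo large \<open>n\<close> would otherwise be detected by \<open>n\<close>-sheeted coverings; hence the
  relation matrix has a nonsingular maximal minor. Its determinant bounds \<open>|G|\<close>, and Hadamard's
  inequality bounds the determinant, a triangle contributing a row of norm \<open>\<surd>3\<close> and a tree edge a row
  of norm 1.

  Upper bound: for a set of pairs \<open>(a, b)\<close> of elements of \<open>G\<close>, a tripartite complex on three copies
  of \<open>G\<close> has the fundamental group with generators \<open>A a\<close>, \<open>B b\<close>, \<open>D d\<close> and relations
  \<open>A a \<cdot> B b = D (a b)\<close>, at the price of at most four triangles per pair. Doubling along the binary
  expansions of the invariant factors yields the cyclic summands, and two more pairs make two
  generators commute.\<close>

section \<open>Invariant factors\<close>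

text \<open>No presentation of a fundamental group is ever computed. Besides the tree and triangle
  relations, the topological inputs are that edge classes generate \<open>FG\<close> and that a
  normalised cocycle with values in a finite group induces a homomorphism on \<open>FG\<close>. For
  the upper bound this suffices because the relations hold in \<open>G\<close> itself: the labels of
  the tripartite complex define a cocycle with values in \<open>G\<close>, and its monodromy is a
  left inverse of a surjection from \<open>G\<close> to \<open>FG\<close> obtained from the
  relations. For the lower bound an integer cocycle would need infinitely many sheets; modulo an
  \<open>n\<close> larger than |G| times the entry at hand it needs finitely many, and finiteness of
  \<open>FG\<close> makes |G| times the entry vanish modulo \<open>n\<close>, hence vanish.
  Constants: the squared norm 3 of a triangle row gives |G|^2 \<le> 3^k for k triangles. A chain
  costs 7 triangles at the start and 10 or 11 per halving, at most 14 log2 n + 3 when n \<ge> 2; a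
  commuting pair of generators costs 2 * 4. The terms in s add up to 4 s^2 - s, which is at most 7
  s^2 - 4 s as s \<le> s^2.\<close>

context comm_group
begin

text \<open>With \<open>k = ord (u \<otimes> v)\<close>, the power \<open>k * ord v\<close> kills
  both \<open>u \<otimes> v\<close> and \<open>v\<close>, hence \<open>u\<close>; so
  \<open>ord u\<close> divides \<open>k * ord v\<close>, and by coprimality \<open>k\<close>. The
  same holds for \<open>v\<close>.\<close>

lemma ord_mult_coprime:
  assumes x: "x \<in> carrier G" "y \<in> carrier G" and co: "coprime (ord x) (ord y)"
  shows "ord (x \<otimes> y) = ord x * ord y"
proof (rule dvd_antisym)
  show "ord (x \<otimes> y) dvd ord x * ord y" using x by (rule abelian_ord_mul_divides)
  have *: "ord u dvd ord (u \<otimes> v)" if u: "u \<in> carrier G" "v \<in> carrier G" "coprime (ord u) (ord v)" for u v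
  proof -
    let ?k = "ord (u \<otimes> v)"
    have "u [^] (?k * ord v) = (u \<otimes> v) [^] (?k * ord v)"
    proof -
      have "v [^] (?k * ord v) = \<one>" using u pow_eq_id by auto
      then show ?thesis using u by (simp add: pow_mult_distrib m_comm)
    qed
    also have "\<dots> = \<one>" using u pow_eq_id by auto
    finally have "ord u dvd ?k * ord v" using u pow_eq_id by blast
    then show ?thesis using u(3) by (simp add: coprime_dvd_mult_left_iff)
  qed
  have "ord x dvd ord (x \<otimes> y)" using * x co by blast
  moreover have "ord y dvd ord (x \<otimes> y)"
    using *[of y x] x co by (simp add: coprime_commute m_comm)
  ultimately show "ord x * ord y dvd ord (x \<otimes> y)" using co by (simp add: divides_mult)
qed

text \<open>An element of maximal order does it: if a prime \<open>p\<close> divided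
  \<open>ord x\<close> to a higher power than \<open>ord a\<close>, the \<open>p\<close>-free part
  of \<open>a\<close> times the \<open>p\<close>-primary part of \<open>x\<close> would have larger
  order.\<close>

lemma exists_exponent_element:
  assumes fin: "finite (carrier G)"
  obtains a where "a \<in> carrier G" "\<And>x. x \<in> carrier G \<Longrightarrow> x [^] ord a = \<one>"
proof -
  have fin': "finite (ord ` carrier G)" "ord ` carrier G \<noteq> {}" using fin one_closed by blast+
  obtain a where a: "a \<in> carrier G" "ord a = Max (ord ` carrier G)"
    using Max_in[OF fin'] by force
  have max: "ord x \<le> ord a" if "x \<in> carrier G" for x using a(2) fin' that by simp
  have "ord x dvd ord a" if x: "x \<in> carrier G" for x
  proof (rule ccontr)
    have pos: "ord y > 0" if "y \<in> carrier G" for y using ord_ge_1[OF fin that] by simp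
    assume "\<not> ord x dvd ord a"
    then have "\<exists>p. prime p \<and> \<not> multiplicity p (ord x) \<le> multiplicity p (ord a)"
      using multiplicity_le_imp_dvd[of "ord x" "ord a"] pos[OF x] by auto
    then obtain p where p: "prime p" "multiplicity p (ord a) < multiplicity p (ord x)" by auto
    define e where "e = multiplicity p (ord a)"
    define f where "f = multiplicity p (ord x)"
    have np: "\<not> is_unit p" using p(1) not_prime_unit by blast
    have nz: "ord a \<noteq> 0" "ord x \<noteq> 0" using pos[OF a(1)] pos[OF x] by simp_all
    obtain m where m: "ord a = p ^ e * m" "\<not> p dvd m"
      unfolding e_def using multiplicity_decompose'[OF nz(1) np] by blast
    obtain l where l: "ord x = p ^ f * l" "\<not> p dvd l"
      unfolding f_def using multiplicity_decompose'[OF nz(2) np] by blast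
    have p0: "p > 0" using p(1) prime_gt_0_nat by blast
    have oa: "ord (a [^] (p ^ e)) = m"
      using a(1) m pos[OF a(1)] p0 by (subst ord_pow) auto
    have ox: "ord (x [^] l) = p ^ f"
      using x l pos[OF x] p0 by (subst ord_pow) auto
    have "coprime m (p ^ f)" using p m(2) by (simp add: coprime_commute[of m] prime_imp_coprime)
    then have "ord (a [^] (p ^ e) \<otimes> x [^] l) = m * p ^ f"
      using ord_mult_coprime[of "a [^] (p ^ e)" "x [^] l"] oa ox a x by simp
    then have "m * p ^ f \<le> ord a" using max[of "a [^] (p ^ e) \<otimes> x [^] l"] a x by simp
    moreover have "p ^ e < p ^ f" using p prime_gt_1_nat by (simp add: e_def f_def)
    moreover have "m > 0" using m pos[OF a(1)] by auto
    ultimately show False using m by (simp add: mult.commute)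
  qed
  then show ?thesis using that a(1) pow_eq_id by blast
qed

text \<open>\<open>H\<close> is a largest subgroup that meets the powers of \<open>a\<close>
  trivially. An \<open>x\<close> outside \<open>D\<close>, the product of \<open>H\<close> with
  these powers, could be changed by a power of \<open>a\<close> into a \<open>y\<close> that
  enlarges \<open>H\<close>; the exponent hypothesis makes this change possible.\<close>

lemma exponent_element_has_complement:
  assumes fin: "finite (carrier G)" and a: "a \<in> carrier G"
    and exp: "\<And>x. x \<in> carrier G \<Longrightarrow> x [^] ord a = \<one>"
  obtains H where "subgroup H G" "\<And>z::int. a [^] z \<in> H \<Longrightarrow> a [^] z = \<one>"
    "\<And>x. x \<in> carrier G \<Longrightarrow> \<exists>h\<in>H. \<exists>z::int. x = h \<otimes> a [^] z"
proof -
  let ?P = "\<lambda>H. subgroup H G \<and> (\<forall>z::int. a [^] z \<in> H \<longrightarrow> a [^] z = \<one>)"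
  have "?P {\<one>}" using triv_subgroup by auto
  moreover have "\<forall>H. ?P H \<longrightarrow> card H < Suc (card (carrier G))"
    using fin by (auto simp: less_Suc_eq_le intro!: card_mono dest: subgroup.subset)
  ultimately obtain H where H: "?P H" and max: "\<And>H'. ?P H' \<Longrightarrow> card H' \<le> card H"
    using ex_has_greatest_nat[of ?P "{\<one>}" card "Suc (card (carrier G))"] by (metis less_imp_le)
  interpret H: subgroup H G using H by simp
  define D where "D = {h \<otimes> a [^] (z::int) | h z. h \<in> H}"
  have D: "subgroup D G"
  proof (rule subgroupI)
    show "D \<subseteq> carrier G" using a by (auto simp: D_def)
    show "D \<noteq> {}" using H.one_closed unfolding D_def by blast
    fix x y assume "x \<in> D" "y \<in> D"
    then obtain h k and z w :: int where x: "x = h \<otimes> a [^] z" "y = k \<otimes> a [^] w" "h \<in> H" "k \<in> H"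
      by (auto simp: D_def)
    have "inv x = inv h \<otimes> a [^] (- z)" using x a by (simp add: inv_mult int_pow_neg)
    then show "inv x \<in> D" using x unfolding D_def by blast
    have "x \<otimes> y = (h \<otimes> k) \<otimes> a [^] (z + w)" using x a by (simp add: int_pow_mult m_ac)
    then show "x \<otimes> y \<in> D" using x unfolding D_def by blast
  qed
  interpret D: subgroup D G by (rule D)
  have HD: "H \<subseteq> D"
  proof
    fix h assume "h \<in> H"
    then have "h = h \<otimes> a [^] (0::int)" by simp
    then show "h \<in> D" using \<open>h \<in> H\<close> unfolding D_def by blast
  qed
  have aD: "a [^] (z::int) \<in> D" for z
  proof -
    have "a [^] z = \<one> \<otimes> a [^] z" using a by simp
    then show ?thesis unfolding D_def using H.one_closed by blast
  qed
  have "x \<in> D" if x: "x \<in> carrier G" for x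
  proof (rule ccontr)
    assume xD: "x \<notin> D"
    have m: "ord a > 0" using ord_ge_1[OF fin a] by simp
    \<comment> \<open>The order of \<open>x\<close> modulo \<open>D\<close>; it divides every
      exponent that leads into \<open>D\<close>.\<close>
    define k where "k = (LEAST k::nat. 0 < k \<and> x [^] k \<in> D)"
    have k: "0 < k" "x [^] k \<in> D" and kmin: "\<And>j. 0 < j \<Longrightarrow> x [^] (j::nat) \<in> D \<Longrightarrow> k \<le> j"
      using LeastI[of "\<lambda>k. 0 < k \<and> x [^] k \<in> D" "ord a"] m exp[OF x] Least_le[of "\<lambda>k. 0 < k \<and> x [^] k \<in> D"]
      by (auto simp: k_def)
    have kdvd: "int k dvd j" if "x [^] (j::int) \<in> D" for j
    proof -
      have "x [^] (j mod int k) = x [^] (j + int k * (- (j div int k)))"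
        by (simp add: minus_mult_div_eq_mod)
      also have "\<dots> = x [^] j \<otimes> (x [^] k) [^] (- (j div int k))"
        using x by (simp only: int_pow_mult int_pow_pow[symmetric] int_pow_int)
      also have "\<dots> \<in> D"
        using D.m_closed[OF that subgroup_int_pow_closed[OF D k(2)]] .
      finally have "x [^] int (nat (j mod int k)) \<in> D" using k(1) by simp
      then have "x [^] nat (j mod int k) \<in> D" by (simp only: int_pow_int)
      moreover have "nat (j mod int k) < k" using k(1) by (simp add: nat_less_iff)
      ultimately have "nat (j mod int k) = 0" using kmin by (meson linorder_not_le not_gr_zero)
      then have "j mod int k \<le> 0" by simp
      moreover have "j mod int k \<ge> 0" using k(1) by simp
      ultimately show ?thesis by (simp add: dvd_eq_mod_eq_0)
    qed
    obtain h and j :: int where hj: "h \<in> H" "x [^] k = h \<otimes> a [^] j" using k(2) by (auto simp: D_def)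
    \<comment> \<open>The exponent hypothesis enters here: \<open>k\<close> divides
      \<open>ord a\<close>, and comparing with \<open>x [^] k = h \<otimes> a [^] j\<close> then
      shows that \<open>k\<close> divides \<open>j\<close>.\<close>
    have "x [^] int (ord a) = \<one>" using exp[OF x] by (simp add: int_pow_int)
    then have "x [^] int (ord a) \<in> D" by simp
    then have "int k dvd int (ord a)" by (rule kdvd)
    then obtain q where q: "ord a = k * q" by (auto simp: int_dvd_int_iff)
    have "\<one> = (x [^] k) [^] q" using exp[OF x] q x by (simp add: nat_pow_pow)
    also have "\<dots> = h [^] q \<otimes> a [^] (j * int q)"
      using hj a by (simp add: pow_mult_distrib m_comm int_pow_pow[symmetric] int_pow_int)
    finally have 1: "h [^] q \<otimes> a [^] (j * int q) = \<one>" by simp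
    have hq: "h [^] q \<in> H" using hj(1) by (metis H.subgroup_axioms int_pow_int subgroup_int_pow_closed)
    have "a [^] (j * int q) = inv (h [^] q)" using 1 hj a by (metis H.mem_carrier hq int_pow_closed inv_equality m_comm)
    then have "a [^] (j * int q) \<in> H" using hq by simp
    then have "a [^] (j * int q) = \<one>" using H by blast
    then have "int (ord a) dvd j * int q" using a by (simp add: int_pow_eq_id)
    then have "int k dvd j" using q m by simp
    then obtain i where i: "j = int k * i" by auto
    \<comment> \<open>Division by a \<open>k\<close>-th root of the \<open>a\<close>-part of
      \<open>x [^] k\<close>: \<open>y\<close> stays in the coset of \<open>x\<close> modulo
      \<open>D\<close>, but \<open>y [^] k\<close> lies in \<open>H\<close>.\<close>
    define y where "y = x \<otimes> a [^] (- i)"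
    have y: "y \<in> carrier G" using x a by (simp add: y_def)
    have yk: "y [^] k = h"
    proof -
      have "y [^] int k = x [^] int k \<otimes> a [^] (- j)"
        using x a by (simp add: y_def int_pow_mult_distrib m_comm int_pow_pow i mult.commute)
      then show ?thesis using hj a by (simp add: int_pow_int m_assoc int_pow_neg)
    qed
    have xy: "y [^] (z::int) \<in> D \<longleftrightarrow> x [^] z \<in> D" for z
    proof -
      have "y [^] z = x [^] z \<otimes> a [^] (- i * z)"
        using x a by (simp add: y_def int_pow_mult_distrib m_comm int_pow_pow)
      moreover from this have "x [^] z = y [^] z \<otimes> a [^] (i * z)" using x a by (simp add: m_assoc int_pow_neg)
      ultimately show ?thesis using aD by (metis D.m_closed)
    qed
    define H' where "H' = {g \<otimes> y [^] (z::int) | g z. g \<in> H}"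
    have "subgroup H' G"
    proof (rule subgroupI)
      show "H' \<subseteq> carrier G" using y by (auto simp: H'_def)
      show "H' \<noteq> {}" using H.one_closed unfolding H'_def by blast
      fix u v assume "u \<in> H'" "v \<in> H'"
      then obtain g g' and z w :: int where u: "u = g \<otimes> y [^] z" "v = g' \<otimes> y [^] w" "g \<in> H" "g' \<in> H"
        by (auto simp: H'_def)
      have "inv u = inv g \<otimes> y [^] (- z)" using u y by (simp add: inv_mult int_pow_neg)
      then show "inv u \<in> H'" using u unfolding H'_def by blast
      have "u \<otimes> v = (g \<otimes> g') \<otimes> y [^] (z + w)" using u y by (simp add: int_pow_mult m_ac)
      then show "u \<otimes> v \<in> H'" using u unfolding H'_def by blast
    qed
    \<comment> \<open>A power of \<open>a\<close> in \<open>H'\<close> involves a power of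
      \<open>y\<close> that lies in \<open>D\<close>; its exponent is a multiple of
      \<open>k\<close>, so that power of \<open>y\<close> is already in \<open>H\<close>.\<close>
    moreover have "a [^] z = \<one>" if az: "a [^] z \<in> H'" for z :: int
    proof -
      obtain g and w :: int where g: "a [^] z = g \<otimes> y [^] w" "g \<in> H" using az unfolding H'_def by blast
      then have "y [^] w = inv g \<otimes> a [^] z" using y by (simp add: m_assoc[symmetric])
      then have "y [^] w \<in> D" using aD HD g(2) by auto
      then have "int k dvd w" using xy kdvd by blast
      then obtain c where c: "w = int k * c" by auto
      have "y [^] w = h [^] c" using yk y c by (simp add: int_pow_pow[symmetric] int_pow_int)
      then have "y [^] w \<in> H" using hj(1) by (simp add: H.subgroup_axioms subgroup_int_pow_closed)
      then have "a [^] z \<in> H" using g by simp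
      then show ?thesis using H by blast
    qed
    ultimately have "card H' \<le> card H" using max by blast
    moreover have "H \<subseteq> H'"
    proof
      fix h assume "h \<in> H"
      then have "h = h \<otimes> y [^] (0::int)" by simp
      then show "h \<in> H'" using \<open>h \<in> H\<close> unfolding H'_def by blast
    qed
    moreover have "finite H'" using fin \<open>subgroup H' G\<close> by (meson finite_subset subgroup.subset)
    ultimately have "H' = H" by (metis card_seteq)
    have "y = \<one> \<otimes> y [^] (1::int)" using y by simp
    then have "y \<in> H'" unfolding H'_def using H.one_closed by blast
    then have "y [^] (1::int) \<in> D" using \<open>H' = H\<close> HD y by auto
    then show False using xy[of 1] xD x by simp
  qed
  then show ?thesis using that[of H] H unfolding D_def by blast
qed

end

text \<open>An ordered product instead of \<open>finprod\<close>, because it is also formed in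
  fundamental groups that are not yet known to be abelian. The exponents form a function, so that an
  element of a \<open>cyclic_sum\<close> can serve as the list of exponents.\<close>

primrec power_prod :: "('a, 'b) monoid_scheme \<Rightarrow> (nat \<Rightarrow> 'a) \<Rightarrow> nat \<Rightarrow> (nat \<Rightarrow> int) \<Rightarrow> 'a"
  where "power_prod G g 0 k = \<one>\<^bsub>G\<^esub>"
  | "power_prod G g (Suc s) k = power_prod G g s k \<otimes>\<^bsub>G\<^esub> g s [^]\<^bsub>G\<^esub> k s"

lemma power_prod_cong:
  assumes "\<And>i. i < s \<Longrightarrow> g i = g' i" "\<And>i. i < s \<Longrightarrow> k i = k' i"
  shows "power_prod G g s k = power_prod G g' s k'"
  using assms by (induction s) auto

lemma power_prod_subgroup:
  assumes "group G" "subgroup H G" "\<And>i. i < s \<Longrightarrow> g i \<in> H"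
  shows "power_prod (G\<lparr>carrier := H\<rparr>) g s k = power_prod G g s k"
  using assms(3) by (induction s) (auto simp: group.int_pow_consistent[OF assms(1,2)])

abbreviation cyclic_sum :: "nat list \<Rightarrow> (nat \<Rightarrow> int) monoid"
  where "cyclic_sum ns \<equiv> sum_group {..<length ns} (\<lambda>i. integer_mod_group (ns ! i))"

lemma group_cyclic_sum: "group (cyclic_sum ns)"
  by (rule sum_group) simp

lemma carrier_cyclic_sum:
  assumes "\<forall>n\<in>set ns. 0 < n"
  shows "carrier (cyclic_sum ns) = (\<Pi>\<^sub>E i\<in>{..<length ns}. {0..<int (ns ! i)})"
proof -
  have "carrier (integer_mod_group (ns ! i)) = {0..<int (ns ! i)}" if "i < length ns" for i
    using assms that by (simp add: carrier_integer_mod_group)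
  then have "(\<Pi>\<^sub>E i\<in>{..<length ns}. carrier (integer_mod_group (ns ! i)))
      = (\<Pi>\<^sub>E i\<in>{..<length ns}. {0..<int (ns ! i)})"
    by (intro PiE_cong) simp
  then show ?thesis by (simp add: carrier_sum_group)
qed

lemma card_cyclic_sum:
  assumes "\<forall>n\<in>set ns. 0 < n"
  shows "finite (carrier (cyclic_sum ns))" "card (carrier (cyclic_sum ns)) = prod_list ns"
proof -
  show "finite (carrier (cyclic_sum ns))"
    unfolding carrier_cyclic_sum[OF assms] by (intro finite_PiE) auto
  have "card (carrier (cyclic_sum ns)) = (\<Prod>i<length ns. ns ! i)"
    unfolding carrier_cyclic_sum[OF assms] by (subst card_PiE) auto
  also have "\<dots> = prod_list ns"
    by (simp add: prod.list_conv_set_nth atLeast0LessThan)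
  finally show "card (carrier (cyclic_sum ns)) = prod_list ns" .
qed

context group
begin

lemma power_prod_closed:
  assumes "\<And>i. i < s \<Longrightarrow> g i \<in> carrier G"
  shows "power_prod G g s k \<in> carrier G"
  using assms by (induction s) auto

lemma int_pow_commute:
  assumes "x \<in> carrier G" "y \<in> carrier G" "x \<otimes> y = y \<otimes> x"
  shows "x \<otimes> y [^] (z::int) = y [^] z \<otimes> x"
proof -
  have "x [^] (1::int) \<otimes> y [^] z = y [^] z \<otimes> x [^] (1::int)"
  proof -
    have *: "a \<otimes> b [^] (n::nat) = b [^] n \<otimes> a" if "a \<in> carrier G" "b \<in> carrier G" "a \<otimes> b = b \<otimes> a" for a b n
    proof (induction n)
      case (Suc n)
      have "a \<otimes> b [^] Suc n = a \<otimes> b [^] n \<otimes> b" using that by (simp add: m_assoc)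
      also have "\<dots> = b [^] n \<otimes> (b \<otimes> a)" using Suc that by (simp add: m_assoc)
      finally show ?case using that by (simp add: m_assoc)
    qed (use that in simp)
    have "x = inv y \<otimes> x \<otimes> y" using assms by (simp add: m_assoc inv_solve_left)
    then have inv: "x \<otimes> inv y = inv y \<otimes> x" using assms by (simp add: inv_solve_right' m_closed)
    show ?thesis
    proof (cases "z \<ge> 0")
      case True
      then obtain n where "z = int n" by (metis nonneg_int_cases)
      then show ?thesis using *[of x y n] assms by (simp add: int_pow_int)
    next
      case False
      then obtain n where "z = - int n" by (metis linorder_not_le neg_int_cases)
      then show ?thesis using *[of x "inv y" n] assms inv by (simp add: int_pow_neg int_pow_int inv_closed nat_pow_inv)
    qed
  qed
  then show ?thesis using assms by simp
qed

lemma power_prod_commute: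
  assumes "\<And>i. i < s \<Longrightarrow> g i \<in> carrier G" "x \<in> carrier G" "\<And>i. i < s \<Longrightarrow> x \<otimes> g i = g i \<otimes> x"
  shows "x \<otimes> power_prod G g s k = power_prod G g s k \<otimes> x"
  using assms(1,3)
proof (induction s)
  case (Suc s)
  have c: "power_prod G g s k \<in> carrier G" using Suc.prems by (intro power_prod_closed) auto
  have "x \<otimes> power_prod G g (Suc s) k = (x \<otimes> power_prod G g s k) \<otimes> g s [^] k s"
    using Suc.prems assms(2) c by (simp add: m_assoc)
  also have "\<dots> = power_prod G g s k \<otimes> (x \<otimes> g s [^] k s)"
    using Suc assms(2) c by (simp add: m_assoc)
  also have "x \<otimes> g s [^] k s = g s [^] k s \<otimes> x"
    using Suc.prems assms(2) by (intro int_pow_commute) auto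
  finally show ?case using Suc.prems assms(2) c by (simp add: m_assoc)
qed (use assms in simp)

lemma power_prod_add:
  assumes "\<And>i. i < s \<Longrightarrow> g i \<in> carrier G"
    and "\<And>i j. i < s \<Longrightarrow> j < s \<Longrightarrow> g i \<otimes> g j = g j \<otimes> g i"
  shows "power_prod G g s (\<lambda>i. k i + l i) = power_prod G g s k \<otimes> power_prod G g s l"
  using assms
proof (induction s)
  case (Suc s)
  let ?K = "power_prod G g s k" and ?L = "power_prod G g s l"
  have c: "?K \<in> carrier G" "?L \<in> carrier G" using Suc.prems by (auto intro!: power_prod_closed)
  have gs: "g s \<in> carrier G" using Suc.prems by auto
  have "g s \<otimes> ?L = ?L \<otimes> g s" using Suc.prems by (intro power_prod_commute) auto
  then have com: "?L \<otimes> g s [^] k s = g s [^] k s \<otimes> ?L" using c gs by (intro int_pow_commute) auto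
  have "power_prod G g (Suc s) (\<lambda>i. k i + l i) = (?K \<otimes> ?L) \<otimes> (g s [^] k s \<otimes> g s [^] l s)"
    using Suc gs by (simp add: int_pow_mult)
  also have "\<dots> = ?K \<otimes> (?L \<otimes> g s [^] k s) \<otimes> g s [^] l s"
    using c gs by (simp add: m_assoc)
  also have "\<dots> = power_prod G g (Suc s) k \<otimes> power_prod G g (Suc s) l"
    unfolding com using c gs by (simp add: m_assoc)
  finally show ?case .
qed simp

lemma int_pow_mod:
  assumes "x \<in> carrier G" "x [^] n = \<one>"
  shows "x [^] (k mod int n) = x [^] k"
proof -
  have "x [^] k = x [^] (int n * (k div int n) + k mod int n)" by simp
  also have "\<dots> = (x [^] int n) [^] (k div int n) \<otimes> x [^] (k mod int n)"
    using assms(1) by (simp only: int_pow_mult int_pow_pow)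
  also have "\<dots> = x [^] (k mod int n)" using assms by (simp add: int_pow_int)
  finally show ?thesis by simp
qed

lemma power_prod_mod:
  assumes "\<And>i. i < s \<Longrightarrow> g i \<in> carrier G" "\<And>i. i < s \<Longrightarrow> g i [^] (n i :: nat) = \<one>"
  shows "power_prod G g s (\<lambda>i. k i mod int (n i)) = power_prod G g s k"
  using assms by (induction s) (auto simp: int_pow_mod)

text \<open>Reducing an exponent modulo \<open>ns ! i\<close> is harmless since
  \<open>g i [^] (ns ! i) = \<one>\<close>, and commutation of the \<open>g i\<close> splits the
  product: the universal property of the direct sum for a target that may be nonabelian.\<close>

lemma power_prod_hom:
  assumes "\<And>i. i < length ns \<Longrightarrow> g i \<in> carrier G"
    and "\<And>i. i < length ns \<Longrightarrow> g i [^] (ns ! i) = \<one>"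
    and "\<And>i j. i < length ns \<Longrightarrow> j < length ns \<Longrightarrow> g i \<otimes> g j = g j \<otimes> g i"
  shows "power_prod G g (length ns) \<in> hom (cyclic_sum ns) G"
proof (rule homI)
  fix x y
  show "power_prod G g (length ns) x \<in> carrier G" using assms(1) by (rule power_prod_closed)
  have "power_prod G g (length ns) (x \<otimes>\<^bsub>cyclic_sum ns\<^esub> y)
      = power_prod G g (length ns) (\<lambda>i. (x i + y i) mod int (ns ! i))"
    by (rule power_prod_cong) auto
  also have "\<dots> = power_prod G g (length ns) x \<otimes> power_prod G g (length ns) y"
    using assms by (simp add: power_prod_mod power_prod_add)
  finally show "power_prod G g (length ns) (x \<otimes>\<^bsub>cyclic_sum ns\<^esub> y)
      = power_prod G g (length ns) x \<otimes> power_prod G g (length ns) y" .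
qed

end

text \<open>Induction on the order: an element \<open>a\<close> whose order is the exponent is split
  off, with complement \<open>H\<close>. Every factor of \<open>H\<close> divides the exponent, so
  \<open>ord a\<close> may be appended at the end of the divisor chain.\<close>

lemma cyclic_decomposition:
  assumes "comm_group G" and "finite (carrier G)"
  shows "\<exists>ns g. (\<forall>n\<in>set ns. 2 \<le> n) \<and> sorted_wrt (dvd) ns \<and>
    (\<forall>i<length ns. g i \<in> carrier G \<and> group.ord G (g i) = ns ! i) \<and>
    (\<forall>x\<in>carrier G. \<exists>k. x = power_prod G g (length ns) k) \<and> order G = prod_list ns"
  using assms
proof (induction "order G" arbitrary: G rule: less_induct)
  case (less G)
  interpret comm_group G by fact
  note fin = \<open>finite (carrier G)\<close>
  show ?case
  proof (cases "carrier G = {\<one>\<^bsub>G\<^esub>}")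
    case True
    then show ?thesis by (intro exI[of _ "[]"] exI[of _ "\<lambda>_. \<one>\<^bsub>G\<^esub>"]) (simp add: order_def)
  next
    case False
    obtain a where a: "a \<in> carrier G" "\<And>x. x \<in> carrier G \<Longrightarrow> x [^]\<^bsub>G\<^esub> ord a = \<one>\<^bsub>G\<^esub>"
      using exists_exponent_element[OF fin] by blast
    define n where "n = ord a"
    have n1: "n \<ge> 1" unfolding n_def using fin a(1) by (rule ord_ge_1)
    have "n \<noteq> 1"
    proof
      assume "n = 1"
      then have "\<And>x. x \<in> carrier G \<Longrightarrow> x = \<one>\<^bsub>G\<^esub>" using a(2) n_def by force
      then show False using False one_closed by blast
    qed
    then have n2: "n \<ge> 2" using n1 by simp
    obtain H where H: "subgroup H G" "\<And>z::int. a [^]\<^bsub>G\<^esub> z \<in> H \<Longrightarrow> a [^]\<^bsub>G\<^esub> z = \<one>\<^bsub>G\<^esub>"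
      "\<And>x. x \<in> carrier G \<Longrightarrow> \<exists>h\<in>H. \<exists>z::int. x = h \<otimes>\<^bsub>G\<^esub> a [^]\<^bsub>G\<^esub> z"
      using exponent_element_has_complement[OF fin a(1) a(2)] by blast
    interpret H: subgroup H G by (rule H)
    let ?H = "G\<lparr>carrier := H\<rparr>"
    have HC: "comm_group ?H" 
      by (rule group.group_comm_groupI[OF subgroup_imp_group[OF H(1)]]) (auto simp: m_comm)
    interpret HH: comm_group ?H by (rule HC)
    have finH: "finite H" using fin H.subset by (rule finite_subset[rotated])
    define \<phi> where "\<phi> = (\<lambda>(h, z::int). h \<otimes>\<^bsub>G\<^esub> a [^]\<^bsub>G\<^esub> z)"
    have amod: "a [^]\<^bsub>G\<^esub> (z mod int n) = a [^]\<^bsub>G\<^esub> z" for z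
      using a(1) by (intro int_pow_mod) (auto simp: n_def)
    have "bij_betw \<phi> (H \<times> {0..<int n}) (carrier G)"
    proof (rule bij_betw_imageI)
      show "inj_on \<phi> (H \<times> {0..<int n})"
      proof (rule inj_onI, clarsimp simp: \<phi>_def)
        fix h z h' z' assume *: "h \<in> H" "h' \<in> H" "0 \<le> z" "z < int n" "0 \<le> z'" "z' < int n"
          "h \<otimes>\<^bsub>G\<^esub> a [^]\<^bsub>G\<^esub> z = h' \<otimes>\<^bsub>G\<^esub> a [^]\<^bsub>G\<^esub> z'"
        have "a [^]\<^bsub>G\<^esub> (z - z') = inv\<^bsub>G\<^esub> h \<otimes>\<^bsub>G\<^esub> h'"
        proof -
          have "inv\<^bsub>G\<^esub> h \<otimes>\<^bsub>G\<^esub> (h \<otimes>\<^bsub>G\<^esub> a [^]\<^bsub>G\<^esub> z) \<otimes>\<^bsub>G\<^esub> inv\<^bsub>G\<^esub> (a [^]\<^bsub>G\<^esub> z')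
              = inv\<^bsub>G\<^esub> h \<otimes>\<^bsub>G\<^esub> (h' \<otimes>\<^bsub>G\<^esub> a [^]\<^bsub>G\<^esub> z') \<otimes>\<^bsub>G\<^esub> inv\<^bsub>G\<^esub> (a [^]\<^bsub>G\<^esub> z')" using * by simp
          then show ?thesis using * a(1) by (simp add: m_assoc inv_solve_left int_pow_diff flip: m_assoc) (simp add: m_assoc)
        qed
        also have "\<dots> \<in> H" using * by simp
        finally have "a [^]\<^bsub>G\<^esub> (z - z') = \<one>\<^bsub>G\<^esub>" by (rule H(2))
        then have "int n dvd z - z'" using a(1) by (simp add: int_pow_eq_id n_def)
        then have zz: "z = z'" using * by (metis mod_eq_dvd_iff mod_pos_pos_trivial)
        then have "h = h'" using * a(1) by (metis H.mem_carrier int_pow_closed right_cancel)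
        then show "h = h' \<and> z = z'" using zz by simp
      qed
      show "\<phi> ` (H \<times> {0..<int n}) = carrier G"
      proof
        show "\<phi> ` (H \<times> {0..<int n}) \<subseteq> carrier G" using a(1) by (auto simp: \<phi>_def)
        show "carrier G \<subseteq> \<phi> ` (H \<times> {0..<int n})"
        proof
          fix x assume "x \<in> carrier G"
          then obtain h and z :: int where "h \<in> H" "x = h \<otimes>\<^bsub>G\<^esub> a [^]\<^bsub>G\<^esub> z" using H(3) by blast
          then have "x = \<phi> (h, z mod int n)" "(h, z mod int n) \<in> H \<times> {0..<int n}"
            using n1 by (auto simp: \<phi>_def amod)
          then show "x \<in> \<phi> ` (H \<times> {0..<int n})" by blast
        qed
      qed
    qed
    then have card: "order G = card H * n"
      by (simp add: order_def bij_betw_same_card[symmetric] card_cartesian_product)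
    have "card H > 0" using finH H.one_closed by (metis card_gt_0_iff empty_iff)
    then have "order ?H < order G" using n2 card by (simp add: order_def)
    from less.hyps[OF this HC] finH obtain ns g where
      IH: "\<forall>n\<in>set ns. 2 \<le> n" "sorted_wrt (dvd) ns" "\<forall>i<length ns. g i \<in> H \<and> HH.ord (g i) = ns ! i"
        "\<forall>x\<in>H. \<exists>k. x = power_prod ?H g (length ns) k" "card H = prod_list ns"
      by (auto simp: order_def)
    define g' where "g' = g(length ns := a)"
    have gord: "ord (g i) = ns ! i" if "i < length ns" for i
    proof -
      have "ord (g i) = HH.ord (g i)"
        unfolding ord_def HH.ord_def by (simp add: nat_pow_consistent[symmetric])
      then show ?thesis using IH(3) that by simp
    qed
    have "ns ! i dvd n" if "i < length ns" for i
      using a(2)[of "g i"] IH(3) gord that H.subset pow_eq_id[of "g i" n] unfolding n_def by auto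
    then have "sorted_wrt (dvd) (ns @ [n])" using IH(2) by (auto simp: sorted_wrt_append in_set_conv_nth)
    moreover have "\<exists>k. x = power_prod G g' (length (ns @ [n])) k" if xG: "x \<in> carrier G" for x
    proof -
      obtain h and z :: int where hz: "h \<in> H" "x = h \<otimes>\<^bsub>G\<^esub> a [^]\<^bsub>G\<^esub> z" using H(3)[OF xG] by blast
      obtain k where "h = power_prod ?H g (length ns) k" using IH(4) hz(1) by blast
      also have "\<dots> = power_prod G g (length ns) k"
        using H(1) IH(3) by (intro power_prod_subgroup) auto
      also have "\<dots> = power_prod G g' (length ns) (k(length ns := z))"
        by (rule power_prod_cong) (auto simp: g'_def)
      finally have "x = power_prod G g' (length (ns @ [n])) (k(length ns := z))"
        using hz(2) by (simp add: g'_def)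
      then show ?thesis by blast
    qed
    moreover have "\<forall>i<length (ns @ [n]). g' i \<in> carrier G \<and> ord (g' i) = (ns @ [n]) ! i"
      using gord IH(3) a(1) by (auto simp: g'_def nth_append less_Suc_eq n_def)
    moreover have "order G = prod_list (ns @ [n])" using card IH(5) by simp
    ultimately show ?thesis using IH(1) n2 by (intro exI[of _ "ns @ [n]"] exI[of _ g']) auto
  qed
qed

text \<open>The power product of the generators maps \<open>cyclic_sum ns\<close> onto
  \<open>G\<close>; both have \<open>prod_list ns\<close> elements, so it is injective.\<close>

lemma (in comm_group) invariant_factors_exist:
  assumes "finite (carrier G)"
  shows "\<exists>ns. invariant_factors G ns"
proof -
  obtain ns g where *: "\<forall>n\<in>set ns. 2 \<le> n" "sorted_wrt (dvd) ns"
    "\<forall>i<length ns. g i \<in> carrier G \<and> ord (g i) = ns ! i"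
    "\<forall>x\<in>carrier G. \<exists>k. x = power_prod G g (length ns) k" "order G = prod_list ns"
    using cyclic_decomposition[OF comm_group_axioms assms] by blast
  have pos: "\<forall>n\<in>set ns. 0 < n" using *(1) by force
  have pow: "g i [^] (ns ! i) = \<one>" if "i < length ns" for i
    using *(3) that pow_ord_eq_1[of "g i"] by simp
  let ?S = "cyclic_sum ns" and ?f = "power_prod G g (length ns)"
  have hom: "?f \<in> hom ?S G" using *(3) pow by (intro power_prod_hom) (auto intro: m_comm)
  have "carrier G \<subseteq> ?f ` carrier ?S"
  proof
    fix x assume "x \<in> carrier G"
    then obtain k where k: "x = ?f k" using *(4) by blast
    define k' where "k' = (\<lambda>i\<in>{..<length ns}. k i mod int (ns ! i))"
    have "k' \<in> carrier ?S" using pos unfolding carrier_cyclic_sum[OF pos] k'_def by auto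
    moreover have "?f k' = ?f (\<lambda>i. k i mod int (ns ! i))" by (rule power_prod_cong) (auto simp: k'_def)
    ultimately show "x \<in> ?f ` carrier ?S" using k *(3) pow by (auto simp: power_prod_mod intro!: image_eqI[of _ _ k'])
  qed
  then have img: "?f ` carrier ?S = carrier G" using hom by (auto simp: hom_def)
  moreover have "card (carrier ?S) = card (carrier G)"
    using *(5) card_cyclic_sum(2)[OF pos] by (simp add: order_def)
  ultimately have "inj_on ?f (carrier ?S)" using card_cyclic_sum(1)[OF pos] by (intro eq_card_imp_inj_on) auto
  then have "?f \<in> iso ?S G" using hom img by (simp add: iso_def bij_betw_def)
  then have "G \<cong> ?S" using group.iso_sym[OF group_cyclic_sum] by (auto simp: is_iso_def)
  then show ?thesis using *(1,2) unfolding invariant_factors_def by blast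
qed

section \<open>Torsion counts and the number of invariant factors\<close>

lemma card_torsion_cyclic:
  assumes "0 < n" "prime p"
  shows "card {x \<in> {0..<int n}. int n dvd int p * x} = (if p dvd n then p else 1)"
proof (cases "p dvd n")
  case True
  then obtain m where m: "n = p * m" by auto
  have pm: "p > 0" "m > 0" using assms m by (auto simp: prime_gt_0_nat)
  have "{x \<in> {0..<int n}. int n dvd int p * x} = (\<lambda>j. int m * int j) ` {..<p}" (is "?L = ?R")
  proof
    show "?R \<subseteq> ?L" using pm m by (auto simp: mult.commute simp flip: of_nat_mult)
    show "?L \<subseteq> ?R"
    proof
      fix x assume x: "x \<in> ?L"
      then have "int m dvd x" using m pm by auto
      then obtain j where j: "x = int m * j" by auto
      then have "0 \<le> j" "j < int p" using x pm m
        by (auto simp: zero_le_mult_iff mult.commute[of "int p"] mult_less_cancel_left)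
      then show "x \<in> ?R" using j by (intro image_eqI[of _ _ "nat j"]) auto
    qed
  qed
  moreover have "inj_on (\<lambda>j. int m * int j) {..<p}" using pm by (auto simp: inj_on_def)
  ultimately show ?thesis using True by (simp add: card_image)
next
  case False
  then have "coprime (int n) (int p)" using assms by (simp add: prime_imp_coprime coprime_commute[of n])
  then have "{x \<in> {0..<int n}. int n dvd int p * x} = {0}"
    using assms by (auto simp: coprime_dvd_mult_right_iff zdvd_not_zless dest!: zdvd_imp_le)
  then show ?thesis using False by simp
qed

lemma nat_pow_cyclic_sum:
  "x [^]\<^bsub>cyclic_sum ns\<^esub> (k::nat) = (\<lambda>i\<in>{..<length ns}. int k * x i mod int (ns ! i))"
proof -
  interpret group "cyclic_sum ns" by (rule group_cyclic_sum)
  show ?thesis by (induction k) (auto simp: algebra_simps mod_simps)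
qed

lemma card_torsion_cyclic_sum:
  assumes pos: "\<forall>n\<in>set ns. 0 < n" and p: "prime p"
  shows "card {x \<in> carrier (cyclic_sum ns). x [^]\<^bsub>cyclic_sum ns\<^esub> p = \<one>\<^bsub>cyclic_sum ns\<^esub>}
    = (\<Prod>i<length ns. if p dvd ns ! i then p else 1)"
proof -
  interpret group "cyclic_sum ns" by (rule group_cyclic_sum)
  have "{x \<in> carrier (cyclic_sum ns). x [^]\<^bsub>cyclic_sum ns\<^esub> p = \<one>\<^bsub>cyclic_sum ns\<^esub>}
    = (\<Pi>\<^sub>E i\<in>{..<length ns}. {x \<in> {0..<int (ns ! i)}. int (ns ! i) dvd int p * x})" (is "?L = ?R")
  proof (rule Set.set_eqI)
    fix x
    have "x \<in> ?L \<longleftrightarrow> x \<in> carrier (cyclic_sum ns) \<and> (\<forall>i<length ns. int p * x i mod int (ns ! i) = 0)"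
      by (auto simp: nat_pow_cyclic_sum fun_eq_iff restrict_def)
    also have "\<dots> \<longleftrightarrow> x \<in> ?R"
      unfolding carrier_cyclic_sum[OF pos] by (auto simp: PiE_iff dvd_eq_mod_eq_0)
    finally show "x \<in> ?L \<longleftrightarrow> x \<in> ?R" .
  qed
  then have "card ?L = card ?R" by (rule arg_cong)
  also have "\<dots> = (\<Prod>i<length ns. card {x \<in> {0..<int (ns ! i)}. int (ns ! i) dvd int p * x})"
    by (rule card_PiE) simp
  also have "\<dots> = (\<Prod>i<length ns. if p dvd ns ! i then p else 1)"
    using pos p by (intro prod.cong card_torsion_cyclic) auto
  finally show ?thesis .
qed

lemma card_torsion_iso:
  assumes "group G" "group H" "G \<cong> H"
  shows "card {x \<in> carrier G. x [^]\<^bsub>G\<^esub> (p::nat) = \<one>\<^bsub>G\<^esub>} = card {x \<in> carrier H. x [^]\<^bsub>H\<^esub> p = \<one>\<^bsub>H\<^esub>}"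
proof -
  obtain f where f: "f \<in> iso G H" using assms(3) by (auto simp: is_iso_def)
  interpret group_hom G H f using assms f by (auto simp: group_hom_def group_hom_axioms_def iso_def)
  have b: "bij_betw f (carrier G) (carrier H)" using f by (simp add: iso_def)
  have "f (x [^]\<^bsub>G\<^esub> p) = \<one>\<^bsub>H\<^esub> \<longleftrightarrow> x [^]\<^bsub>G\<^esub> p = \<one>\<^bsub>G\<^esub>" if "x \<in> carrier G" for x
    using b that by (metis G.nat_pow_closed G.one_closed bij_betw_inv_into_left hom_one)
  then have *: "f x [^]\<^bsub>H\<^esub> p = \<one>\<^bsub>H\<^esub> \<longleftrightarrow> x [^]\<^bsub>G\<^esub> p = \<one>\<^bsub>G\<^esub>" if "x \<in> carrier G" for x
    using that by (simp add: hom_nat_pow)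
  have "bij_betw f {x \<in> carrier G. x [^]\<^bsub>G\<^esub> p = \<one>\<^bsub>G\<^esub>} {x \<in> carrier H. x [^]\<^bsub>H\<^esub> p = \<one>\<^bsub>H\<^esub>}"
  proof (rule bij_betw_subset[OF b])
    show "f ` {x \<in> carrier G. x [^]\<^bsub>G\<^esub> p = \<one>\<^bsub>G\<^esub>} = {x \<in> carrier H. x [^]\<^bsub>H\<^esub> p = \<one>\<^bsub>H\<^esub>}"
    proof (intro equalityI subsetI)
      fix y assume y: "y \<in> {x \<in> carrier H. x [^]\<^bsub>H\<^esub> p = \<one>\<^bsub>H\<^esub>}"
      then obtain x where "x \<in> carrier G" "y = f x" using b by (auto simp: bij_betw_def)
      then show "y \<in> f ` {x \<in> carrier G. x [^]\<^bsub>G\<^esub> p = \<one>\<^bsub>G\<^esub>}" using * y by auto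
    qed (use * b in \<open>auto simp: bij_betw_def\<close>)
  qed auto
  then show ?thesis by (rule bij_betw_same_card)
qed

text \<open>A prime \<open>p\<close> dividing the first entry of \<open>ms\<close> divides all of
  them, so \<open>x [^] p = \<one>\<close> has \<open>p ^ length ms\<close> solutions; counted
  through \<open>ns\<close> there are at most \<open>p ^ length ns\<close>.\<close>

lemma invariant_factors_length_le:
  assumes "group G" "invariant_factors G ns" "invariant_factors G ms"
  shows "length ms \<le> length ns"
proof (cases "ms = []")
  case False
  have pos: "\<forall>n\<in>set ns. 0 < n" "\<forall>n\<in>set ms. 0 < n"
    using assms by (force simp: invariant_factors_def)+
  have "2 \<le> ms ! 0" using False assms(3) by (simp add: invariant_factors_def)
  then obtain p where p: "prime p" "p dvd ms ! 0" using prime_factor_nat[of "ms ! 0"] by auto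
  have dvd: "p dvd ms ! i" if "i < length ms" for i
  proof (cases "i = 0")
    case False
    then show ?thesis using assms(3) p(2) that
      by (auto simp: invariant_factors_def sorted_wrt_iff_nth_less intro: dvd_trans)
  qed (use p in simp)
  have "p ^ length ms = (\<Prod>i<length ms. if p dvd ms ! i then p else 1)" using dvd by simp
  also have "\<dots> = (\<Prod>i<length ns. if p dvd ns ! i then p else 1)"
  proof -
    have "cyclic_sum ms \<cong> cyclic_sum ns"
      using assms group.iso_sym[OF assms(1)] iso_trans unfolding invariant_factors_def by blast
    then show ?thesis
      using card_torsion_iso[OF group_cyclic_sum group_cyclic_sum, of ms ns p]
      unfolding card_torsion_cyclic_sum[OF pos(1) p(1)] card_torsion_cyclic_sum[OF pos(2) p(1)] by blast
  qed
  also have "\<dots> \<le> (\<Prod>i<length ns. p)" using prime_ge_1_nat[OF p(1)] by (intro prod_mono) auto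
  also have "\<dots> = p ^ length ns" by simp
  finally show ?thesis using p(1) prime_gt_1_nat by (simp add: power_le_imp_le_exp)
qed simp

lemma num_invariant_factors_eq:
  assumes "group G" "invariant_factors G ns"
  shows "num_invariant_factors G = length ns"
  unfolding num_invariant_factors_def
proof (rule the_equality)
  show "\<exists>ms. invariant_factors G ms \<and> length ms = length ns" using assms(2) by blast
  show "s = length ns" if "\<exists>ms. invariant_factors G ms \<and> length ms = s" for s
    using that invariant_factors_length_le[OF assms(1)] assms(2) by (metis le_antisym)
qed

section \<open>The fundamental group of a complex\<close>

text \<open>Bundles the side conditions of concatenation and homotopy, so that they can be
  discharged by composing facts with \<open>OF\<close>.\<close>

definition joins :: "'a::topological_space set \<Rightarrow> 'a \<Rightarrow> 'a \<Rightarrow> (real \<Rightarrow> 'a) \<Rightarrow> bool"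
  where "joins S a b p \<longleftrightarrow> path p \<and> path_image p \<subseteq> S \<and> pathstart p = a \<and> pathfinish p = b"

lemma joins_join: "joins S a b p \<Longrightarrow> joins S b c q \<Longrightarrow> joins S a c (p +++ q)"
  by (auto simp: joins_def path_image_join)

lemma joins_reversepath: "joins S a b p \<Longrightarrow> joins S b a (reversepath p)"
  by (auto simp: joins_def)

lemma joins_const: "a \<in> S \<Longrightarrow> joins S a a (\<lambda>_. a)"
  by (auto simp: joins_def path_def pathstart_def pathfinish_def path_image_def)

lemma joins_homotopic: "homotopic_paths S p q \<Longrightarrow> joins S a b p \<longleftrightarrow> joins S a b q"
  unfolding joins_def
  using homotopic_paths_imp_path homotopic_paths_imp_subset homotopic_paths_imp_pathstart
    homotopic_paths_imp_pathfinish by metis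

lemma homotopic_refl: "joins S a b p \<Longrightarrow> homotopic_paths S p p"
  by (simp add: joins_def)

lemma homotopic_join:
  assumes "homotopic_paths S p p'" "homotopic_paths S q q'" "joins S a b p" "joins S b c q"
  shows "homotopic_paths S (p +++ q) (p' +++ q')"
  using assms by (intro homotopic_paths_join) (auto simp: joins_def)

lemma homotopic_assoc:
  assumes "joins S a b p" "joins S b c q" "joins S c d r"
  shows "homotopic_paths S ((p +++ q) +++ r) (p +++ (q +++ r))"
  using assms homotopic_paths_assoc[of p S q r] by (auto simp: joins_def homotopic_paths_sym)

text \<open>Paths with common endpoints in a convex set are homotopic, so all reparametrizations of a
  path, and all pairs of paths in the image of a square, can be compared at once.\<close>

lemma homotopic_compose_convex:
  fixes f g :: "real \<Rightarrow> 'b::real_normed_vector"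
  assumes "continuous_on C p" "p ` C \<subseteq> S" "convex C" "joins C a b f" "joins C a b g"
  shows "homotopic_paths S (p \<circ> f) (p \<circ> g)"
proof (rule homotopic_paths_continuous_image[OF _ assms(1)])
  show "homotopic_paths C f g"
    using assms(3-5) unfolding joins_def path_image_def
    by (intro homotopic_paths_linear closed_segment_subset) auto
  show "p \<in> C \<rightarrow> S" using assms(2) by auto
qed

lemma homotopic_reparametrize:
  assumes "joins S a b p" "joins {0..1} u v f" "joins {0..1} u v g"
  shows "homotopic_paths S (p \<circ> f) (p \<circ> g)"
  using assms by (intro homotopic_compose_convex[where C = "{0..1}"]) (auto simp: joins_def path_def path_image_def)

lemma joins_linepath_unit: "u \<in> {0..1} \<Longrightarrow> v \<in> {0..1} \<Longrightarrow> joins {0..1::real} u v (linepath u v)"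
  by (auto simp: joins_def closed_segment_eq_real_ivl)

text \<open>With parameters in {0, 1} this yields the unit and inverse laws below, and with general
  parameters the splitting of a path into portions.\<close>

lemma homotopic_compose_linepaths:
  assumes "joins S a b p" "u \<in> {0..1}" "v \<in> {0..1}" "w \<in> {0..1}"
  shows "homotopic_paths S (p \<circ> (linepath u v +++ linepath v w)) (p \<circ> linepath u w)"
  by (rule homotopic_reparametrize[OF assms(1) joins_join[OF joins_linepath_unit joins_linepath_unit]
        joins_linepath_unit]) (use assms in auto)

lemma compose_linepath_01: "p \<circ> linepath (0::real) 1 = p" "p \<circ> linepath (1::real) 0 = reversepath p"
  "p \<circ> linepath u u = (\<lambda>_. p (u::real))"
  by (auto simp: linepath_def reversepath_def fun_eq_iff algebra_simps)

lemma homotopic_rid: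
  assumes "joins S a b p"
  shows "homotopic_paths S (p +++ (\<lambda>_. b)) p"
proof -
  have "homotopic_paths S (p \<circ> (linepath 0 1 +++ linepath 1 1)) (p \<circ> linepath 0 1)"
    using assms by (rule homotopic_compose_linepaths) auto
  then show ?thesis
    using assms by (simp add: path_compose_join compose_linepath_01 joins_def pathfinish_def)
qed

lemma homotopic_lid:
  assumes "joins S a b p"
  shows "homotopic_paths S ((\<lambda>_. a) +++ p) p"
proof -
  have "homotopic_paths S (p \<circ> (linepath 0 0 +++ linepath 0 1)) (p \<circ> linepath 0 1)"
    using assms by (rule homotopic_compose_linepaths) auto
  then show ?thesis
    using assms by (simp add: path_compose_join compose_linepath_01 joins_def pathstart_def)
qed

lemma homotopic_rinv:
  assumes "joins S a b p"
  shows "homotopic_paths S (p +++ reversepath p) (\<lambda>_. a)"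
proof -
  have "homotopic_paths S (p \<circ> (linepath 0 1 +++ linepath 1 0)) (p \<circ> linepath 0 0)"
    using assms by (rule homotopic_compose_linepaths) auto
  then show ?thesis
    using assms by (simp add: path_compose_join compose_linepath_01 joins_def pathstart_def)
qed

lemma homotopic_linv:
  assumes "joins S a b p"
  shows "homotopic_paths S (reversepath p +++ p) (\<lambda>_. b)"
  using homotopic_rinv[OF joins_reversepath[OF assms]] by simp

text \<open>The library's \<open>subpath\<close>, without its restriction to normed spaces.\<close>

definition portion :: "real \<Rightarrow> real \<Rightarrow> (real \<Rightarrow> 'a) \<Rightarrow> real \<Rightarrow> 'a"
  where "portion u v p = p \<circ> linepath u v"

lemma homotopic_portions:
  assumes "joins S a b p" "u \<in> {0..1}" "v \<in> {0..1}" "w \<in> {0..1}"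
  shows "homotopic_paths S (portion u v p +++ portion v w p) (portion u w p)"
  using homotopic_compose_linepaths[OF assms] by (simp add: path_compose_join portion_def)

lemma joins_portion:
  assumes p: "joins S a b p" and uv: "u \<in> {0..1}" "v \<in> {0..1}"
  shows "joins S (p u) (p v) (portion u v p)"
proof -
  have l: "linepath u v ` {0..1} \<subseteq> {0..1}"
    using joins_linepath_unit[OF uv] by (simp add: joins_def path_image_def)
  have "path (portion u v p)"
    using p l continuous_on_subset[of "{0..1}" p] unfolding portion_def joins_def path_def
    by (intro continuous_on_compose[OF continuous_on_linepath]) blast
  moreover have "path_image (portion u v p) \<subseteq> S"
    using p l by (auto simp: portion_def joins_def path_image_def)
  ultimately show ?thesis by (simp add: joins_def portion_def pathstart_def pathfinish_def linepath_def)
qed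

declare homotopic_paths_trans [trans]

section \<open>The group of loop classes\<close>

definition loop_class :: "'a::topological_space set \<Rightarrow> 'a \<Rightarrow> (real \<Rightarrow> 'a) \<Rightarrow> (real \<Rightarrow> 'a) set"
  where "loop_class S x p = loop_homotopy S x `` {p}"

lemma loops_at_iff: "p \<in> loops_at S x \<longleftrightarrow> joins S x x p"
  by (simp add: loops_at_def joins_def)

lemma equiv_loop_homotopy: "equiv (loops_at S x) (loop_homotopy S x)"
  unfolding loop_homotopy_def loops_at_def
  by (rule equivI) (auto simp: refl_on_def sym_def trans_def intro: homotopic_paths_sym homotopic_paths_trans)

lemma loop_class_eq_iff:
  assumes "joins S x x p" "joins S x x q"
  shows "loop_class S x p = loop_class S x q \<longleftrightarrow> homotopic_paths S p q"
proof -
  have "loop_class S x p = loop_class S x q \<longleftrightarrow> (p, q) \<in> loop_homotopy S x"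
    using assms unfolding loop_class_def by (intro eq_equiv_class_iff[OF equiv_loop_homotopy]) (auto simp: loops_at_iff)
  then show ?thesis using assms by (auto simp: loop_homotopy_def loops_at_iff)
qed

lemma loop_class_eqI: "homotopic_paths S p q \<Longrightarrow> joins S x x p \<Longrightarrow> loop_class S x p = loop_class S x q"
  using joins_homotopic loop_class_eq_iff by blast

lemma carrier_fundamental_group:
  "carrier (fundamental_group S x) = {loop_class S x p | p. joins S x x p}"
  unfolding fundamental_group_def quotient_def loop_class_def by (auto simp: loops_at_iff)

lemma loop_class_closed: "joins S x x p \<Longrightarrow> loop_class S x p \<in> carrier (fundamental_group S x)"
  unfolding carrier_fundamental_group by blast

lemma one_fundamental_group: "\<one>\<^bsub>fundamental_group S x\<^esub> = loop_class S x (\<lambda>_. x)"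
  by (simp add: fundamental_group_def loop_class_def)

text \<open>Concatenation respects homotopy, so the union that defines the product runs over copies
  of a single class.\<close>

lemma mult_loop_class:
  assumes p: "joins S x x p" and q: "joins S x x q"
  shows "loop_class S x p \<otimes>\<^bsub>fundamental_group S x\<^esub> loop_class S x q = loop_class S x (p +++ q)"
proof -
  have *: "loop_homotopy S x `` {p' +++ q'} = loop_class S x (p +++ q)"
    if "p' \<in> loop_class S x p" "q' \<in> loop_class S x q" for p' q'
  proof -
    have "homotopic_paths S p p'" "homotopic_paths S q q'"
      using that by (auto simp: loop_class_def loop_homotopy_def)
    then show ?thesis
      using loop_class_eqI[OF homotopic_join[OF _ _ p q] joins_join[OF p q]] by (simp add: loop_class_def)
  qed
  have "p \<in> loop_class S x p" "q \<in> loop_class S x q"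
    using p q by (auto simp: loop_class_def loop_homotopy_def loops_at_iff joins_def)
  then show ?thesis using * by (auto simp: fundamental_group_def)
qed

lemma group_fundamental_group:
  assumes "x \<in> S"
  shows "group (fundamental_group S x)"
proof (rule groupI)
  let ?G = "fundamental_group S x"
  have c: "joins S x x (\<lambda>_. x)" using assms by (rule joins_const)
  show "\<one>\<^bsub>?G\<^esub> \<in> carrier ?G" using loop_class_closed[OF c] by (simp add: one_fundamental_group)
  fix A assume "A \<in> carrier ?G"
  then obtain p where p: "joins S x x p" "A = loop_class S x p" by (auto simp: carrier_fundamental_group)
  show "\<one>\<^bsub>?G\<^esub> \<otimes>\<^bsub>?G\<^esub> A = A"
    unfolding one_fundamental_group p(2) mult_loop_class[OF c p(1)]
    by (rule loop_class_eqI[OF homotopic_lid[OF p(1)] joins_join[OF c p(1)]])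
  have r: "joins S x x (reversepath p)" using p(1) by (rule joins_reversepath)
  have "loop_class S x (reversepath p) \<otimes>\<^bsub>?G\<^esub> A = \<one>\<^bsub>?G\<^esub>"
    unfolding one_fundamental_group p(2) mult_loop_class[OF r p(1)]
    by (rule loop_class_eqI[OF homotopic_linv[OF p(1)] joins_join[OF r p(1)]])
  then show "\<exists>B\<in>carrier ?G. B \<otimes>\<^bsub>?G\<^esub> A = \<one>\<^bsub>?G\<^esub>" using loop_class_closed[OF r] by blast
  fix B assume "B \<in> carrier ?G"
  then obtain q where q: "joins S x x q" "B = loop_class S x q" by (auto simp: carrier_fundamental_group)
  note pq = joins_join[OF p(1) q(1)]
  show "A \<otimes>\<^bsub>?G\<^esub> B \<in> carrier ?G"
    unfolding p(2) q(2) mult_loop_class[OF p(1) q(1)] using pq by (rule loop_class_closed)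
  fix C assume "C \<in> carrier ?G"
  then obtain s where s: "joins S x x s" "C = loop_class S x s" by (auto simp: carrier_fundamental_group)
  show "A \<otimes>\<^bsub>?G\<^esub> B \<otimes>\<^bsub>?G\<^esub> C = A \<otimes>\<^bsub>?G\<^esub> (B \<otimes>\<^bsub>?G\<^esub> C)"
    unfolding p(2) q(2) s(2) mult_loop_class[OF p(1) q(1)] mult_loop_class[OF q(1) s(1)]
      mult_loop_class[OF pq s(1)] mult_loop_class[OF p(1) joins_join[OF q(1) s(1)]]
    by (rule loop_class_eqI[OF homotopic_assoc[OF p(1) q(1) s(1)] joins_join[OF pq s(1)]])
qed

section \<open>Segments, carriers and open stars in a realization\<close>

definition seg :: "(nat \<Rightarrow> real) \<Rightarrow> (nat \<Rightarrow> real) \<Rightarrow> real \<Rightarrow> nat \<Rightarrow> real"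
  where "seg a b t = (\<lambda>v. (1 - t) * a v + t * b v)"

lemma seg_simps [simp]: "seg a b 0 = a" "seg a b 1 = b" "seg a a t = a"
  by (auto simp: seg_def algebra_simps)

lemma seg_commute: "seg a b (1 - t) = seg b a t"
  by (auto simp: seg_def algebra_simps)

lemma reversepath_seg: "reversepath (seg a b) = seg b a"
  by (simp add: reversepath_def seg_commute)

lemma continuous_on_seg:
  assumes "continuous_on A f" "continuous_on A g" "continuous_on A h"
  shows "continuous_on A (\<lambda>z. seg (f z) (g z) (h z))"
proof (rule continuous_on_coordinatewise_then_product)
  fix i
  have "continuous_on A (\<lambda>z. f z i)" "continuous_on A (\<lambda>z. g z i)"
    using assms by (auto intro: continuous_on_product_then_coordinatewise)
  then show "continuous_on A (\<lambda>z. seg (f z) (g z) (h z) i)"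
    unfolding seg_def using assms by (intro continuous_intros)
qed

definition vtx :: "nat \<Rightarrow> nat \<Rightarrow> real"
  where "vtx v = (\<lambda>w. if w = v then 1 else 0)"

text \<open>For a point of a realization this is its carrier, the simplex whose open cell contains
  it.\<close>

definition supp :: "(nat \<Rightarrow> real) \<Rightarrow> nat set"
  where "supp x = {v. x v \<noteq> 0}"

lemma supp_vtx [simp]: "supp (vtx v) = {v}"
  by (auto simp: supp_def vtx_def)

lemma supp_seg: "supp (seg a b t) \<subseteq> supp a \<union> supp b"
  by (auto simp: supp_def seg_def)

locale complex =
  fixes K :: "nat set set"
  assumes complex: "finite_abstract_complex K"
begin

abbreviation S where "S \<equiv> geometric_realization K"

lemma face: "\<sigma> \<in> K \<Longrightarrow> \<tau> \<subseteq> \<sigma> \<Longrightarrow> \<tau> \<noteq> {} \<Longrightarrow> \<tau> \<in> K"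
  using complex unfolding finite_abstract_complex_def by blast

lemma finite_simplex: "\<sigma> \<in> K \<Longrightarrow> finite \<sigma>"
  using complex by (auto simp: finite_abstract_complex_def)

lemma finite_vertices: "finite {v. {v} \<in> K}"
proof -
  have "{v. {v} \<in> K} \<subseteq> \<Union>K" by auto
  moreover have "finite (\<Union>K)" using complex by (auto simp: finite_abstract_complex_def)
  ultimately show ?thesis by (rule finite_subset)
qed

text \<open>The sum may run over any simplex containing the carrier: along a segment the carrier
  changes, while a common simplex of the end points does not.\<close>

lemma in_realization_iff:
  "y \<in> S \<longleftrightarrow> (\<exists>\<sigma>\<in>K. supp y \<subseteq> \<sigma> \<and> (\<forall>v. 0 \<le> y v) \<and> (\<Sum>v\<in>\<sigma>. y v) = 1)"
proof
  assume "y \<in> S"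
  then show "\<exists>\<sigma>\<in>K. supp y \<subseteq> \<sigma> \<and> (\<forall>v. 0 \<le> y v) \<and> (\<Sum>v\<in>\<sigma>. y v) = 1"
    by (intro bexI[of _ "supp y"]) (auto simp: geometric_realization_def supp_def)
next
  assume "\<exists>\<sigma>\<in>K. supp y \<subseteq> \<sigma> \<and> (\<forall>v. 0 \<le> y v) \<and> (\<Sum>v\<in>\<sigma>. y v) = 1"
  then obtain \<sigma> where \<sigma>: "\<sigma> \<in> K" "supp y \<subseteq> \<sigma>" "\<forall>v. 0 \<le> y v" "(\<Sum>v\<in>\<sigma>. y v) = 1" by blast
  have "(\<Sum>v\<in>supp y. y v) = (\<Sum>v\<in>\<sigma>. y v)"
    using \<sigma> finite_simplex by (intro sum.mono_neutral_left) (auto simp: supp_def)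
  then have s: "(\<Sum>v\<in>supp y. y v) = 1" using \<sigma> by simp
  then have "supp y \<noteq> {}" by auto
  then have "supp y \<in> K" using face \<sigma> by blast
  then show "y \<in> S" using s \<sigma> by (auto simp: geometric_realization_def supp_def)
qed

lemma supp_in: "y \<in> S \<Longrightarrow> supp y \<in> K"
  by (auto simp: geometric_realization_def supp_def)

lemma sum_simplex: "y \<in> S \<Longrightarrow> \<sigma> \<in> K \<Longrightarrow> supp y \<subseteq> \<sigma> \<Longrightarrow> (\<Sum>v\<in>\<sigma>. y v) = 1"
proof -
  assume y: "y \<in> S" and \<sigma>: "\<sigma> \<in> K" "supp y \<subseteq> \<sigma>"
  have "(\<Sum>v\<in>supp y. y v) = (\<Sum>v\<in>\<sigma>. y v)"
    using \<sigma> finite_simplex by (intro sum.mono_neutral_left) (auto simp: supp_def)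
  then show ?thesis using y by (simp add: geometric_realization_def supp_def)
qed

lemma nonneg: "y \<in> S \<Longrightarrow> 0 \<le> y v"
  by (auto simp: geometric_realization_def)

lemma vtx_in: "{v} \<in> K \<Longrightarrow> vtx v \<in> S"
  unfolding in_realization_iff by (intro bexI[of _ "{v}"]) (auto simp: supp_def vtx_def)

lemma vertex_in: "y \<in> S \<Longrightarrow> v \<in> supp y \<Longrightarrow> {v} \<in> K"
  using supp_in face by blast

lemma supp_nonempty: "y \<in> S \<Longrightarrow> supp y \<noteq> {}"
  using supp_in complex by (auto simp: finite_abstract_complex_def)

lemma seg_in:
  assumes "y \<in> S" "z \<in> S" "supp y \<union> supp z \<subseteq> \<sigma>" "\<sigma> \<in> K" "t \<in> {0..1}"
  shows "seg y z t \<in> S"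
proof -
  have "(\<Sum>v\<in>\<sigma>. seg y z t v) = (1 - t) * (\<Sum>v\<in>\<sigma>. y v) + t * (\<Sum>v\<in>\<sigma>. z v)"
    by (simp add: seg_def sum.distrib sum_distrib_left)
  also have "\<dots> = 1" using sum_simplex[of y \<sigma>] sum_simplex[of z \<sigma>] assms by simp
  finally show ?thesis
    unfolding in_realization_iff using assms supp_seg[of y z t]
    by (intro bexI[of _ \<sigma>]) (auto simp: nonneg seg_def)
qed

lemma joins_seg:
  assumes "y \<in> S" "z \<in> S" "supp y \<union> supp z \<subseteq> \<sigma>" "\<sigma> \<in> K"
  shows "joins S y z (seg y z)"
proof -
  have "continuous_on {0..1} (\<lambda>t. seg y z t)" by (intro continuous_on_seg continuous_intros)
  then show ?thesis
    using seg_in[OF assms] by (auto simp: joins_def path_def pathstart_def pathfinish_def path_image_def)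
qed

lemma joins_edge: "{u, v} \<in> K \<Longrightarrow> joins S (vtx u) (vtx v) (seg (vtx u) (vtx v))"
  by (rule joins_seg[where \<sigma> = "{u, v}"]) (auto intro!: vtx_in intro: face)

lemma joins_to_vertex: "y \<in> S \<Longrightarrow> v \<in> supp y \<Longrightarrow> joins S y (vtx v) (seg y (vtx v))"
  by (rule joins_seg[where \<sigma> = "supp y"]) (auto intro: vtx_in vertex_in supp_in)

lemma joins_from_vertex: "y \<in> S \<Longrightarrow> v \<in> supp y \<Longrightarrow> joins S (vtx v) y (seg (vtx v) y)"
  by (rule joins_seg[where \<sigma> = "supp y"]) (auto intro: vtx_in vertex_in supp_in)

lemma homotopic_in_simplex:
  assumes p: "joins S a b p" "joins S a b q" and \<sigma>: "\<sigma> \<in> K"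
    and "\<And>t. t \<in> {0..1} \<Longrightarrow> supp (p t) \<subseteq> \<sigma>" "\<And>t. t \<in> {0..1} \<Longrightarrow> supp (q t) \<subseteq> \<sigma>"
  shows "homotopic_paths S p q"
proof -
  let ?h = "\<lambda>z. seg (p (snd z)) (q (snd z)) (fst z)"
  have pq: "continuous_on {0..1} p" "continuous_on {0..1} q" "p ` {0..1} \<subseteq> S" "q ` {0..1} \<subseteq> S"
    "p 0 = a" "q 0 = a" "p 1 = b" "q 1 = b"
    using p by (auto simp: joins_def path_def path_image_def pathstart_def pathfinish_def)
  have "continuous_on ({0..1} \<times> {0..1}) ?h"
    by (intro continuous_on_seg continuous_intros continuous_on_compose2[OF pq(1)] continuous_on_compose2[OF pq(2)]) auto
  moreover have "?h \<in> ({0..1} \<times> {0..1}) \<rightarrow> S"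
  proof clarify
    fix s t :: real assume st: "s \<in> {0..1}" "t \<in> {0..1}"
    show "seg (p (snd (s, t))) (q (snd (s, t))) (fst (s, t)) \<in> S"
      using assms(4,5)[OF st(2)] st pq(3,4) \<sigma> by (auto intro!: seg_in[where \<sigma> = \<sigma>])
  qed
  ultimately show ?thesis
    unfolding homotopic_paths using pq
    by (intro exI[of _ ?h]) (auto simp: pathstart_def pathfinish_def)
qed

lemma homotopic_triangle_seg:
  assumes "a \<in> S" "b \<in> S" "c \<in> S" "supp a \<union> supp b \<union> supp c \<subseteq> \<sigma>" "\<sigma> \<in> K"
  shows "homotopic_paths S (seg a b +++ seg b c) (seg a c)"
proof (rule homotopic_in_simplex[OF _ _ assms(5)])
  show "joins S a c (seg a b +++ seg b c)" "joins S a c (seg a c)"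
    using assms by (auto intro!: joins_join[of S a b _ c] joins_seg[where \<sigma> = \<sigma>])
  fix t :: real assume "t \<in> {0..1}"
  show "supp (seg a c t) \<subseteq> \<sigma>" "supp ((seg a b +++ seg b c) t) \<subseteq> \<sigma>"
    using assms(4) supp_seg[of a c t] supp_seg[of a b "2 * t"] supp_seg[of b c "2 * t - 1"]
    by (auto simp: joinpaths_def)
qed

text \<open>The open star of a vertex contracts to it along straight segments.\<close>

lemma homotopic_in_star:
  assumes p: "joins S a b p" and w: "\<And>t. t \<in> {0..1} \<Longrightarrow> w \<in> supp (p t)"
  shows "homotopic_paths S p (seg a (vtx w) +++ seg (vtx w) b)"
proof -
  define F where "F z = seg (p (fst z)) (vtx w) (snd z)" for z :: "real \<times> real"
  let ?C = "{0..1} \<times> {0..1} :: (real \<times> real) set"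
  have pq: "continuous_on {0..1} p" "p ` {0..1} \<subseteq> S" "p 0 = a" "p 1 = b"
    using p by (auto simp: joins_def path_def path_image_def pathstart_def pathfinish_def)
  have "p 0 \<in> S" using pq(2) by (simp add: image_subset_iff)
  then have wS: "{w} \<in> K" using vertex_in w[of 0] by auto
  have cont: "continuous_on ?C F"
    unfolding F_def by (intro continuous_on_seg continuous_intros continuous_on_compose2[OF pq(1)]) auto
  have im: "F ` ?C \<subseteq> S"
  proof clarify
    fix s t :: real assume st: "s \<in> {0..1}" "t \<in> {0..1}"
    show "F (s, t) \<in> S"
      unfolding F_def using st w[OF st(1)] pq wS
      by (auto intro!: seg_in[where \<sigma> = "supp (p s)"] vtx_in supp_in)
  qed
  have conv: "convex ?C" by (intro convex_Times convex_real_interval)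
  have line: "joins ?C u v (linepath u v)" if "u \<in> ?C" "v \<in> ?C" for u v
    using closed_segment_subset[OF that conv] by (auto simp: joins_def)
  \<comment> \<open>\<open>p\<close> is one side of the square on which \<open>F\<close> is defined;
    the other three sides run to \<open>w\<close>, rest there and come back. In a convex square the
    two routes are homotopic.\<close>
  have "homotopic_paths S (F \<circ> linepath (0, 0) (1, 0))
     (F \<circ> (linepath (0, 0) (0, 1) +++ (linepath (0, 1) (1, 1) +++ linepath (1, 1) (1, 0))))"
    by (rule homotopic_compose_convex[OF cont im conv]) (auto intro!: line joins_join)
  moreover have "F \<circ> linepath (0, 0) (1, 0) = p"
    by (auto simp: F_def linepath_def fun_eq_iff)
  moreover have "F \<circ> linepath (0, 0) (0, 1) = seg a (vtx w)"
    by (auto simp: F_def linepath_def fun_eq_iff pq)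
  moreover have "F \<circ> linepath (0, 1) (1, 1) = (\<lambda>_. vtx w)"
    by (auto simp: F_def linepath_def fun_eq_iff)
  moreover have "F \<circ> linepath (1, 1) (1, 0) = seg (vtx w) b"
    by (auto simp: F_def linepath_def fun_eq_iff pq seg_commute)
  ultimately have "homotopic_paths S p (seg a (vtx w) +++ ((\<lambda>_. vtx w) +++ seg (vtx w) b))"
    by (simp add: path_compose_join)
  also have "homotopic_paths S (seg a (vtx w) +++ ((\<lambda>_. vtx w) +++ seg (vtx w) b)) (seg a (vtx w) +++ seg (vtx w) b)"
  proof -
    have "a \<in> S" "b \<in> S" "w \<in> supp a" "w \<in> supp b" using pq w[of 0] w[of 1] by auto
    then have j: "joins S a (vtx w) (seg a (vtx w))" "joins S (vtx w) b (seg (vtx w) b)"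
      by (auto intro: joins_to_vertex joins_from_vertex)
    show ?thesis
      using j wS by (intro homotopic_join[of S _ _ _ _ a "vtx w" b] homotopic_refl homotopic_lid joins_join[of S _ "vtx w"] joins_const vtx_in)
  qed
  finally show ?thesis .
qed

end

section \<open>Edge classes relative to a spanning tree\<close>

lemma homotopic_cancel_left:
  assumes C: "joins S b c C" and Q: "joins S b d Q"
  shows "homotopic_paths S (C +++ (reversepath C +++ Q)) Q"
proof -
  note rC = joins_reversepath[OF C]
  have "homotopic_paths S (C +++ (reversepath C +++ Q)) ((C +++ reversepath C) +++ Q)"
    by (rule homotopic_paths_sym[OF homotopic_assoc[OF C rC Q]])
  also have "homotopic_paths S ((C +++ reversepath C) +++ Q) ((\<lambda>_. b) +++ Q)"
    by (rule homotopic_join[OF homotopic_rinv[OF C] homotopic_refl[OF Q] joins_join[OF C rC] Q])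
  also have "homotopic_paths S ((\<lambda>_. b) +++ Q) Q" by (rule homotopic_lid[OF Q])
  finally show ?thesis .
qed

lemma homotopic_cancel_right:
  assumes P: "joins S a b P" and C: "joins S b c C"
  shows "homotopic_paths S ((P +++ C) +++ reversepath C) P"
proof -
  note rC = joins_reversepath[OF C]
  have "homotopic_paths S ((P +++ C) +++ reversepath C) (P +++ (C +++ reversepath C))"
    by (rule homotopic_assoc[OF P C rC])
  also have "homotopic_paths S (P +++ (C +++ reversepath C)) (P +++ (\<lambda>_. b))"
    by (rule homotopic_join[OF homotopic_refl[OF P] homotopic_rinv[OF C] P joins_join[OF C rC]])
  also have "homotopic_paths S (P +++ (\<lambda>_. b)) P" by (rule homotopic_rid[OF P])
  finally show ?thesis .
qed

lemma homotopic_cancel_middle: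
  assumes P: "joins S a b P" and C: "joins S b c C" and Q: "joins S b d Q"
  shows "homotopic_paths S ((P +++ C) +++ (reversepath C +++ Q)) (P +++ Q)"
proof -
  note rC = joins_reversepath[OF C]
  have "homotopic_paths S ((P +++ C) +++ (reversepath C +++ Q)) (P +++ (C +++ (reversepath C +++ Q)))"
    by (rule homotopic_assoc[OF P C joins_join[OF rC Q]])
  also have "homotopic_paths S (P +++ (C +++ (reversepath C +++ Q))) (P +++ Q)"
    by (rule homotopic_join[OF homotopic_refl[OF P] homotopic_cancel_left[OF C Q] P joins_join[OF C joins_join[OF rC Q]]])
  finally show ?thesis .
qed

text \<open>\<open>depth\<close> excludes cycles, so the edges from \<open>par v\<close> to
  \<open>v\<close> form a spanning tree rooted at \<open>r\<close>. The base point \<open>x\<close>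
  may be any point of the realization; \<open>r\<close> is a vertex of its carrier.\<close>

locale tree_complex = complex +
  fixes x :: "nat \<Rightarrow> real" and r :: nat and par depth :: "nat \<Rightarrow> nat"
  assumes x_in: "x \<in> S" and r_in: "r \<in> supp x" and depth_root: "depth r = 0"
    and par: "\<And>v. {v} \<in> K \<Longrightarrow> v \<noteq> r \<Longrightarrow> {par v, v} \<in> K \<and> depth v = Suc (depth (par v))"
begin

abbreviation FG where "FG \<equiv> fundamental_group S x"

lemma group_FG: "group FG"
  using x_in by (rule group_fundamental_group)

text \<open>Recursion on the depth, because iterating \<open>par\<close> is known to reach the root
  only from vertices of \<open>K\<close>.\<close>

primrec descend :: "nat \<Rightarrow> nat \<Rightarrow> real \<Rightarrow> nat \<Rightarrow> real"
  where "descend 0 v = seg x (vtx r)"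
  | "descend (Suc n) v = descend n (par v) +++ seg (vtx (par v)) (vtx v)"

definition T :: "nat \<Rightarrow> real \<Rightarrow> nat \<Rightarrow> real"
  where "T v = descend (depth v) v"

lemma T_root: "T r = seg x (vtx r)"
  by (simp add: T_def depth_root)

lemma T_step: "{v} \<in> K \<Longrightarrow> v \<noteq> r \<Longrightarrow> T v = T (par v) +++ seg (vtx (par v)) (vtx v)"
  using par[of v] by (simp add: T_def)

lemma tree_induct [consumes 1, case_names root step]:
  assumes "{v} \<in> K" and "P r"
    and step: "\<And>v. {v} \<in> K \<Longrightarrow> v \<noteq> r \<Longrightarrow> {par v} \<in> K \<Longrightarrow> {par v, v} \<in> K \<Longrightarrow> P (par v) \<Longrightarrow> P v"
  shows "P v"
  using assms(1)
proof (induction "depth v" arbitrary: v)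
  case 0
  then show ?case using par[of v] assms(2) by (cases "v = r") auto
next
  case (Suc n)
  then have "v \<noteq> r" using depth_root by auto
  then have *: "{par v, v} \<in> K" "depth (par v) = n" using par[of v] Suc by auto
  then have "{par v} \<in> K" using face by blast
  then show ?case using step Suc * \<open>v \<noteq> r\<close> by metis
qed

lemma joins_T: "{v} \<in> K \<Longrightarrow> joins S x (vtx v) (T v)"
proof (induction rule: tree_induct)
  case root
  show ?case unfolding T_root using x_in r_in by (rule joins_to_vertex)
next
  case (step v)
  then show ?case unfolding T_step[OF step(1,2)] by (auto intro: joins_join joins_edge)
qed

definition via :: "nat \<Rightarrow> (real \<Rightarrow> nat \<Rightarrow> real) \<Rightarrow> nat \<Rightarrow> real \<Rightarrow> nat \<Rightarrow> real"
  where "via u s v = (T u +++ s) +++ reversepath (T v)"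

lemma joins_via:
  assumes "{u} \<in> K" "{v} \<in> K" "joins S (vtx u) (vtx v) s"
  shows "joins S x x (via u s v)"
  unfolding via_def
  by (rule joins_join[OF joins_join[OF joins_T[OF assms(1)] assms(3)] joins_reversepath[OF joins_T[OF assms(2)]]])

lemma via_cong:
  assumes uv: "{u} \<in> K" "{v} \<in> K" "joins S (vtx u) (vtx v) s" and h: "homotopic_paths S s s'"
  shows "loop_class S x (via u s v) = loop_class S x (via u s' v)"
proof (rule loop_class_eqI[OF _ joins_via[OF uv]])
  note Tu = joins_T[OF uv(1)] and Tv = joins_reversepath[OF joins_T[OF uv(2)]]
  show "homotopic_paths S (via u s v) (via u s' v)"
    unfolding via_def
    by (rule homotopic_join[OF homotopic_join[OF homotopic_refl[OF Tu] h Tu uv(3)]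
          homotopic_refl[OF Tv] joins_join[OF Tu uv(3)] Tv])
qed

text \<open>The tree path back from \<open>v\<close> cancels against the tree path out to
  \<open>v\<close>.\<close>

lemma via_mult:
  assumes u: "{u} \<in> K" and v: "{v} \<in> K" and w: "{w} \<in> K"
    and s: "joins S (vtx u) (vtx v) s" and s': "joins S (vtx v) (vtx w) s'"
  shows "loop_class S x (via u s v) \<otimes>\<^bsub>FG\<^esub> loop_class S x (via v s' w) = loop_class S x (via u (s +++ s') w)"
proof -
  note Tu = joins_T[OF u] and Tv = joins_T[OF v] and Tw = joins_reversepath[OF joins_T[OF w]]
  note rTv = joins_reversepath[OF Tv]
  note A = joins_join[OF Tu s] and B = joins_join[OF s' Tw]
  have "homotopic_paths S (via u s v +++ via v s' w)
     (((T u +++ s) +++ reversepath (T v)) +++ (T v +++ (s' +++ reversepath (T w))))"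
    unfolding via_def
    by (rule homotopic_join[OF homotopic_refl homotopic_assoc[OF Tv s' Tw]])
      (rule joins_join[OF A rTv] joins_join[OF joins_join[OF Tv s'] Tw])+
  also have "homotopic_paths S \<dots> ((T u +++ s) +++ (s' +++ reversepath (T w)))"
    using homotopic_cancel_middle[OF A rTv B] by simp
  also have "homotopic_paths S \<dots> (((T u +++ s) +++ s') +++ reversepath (T w))"
    by (rule homotopic_paths_sym[OF homotopic_assoc[OF A s' Tw]])
  also have "homotopic_paths S \<dots> (via u (s +++ s') w)"
    unfolding via_def
    by (rule homotopic_join[OF homotopic_assoc[OF Tu s s'] homotopic_refl[OF Tw] joins_join[OF A s'] Tw])
  finally have "homotopic_paths S (via u s v +++ via v s' w) (via u (s +++ s') w)" .
  then have "loop_class S x (via u s v +++ via v s' w) = loop_class S x (via u (s +++ s') w)"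
    by (rule loop_class_eqI[OF _ joins_join[OF joins_via[OF u v s] joins_via[OF v w s']]])
  then show ?thesis using mult_loop_class[OF joins_via[OF u v s] joins_via[OF v w s']] by simp
qed

definition edge_class :: "nat \<Rightarrow> nat \<Rightarrow> (real \<Rightarrow> nat \<Rightarrow> real) set"
  where "edge_class u v = loop_class S x (via u (seg (vtx u) (vtx v)) v)"

lemma edge_vertices: "{u, v} \<in> K \<Longrightarrow> {u} \<in> K \<and> {v} \<in> K"
  using face[of "{u, v}"] by blast

lemma edge_class_closed: "{u, v} \<in> K \<Longrightarrow> edge_class u v \<in> carrier FG"
  unfolding edge_class_def using edge_vertices by (intro loop_class_closed joins_via joins_edge) auto

text \<open>Two sides of a triangle are homotopic to the third inside it. The vertices may coincide,
  so \<open>edge_class_refl\<close> and \<open>edge_class_inv\<close> come from degenerate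
  instances.\<close>

lemma edge_class_mult:
  assumes "{u, v, w} \<in> K"
  shows "edge_class u v \<otimes>\<^bsub>FG\<^esub> edge_class v w = edge_class u w"
proof -
  have e: "{u, v} \<in> K" "{v, w} \<in> K" "{u} \<in> K" "{v} \<in> K" "{w} \<in> K"
    using face[OF assms] by auto
  note j = joins_edge[OF e(1)] joins_edge[OF e(2)]
  have "homotopic_paths S (seg (vtx u) (vtx v) +++ seg (vtx v) (vtx w)) (seg (vtx u) (vtx w))"
    using assms e by (intro homotopic_triangle_seg[where \<sigma> = "{u, v, w}"] vtx_in) auto
  then show ?thesis
    unfolding edge_class_def via_mult[OF e(3,4,5) j] by (rule via_cong[OF e(3,5) joins_join[OF j]])
qed

lemma edge_class_refl: "{u} \<in> K \<Longrightarrow> edge_class u u = \<one>\<^bsub>FG\<^esub>"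
  using edge_class_mult[of u u u] edge_class_closed[of u u] group.l_cancel_one'[OF group_FG, of "edge_class u u" "edge_class u u"]
  by simp

lemma edge_class_inv:
  assumes "{u, v} \<in> K"
  shows "edge_class v u = inv\<^bsub>FG\<^esub> edge_class u v"
proof -
  have "edge_class v u \<otimes>\<^bsub>FG\<^esub> edge_class u v = \<one>\<^bsub>FG\<^esub>"
    using edge_class_mult[of v u v] edge_class_refl[of v] assms edge_vertices[OF assms] by (simp add: insert_commute)
  then show ?thesis
    using group.inv_equality[OF group_FG] edge_class_closed[of u v] edge_class_closed[of v u] assms
    by (simp add: insert_commute)
qed

text \<open>\<open>T v\<close> is by construction \<open>T (par v)\<close> followed by this edge, so
  the loop runs along \<open>T v\<close> and straight back.\<close>

lemma edge_class_tree:
  assumes "{v} \<in> K" "v \<noteq> r"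
  shows "edge_class (par v) v = \<one>\<^bsub>FG\<^esub>"
proof -
  have e: "{par v, v} \<in> K" using par assms by blast
  have "homotopic_paths S (via (par v) (seg (vtx (par v)) (vtx v)) v) (\<lambda>_. x)"
    unfolding via_def T_step[OF assms, symmetric] by (rule homotopic_rinv[OF joins_T[OF assms(1)]])
  then show ?thesis
    unfolding edge_class_def one_fundamental_group
    using e edge_vertices[OF e] by (intro loop_class_eqI joins_via joins_edge) auto
qed

section \<open>Pushing loops onto edges\<close>

definition detour :: "nat \<Rightarrow> (real \<Rightarrow> nat \<Rightarrow> real) \<Rightarrow> nat \<Rightarrow> real \<Rightarrow> nat \<Rightarrow> real"
  where "detour u p v = seg (vtx u) (pathstart p) +++ (p +++ seg (pathfinish p) (vtx v))"

lemma joins_endpoints: "joins S a b p \<Longrightarrow> a \<in> S \<and> b \<in> S \<and> pathstart p = a \<and> pathfinish p = b"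
  using pathstart_in_path_image[of p] pathfinish_in_path_image[of p] by (auto simp: joins_def)

lemma detour_eq: "joins S a b p \<Longrightarrow> detour u p v = seg (vtx u) a +++ (p +++ seg b (vtx v))"
  by (simp add: detour_def joins_def)

lemma joins_detour:
  assumes p: "joins S a b p" and "u \<in> supp a" "v \<in> supp b"
  shows "joins S (vtx u) (vtx v) (detour u p v)"
  unfolding detour_eq[OF p]
  by (rule joins_join[OF joins_from_vertex joins_join[OF p joins_to_vertex]])
    (use assms joins_endpoints[OF p] in auto)

text \<open>The excursion from \<open>b\<close> to \<open>v\<close> and back cancels, whichever
  vertex of the carrier of \<open>b\<close> is chosen.\<close>

lemma homotopic_detour_join:
  assumes p: "joins S a b p" and q: "joins S b c q" and uvw: "u \<in> supp a" "v \<in> supp b" "w \<in> supp c"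
    and pq: "homotopic_paths S (p +++ q) pq"
  shows "homotopic_paths S (detour u p v +++ detour v q w) (detour u pq w)"
proof -
  note ends = joins_endpoints[OF p] joins_endpoints[OF q]
  have A: "joins S (vtx u) a (seg (vtx u) a)" using ends uvw by (auto intro: joins_from_vertex)
  have C: "joins S b (vtx v) (seg b (vtx v))" using ends uvw by (auto intro: joins_to_vertex)
  have E: "joins S c (vtx w) (seg c (vtx w))" using ends uvw by (auto intro: joins_to_vertex)
  have rC: "joins S (vtx v) b (seg (vtx v) b)" using ends uvw by (auto intro: joins_from_vertex)
  have jpq: "joins S a c pq" using joins_homotopic[OF pq] joins_join[OF p q] by blast
  have "homotopic_paths S (detour u p v +++ detour v q w)
    (((seg (vtx u) a +++ p) +++ seg b (vtx v)) +++ (seg (vtx v) b +++ (q +++ seg c (vtx w))))"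
    unfolding detour_eq[OF p] detour_eq[OF q]
    by (rule homotopic_join[OF homotopic_paths_sym[OF homotopic_assoc[OF A p C]] homotopic_refl[OF joins_join[OF rC joins_join[OF q E]]]
      joins_join[OF A joins_join[OF p C]] joins_join[OF rC joins_join[OF q E]]])
  also have "homotopic_paths S \<dots> ((seg (vtx u) a +++ p) +++ (q +++ seg c (vtx w)))"
    using homotopic_cancel_middle[OF joins_join[OF A p] C joins_join[OF q E]] by (simp add: reversepath_seg)
  also have "homotopic_paths S \<dots> (seg (vtx u) a +++ (p +++ (q +++ seg c (vtx w))))"
    by (rule homotopic_assoc[OF A p joins_join[OF q E]])
  also have "homotopic_paths S \<dots> (seg (vtx u) a +++ ((p +++ q) +++ seg c (vtx w)))"
    by (rule homotopic_join[OF homotopic_refl[OF A] homotopic_paths_sym[OF homotopic_assoc[OF p q E]] A joins_join[OF p joins_join[OF q E]]])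
  also have "homotopic_paths S \<dots> (seg (vtx u) a +++ (pq +++ seg c (vtx w)))"
    by (rule homotopic_join[OF homotopic_refl[OF A] homotopic_join[OF pq homotopic_refl[OF E] joins_join[OF p q] E] A
        joins_join[OF joins_join[OF p q] E]])
  finally show ?thesis unfolding detour_eq[OF jpq] .
qed

text \<open>In the open star of \<open>w\<close> the path can be led through \<open>w\<close>; the
  segments in the carriers of its end points then straighten to the two edges at
  \<open>w\<close>.\<close>

lemma homotopic_detour_star:
  assumes p: "joins S a b p" and uv: "u \<in> supp a" "v \<in> supp b"
    and w: "\<And>t. t \<in> {0..1} \<Longrightarrow> w \<in> supp (p t)"
  shows "homotopic_paths S (detour u p v) (seg (vtx u) (vtx w) +++ seg (vtx w) (vtx v))"
proof -
  note ends = joins_endpoints[OF p]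
  have wab: "w \<in> supp a" "w \<in> supp b"
    using w[of 0] w[of 1] p by (auto simp: joins_def pathstart_def pathfinish_def)
  have ww: "{w} \<in> K" using vertex_in ends wab by blast
  have uK: "{u} \<in> K" "{v} \<in> K" using vertex_in ends uv by blast+
  have ja: "joins S (vtx u) a (seg (vtx u) a)" "joins S a (vtx w) (seg a (vtx w))"
    and jb: "joins S (vtx w) b (seg (vtx w) b)" "joins S b (vtx v) (seg b (vtx v))"
    using ends uv wab by (auto intro: joins_from_vertex joins_to_vertex)
  have "homotopic_paths S (detour u p v) (seg (vtx u) a +++ ((seg a (vtx w) +++ seg (vtx w) b) +++ seg b (vtx v)))"
    unfolding detour_eq[OF p]
    by (rule homotopic_join[OF homotopic_refl[OF ja(1)]
        homotopic_join[OF homotopic_in_star[OF p w] homotopic_refl[OF jb(2)] p jb(2)] ja(1) joins_join[OF p jb(2)]])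
  also have "homotopic_paths S \<dots> (seg (vtx u) a +++ (seg a (vtx w) +++ (seg (vtx w) b +++ seg b (vtx v))))"
    by (rule homotopic_join[OF homotopic_refl[OF ja(1)] homotopic_assoc[OF ja(2) jb] ja(1)
        joins_join[OF joins_join[OF ja(2) jb(1)] jb(2)]])
  also have "homotopic_paths S \<dots> ((seg (vtx u) a +++ seg a (vtx w)) +++ (seg (vtx w) b +++ seg b (vtx v)))"
    by (rule homotopic_paths_sym[OF homotopic_assoc[OF ja joins_join[OF jb]]])
  also have "homotopic_paths S \<dots> (seg (vtx u) (vtx w) +++ seg (vtx w) (vtx v))"
  proof (rule homotopic_join[OF _ _ joins_join[OF ja] joins_join[OF jb]])
    show "homotopic_paths S (seg (vtx u) a +++ seg a (vtx w)) (seg (vtx u) (vtx w))"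
      using ends uv wab ww uK by (intro homotopic_triangle_seg[where \<sigma> = "supp a"] vtx_in supp_in) auto
    show "homotopic_paths S (seg (vtx w) b +++ seg b (vtx v)) (seg (vtx w) (vtx v))"
      using ends uv wab ww uK by (intro homotopic_triangle_seg[where \<sigma> = "supp b"] vtx_in supp_in) auto
  qed
  finally show ?thesis .
qed

text \<open>A path is cut into pieces lying in open stars; each piece may be pushed onto edges.\<close>

theorem edge_classes_generate:
  assumes edges: "\<And>u v. {u, v} \<in> K \<Longrightarrow> edge_class u v \<in> H"
    and mult: "\<And>A B. A \<in> H \<Longrightarrow> B \<in> H \<Longrightarrow> A \<otimes>\<^bsub>FG\<^esub> B \<in> H"
  shows "carrier FG \<subseteq> H"
proof
  fix A assume "A \<in> carrier FG"
  then obtain p where p: "joins S x x p" and A: "A = loop_class S x p" by (auto simp: carrier_fundamental_group)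
  have pc: "continuous_on {0..1} p" "\<And>t. t \<in> {0..1} \<Longrightarrow> p t \<in> S" "p 0 = x" "p 1 = x"
    using p by (auto simp: joins_def path_def path_image_def pathstart_def pathfinish_def)
  \<comment> \<open>All vertices of the two carriers are allowed, so that adjacent pieces can be
    matched at any vertex in between.\<close>
  define P where "P a b \<longleftrightarrow> (0 \<le> a \<and> a \<le> b \<and> b \<le> 1 \<longrightarrow> (\<forall>u\<in>supp (p a). \<forall>v\<in>supp (p b).
    loop_class S x (via u (detour u (portion a b p) v) v) \<in> H))" for a b
  have sub: "joins S (p a) (p b) (portion a b p)" if "0 \<le> a" "a \<le> b" "b \<le> 1" for a b
    using that by (intro joins_portion[OF p]) auto
  have "P 0 1"
  \<comment> \<open>This plays the part of a Lebesgue number: the property passes to unions of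
    adjacent intervals and holds on all short intervals around each point.\<close>
  proof (rule Bolzano)
    show "(0::real) \<le> 1" by simp
  next
    fix a b c assume P: "P a b" "P b c" "a \<le> b" "b \<le> c"
    show "P a c" unfolding P_def
    proof (intro impI ballI)
      fix u w assume ac: "0 \<le> a \<and> a \<le> c \<and> c \<le> 1" and uw: "u \<in> supp (p a)" "w \<in> supp (p c)"
      obtain v where v: "v \<in> supp (p b)" using supp_nonempty[OF pc(2)[of b]] P ac by auto
      have j: "joins S (p a) (p b) (portion a b p)" "joins S (p b) (p c) (portion b c p)"
        using P ac by (auto intro: sub)
      have K: "{u} \<in> K" "{v} \<in> K" "{w} \<in> K"
        using vertex_in[OF pc(2)[of a] uw(1)] vertex_in[OF pc(2)[of b] v] vertex_in[OF pc(2)[of c] uw(2)] P ac by auto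
      have h: "homotopic_paths S (portion a b p +++ portion b c p) (portion a c p)"
        using P ac by (intro homotopic_portions[OF p]) auto
      note d = joins_detour[OF j(1) uw(1) v] joins_detour[OF j(2) v uw(2)]
      have "loop_class S x (via u (detour u (portion a b p) v) v) \<otimes>\<^bsub>FG\<^esub>
          loop_class S x (via v (detour v (portion b c p) w) w) \<in> H"
        using P ac uw v unfolding P_def by (intro mult) auto
      also have "loop_class S x (via u (detour u (portion a b p) v) v) \<otimes>\<^bsub>FG\<^esub>
          loop_class S x (via v (detour v (portion b c p) w) w)
        = loop_class S x (via u (detour u (portion a b p) v +++ detour v (portion b c p) w) w)"
        by (rule via_mult[OF K d])
      also have "\<dots> = loop_class S x (via u (detour u (portion a c p) w) w)"
        by (rule via_cong[OF K(1,3) joins_join[OF d] homotopic_detour_join[OF j uw(1) v uw(2) h]])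
      finally show "loop_class S x (via u (detour u (portion a c p) w) w) \<in> H" .
    qed
  next
    fix t assume t: "0 \<le> t" "t \<le> (1::real)"
    \<comment> \<open>A nonzero coordinate \<open>w\<close> of \<open>p t\<close> stays nonzero
      nearby, so short pieces around \<open>t\<close> lie in the open star of
      \<open>w\<close>.\<close>
    then obtain w where w: "p t w \<noteq> 0" using supp_nonempty[OF pc(2)[of t]] by (auto simp: supp_def)
    have "continuous_on {0..1} (\<lambda>s. p s w)"
      using pc(1) by (rule continuous_on_product_then_coordinatewise)
    then obtain d where d: "d > 0" "\<And>s. s \<in> {0..1} \<Longrightarrow> dist s t < d \<Longrightarrow> dist (p s w) (p t w) < \<bar>p t w\<bar>"
      using t w unfolding continuous_on_iff by (metis atLeastAtMost_iff zero_less_abs_iff)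
    have nz: "w \<in> supp (p s)" if "s \<in> {0..1}" "dist s t < d" for s
      using d(2)[OF that] by (auto simp: supp_def dist_real_def)
    have "P a b" if ab: "a \<le> t" "t \<le> b" "b - a < d" for a b
      unfolding P_def
    proof (intro impI ballI)
      fix u v assume r01: "0 \<le> a \<and> a \<le> b \<and> b \<le> 1" and uv: "u \<in> supp (p a)" "v \<in> supp (p b)"
      have j: "joins S (p a) (p b) (portion a b p)" using r01 by (intro sub) auto
      have star: "w \<in> supp (portion a b p s)" if s: "s \<in> {0..1}" for s
      proof -
        have "0 \<le> s * (b - a)" "s * (b - a) \<le> b - a"
          using r01 s mult_left_le_one_le[of "b - a" s] by auto
        then have "dist (s * (b - a) + a) t < d" "s * (b - a) + a \<in> {0..1}"
          using ab r01 by (auto simp: dist_real_def)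
        then show ?thesis using nz[of "s * (b - a) + a"] by (simp add: portion_def linepath_def algebra_simps)
      qed
      have wab: "w \<in> supp (p a)" "w \<in> supp (p b)" using star[of 0] star[of 1] by (auto simp: portion_def linepath_def)
      have aS: "p a \<in> S" "p b \<in> S" using pc(2) r01 by auto
      have K: "{u} \<in> K" "{v} \<in> K" "{w} \<in> K" using vertex_in aS uv wab by blast+
      have e: "{u, w} \<in> K" "{w, v} \<in> K"
        using face[OF supp_in[OF aS(1)], of "{u, w}"] face[OF supp_in[OF aS(2)], of "{w, v}"] uv wab by auto
      have "loop_class S x (via u (detour u (portion a b p) v) v)
          = loop_class S x (via u (seg (vtx u) (vtx w) +++ seg (vtx w) (vtx v)) v)"
        by (rule via_cong[OF K(1,2) joins_detour[OF j uv] homotopic_detour_star[OF j uv star]])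
      also have "\<dots> = edge_class u w \<otimes>\<^bsub>FG\<^esub> edge_class w v"
        unfolding edge_class_def by (rule via_mult[OF K(1,3,2) joins_edge[OF e(1)] joins_edge[OF e(2)], symmetric])
      also have "\<dots> \<in> H" using e by (intro mult edges)
      finally show "loop_class S x (via u (detour u (portion a b p) v) v) \<in> H" .
    qed
    then show "\<exists>d>0. \<forall>a b. a \<le> t \<and> t \<le> b \<and> b - a < d \<longrightarrow> P a b" using d(1) by blast
  qed
  then have "loop_class S x (via r (detour r p r) r) \<in> H"
    unfolding P_def using r_in pc by (simp add: portion_def compose_linepath_01)
  \<comment> \<open>The segments added to \<open>p\<close> at its ends are \<open>T r\<close> and
    its reverse, so everything but \<open>p\<close> cancels.\<close>
  also have "loop_class S x (via r (detour r p r) r) = A"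
  proof -
    have rK: "{r} \<in> K" using vertex_in x_in r_in by blast
    note d = joins_detour[OF p r_in r_in]
    have C: "joins S x (vtx r) (T r)" using rK by (rule joins_T)
    note rC = joins_reversepath[OF C]
    have det: "detour r p r = reversepath (T r) +++ (p +++ T r)"
      unfolding detour_eq[OF p] by (simp add: T_root reversepath_seg)
    have "homotopic_paths S (via r (detour r p r) r) ((p +++ T r) +++ reversepath (T r))"
      unfolding via_def det
      by (rule homotopic_join[OF homotopic_cancel_left[OF C joins_join[OF p C]] homotopic_refl[OF rC]
        joins_join[OF C joins_join[OF rC joins_join[OF p C]]] rC])
    also have "homotopic_paths S \<dots> p" by (rule homotopic_cancel_right[OF p C])
    finally show ?thesis unfolding A by (rule loop_class_eqI[OF _ joins_via[OF rK rK d]])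
  qed
  finally show "A \<in> H" .
qed

end

section \<open>Monodromy of cocycles\<close>

text \<open>The covering space theory of the library is restricted to normed spaces, so realizations are
  transported to the space of bounded functions on the naturals.\<close>

definition basis_vec :: "nat \<Rightarrow> nat \<Rightarrow>\<^sub>C real"
  where "basis_vec k = Bcontfun (\<lambda>i. if i = k then 1 else 0)"

lemma basis_vec_apply: "apply_bcontfun (basis_vec k) i = (if i = k then 1 else 0)"
proof -
  have "(\<lambda>i::nat. if i = k then 1 else 0 :: real) \<in> bcontfun"
    by (rule bcontfun_normI[where b = 1]) auto
  then show ?thesis by (simp add: basis_vec_def Bcontfun_inverse)
qed

lemma bounded_linear_coord: "bounded_linear (\<lambda>y :: nat \<Rightarrow>\<^sub>C real. apply_bcontfun y i)"
  by (rule bounded_linear_intro[where K = 1])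
    (auto simp: plus_bcontfun.rep_eq scaleR_bcontfun.rep_eq intro: order_trans[OF _ norm_bounded])

lemma continuous_on_coord [continuous_intros]:
  "continuous_on A f \<Longrightarrow> continuous_on A (\<lambda>z. apply_bcontfun (f z :: nat \<Rightarrow>\<^sub>C real) i)"
  by (rule bounded_linear.continuous_on[OF bounded_linear_coord])

lemma coord_sum: "apply_bcontfun (\<Sum>w\<in>A. f w :: nat \<Rightarrow>\<^sub>C real) i = (\<Sum>w\<in>A. apply_bcontfun (f w) i)"
  using bounded_linear.linear[OF bounded_linear_coord] by (rule linear_sum)

lemma coord_sum_basis:
  assumes "finite A" "inj_on e A" "a \<in> A"
  shows "apply_bcontfun (\<Sum>w\<in>A. f w *\<^sub>R basis_vec (e w)) (e a) = f a"
proof -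
  have "apply_bcontfun (\<Sum>w\<in>A. f w *\<^sub>R basis_vec (e w)) (e a) = (\<Sum>w\<in>A. if w = a then f w else 0)"
    unfolding coord_sum using assms(2,3)
    by (intro sum.cong) (auto simp: scaleR_bcontfun.rep_eq basis_vec_apply inj_on_def)
  then show ?thesis using assms by simp
qed

text \<open>A cocycle with values in a possibly nonabelian group, normalised to be trivial on the
  tree. Finiteness of \<open>G\<close> keeps the covering built from it inside finitely many
  coordinates.\<close>

locale cocycle = tree_complex + group G for G :: "('c, 'd) monoid_scheme" (structure) +
  fixes c :: "nat \<Rightarrow> nat \<Rightarrow> 'c"
  assumes fin: "finite (carrier G)"
    and c_closed: "\<And>u v. c u v \<in> carrier G"
    and c_mult: "\<And>u v w. {u, v, w} \<in> K \<Longrightarrow> c u v \<otimes> c v w = c u w"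
    and c_tree: "\<And>v. {v} \<in> K \<Longrightarrow> v \<noteq> r \<Longrightarrow> c (par v) v = \<one>"
begin

lemma c_refl: "{u} \<in> K \<Longrightarrow> c u u = \<one>"
  using c_mult[of u u u] c_closed by simp

lemma c_inv: "{u, v} \<in> K \<Longrightarrow> c v u = inv (c u v)"
  using c_mult[of v u v] c_refl[of v] c_closed face[of "{u, v}" "{v}"]
  by (intro inv_equality[symmetric]) (auto simp: insert_commute)

definition V where "V = {v. {v} \<in> K}"

lemma finite_V: "finite V"
  using finite_vertices by (simp add: V_def)

definition code :: "nat \<times> 'c \<Rightarrow> nat"
  where "code = (SOME e. inj_on e (V \<times> carrier G))"

lemma inj_code: "inj_on code (V \<times> carrier G)"
proof -
  have "\<exists>e::nat \<times> 'c \<Rightarrow> nat. inj_on e (V \<times> carrier G)"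
    using finite_imp_inj_to_nat_seg[of "V \<times> carrier G"] finite_V fin by auto
  then show ?thesis unfolding code_def by (rule someI_ex)
qed

text \<open>Over the star of \<open>v\<close>, \<open>sheet v g\<close> is the section with label \<open>g\<close> at \<open>v\<close>; its label at an adjacent
  vertex \<open>w\<close> is then \<open>g \<otimes> c v w\<close>. The coordinate of \<open>w\<close> is stored at the code of the labelled vertex.\<close>

definition emb :: "(nat \<Rightarrow> real) \<Rightarrow> nat \<Rightarrow>\<^sub>C real"
  where "emb y = (\<Sum>w\<in>V. y w *\<^sub>R basis_vec w)"

definition sheet :: "nat \<Rightarrow> 'c \<Rightarrow> (nat \<Rightarrow>\<^sub>C real) \<Rightarrow> nat \<Rightarrow>\<^sub>C real"
  where "sheet v g z = (\<Sum>w\<in>V. apply_bcontfun z w *\<^sub>R basis_vec (code (w, g \<otimes> c v w)))"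

definition proj :: "(nat \<Rightarrow>\<^sub>C real) \<Rightarrow> nat \<Rightarrow>\<^sub>C real"
  where "proj s = (\<Sum>w\<in>V. (\<Sum>h\<in>carrier G. apply_bcontfun s (code (w, h))) *\<^sub>R basis_vec w)"

lemma continuous_emb: "continuous_on A emb"
  unfolding emb_def
  by (intro continuous_intros continuous_on_product_then_coordinatewise[where f = "\<lambda>y. y"])

lemma continuous_sheet: "continuous_on A (sheet v g)"
  unfolding sheet_def by (intro continuous_intros)

lemma continuous_proj: "continuous_on A proj"
  unfolding proj_def by (intro continuous_intros)

lemma emb_coord: "w \<in> V \<Longrightarrow> apply_bcontfun (emb y) w = y w"
  unfolding emb_def using coord_sum_basis[of V "\<lambda>w. w" w y] finite_V by auto

lemma sheet_coord:
  assumes "w \<in> V" "h \<in> carrier G" "g \<in> carrier G"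
  shows "apply_bcontfun (sheet v g z) (code (w, h)) = (if h = g \<otimes> c v w then apply_bcontfun z w else 0)"
proof -
  have "apply_bcontfun (sheet v g z) (code (w, h))
      = (\<Sum>u\<in>V. if u = w \<and> h = g \<otimes> c v w then apply_bcontfun z w else 0)"
    unfolding sheet_def coord_sum using assms c_closed
    by (intro sum.cong)
      (auto simp: scaleR_bcontfun.rep_eq basis_vec_apply dest!: inj_onD[OF inj_code])
  also have "\<dots> = (if h = g \<otimes> c v w then apply_bcontfun z w else 0)"
    using assms finite_V by (cases "h = g \<otimes> c v w") auto
  finally show ?thesis .
qed

lemma proj_sheet:
  assumes "g \<in> carrier G"
  shows "proj (sheet v g (emb y)) = emb y"
proof -
  have "(\<Sum>h\<in>carrier G. apply_bcontfun (sheet v g (emb y)) (code (w, h))) = y w" if "w \<in> V" for w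
    using that assms fin c_closed by (simp add: sheet_coord emb_coord)
  then show ?thesis unfolding proj_def emb_def[of y] by (intro sum.cong) auto
qed

text \<open>On the carrier of \<open>y\<close> the cocycle identity matches the two labellings; off
  the carrier the coefficients vanish, whatever the labels.\<close>

lemma sheet_change:
  assumes "\<sigma> \<in> K" "supp y \<union> {u, v} \<subseteq> \<sigma>" "g \<in> carrier G"
  shows "sheet u g (emb y) = sheet v (g \<otimes> c u v) (emb y)"
  unfolding sheet_def
proof (intro sum.cong refl)
  fix w assume w: "w \<in> V"
  show "apply_bcontfun (emb y) w *\<^sub>R basis_vec (code (w, g \<otimes> c u w))
      = apply_bcontfun (emb y) w *\<^sub>R basis_vec (code (w, g \<otimes> c u v \<otimes> c v w))"
  proof (cases "w \<in> supp y")
    case True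
    then have "{u, v, w} \<in> K" using assms by (intro face[OF assms(1)]) auto
    then show ?thesis using assms(3) c_closed by (simp add: m_assoc c_mult)
  next
    case False
    then show ?thesis using w by (simp add: emb_coord supp_def)
  qed
qed

definition base where "base = emb ` S"

definition cover where "cover = {sheet v g (emb y) | v g y. y \<in> S \<and> v \<in> supp y \<and> g \<in> carrier G}"

lemma in_V: "y \<in> S \<Longrightarrow> v \<in> supp y \<Longrightarrow> v \<in> V"
  using vertex_in by (auto simp: V_def)

lemma sheet_in_cover:
  assumes "y \<in> S" "\<sigma> \<in> K" "supp y \<union> {u} \<subseteq> \<sigma>" "g \<in> carrier G"
  shows "sheet u g (emb y) \<in> cover"
proof -
  obtain v where v: "v \<in> supp y" using supp_nonempty[OF assms(1)] by blast
  have "sheet u g (emb y) = sheet v (g \<otimes> c u v) (emb y)"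
    using assms v by (intro sheet_change) auto
  then show ?thesis unfolding cover_def using assms v c_closed by blast
qed

text \<open>Over the open star of a vertex \<open>v\<close> the preimage splits into sheets with a
  fixed label \<open>g\<close> at \<open>v\<close>, and \<open>sheet v g\<close> inverts
  \<open>proj\<close> there.\<close>

lemma covering: "covering_space cover proj base"
proof
  show "continuous_on cover proj" by (rule continuous_proj)
  show "proj ` cover = base"
  proof
    show "proj ` cover \<subseteq> base" by (auto simp: cover_def base_def proj_sheet)
    show "base \<subseteq> proj ` cover"
    proof
      fix z assume "z \<in> base"
      then obtain y where y: "y \<in> S" "z = emb y" by (auto simp: base_def)
      obtain v where "v \<in> supp y" using supp_nonempty[OF y(1)] by blast
      then have "sheet v \<one> (emb y) \<in> cover" using y by (intro sheet_in_cover[of _ "supp y"] supp_in) auto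
      then show "z \<in> proj ` cover" using y proj_sheet[of \<one> v y] by force
    qed
  qed
  fix z assume "z \<in> base"
  then obtain y0 where y0: "y0 \<in> S" "z = emb y0" by (auto simp: base_def)
  obtain v where v: "v \<in> supp y0" using supp_nonempty[OF y0(1)] by blast
  have vV: "v \<in> V" using in_V y0 v by blast
  define U where "U = base \<inter> (\<lambda>z. apply_bcontfun z v) -` (- {0})"
  have U: "U = emb ` {y \<in> S. v \<in> supp y}"
    using vV by (auto simp: U_def base_def supp_def emb_coord)
  have Uopen: "openin (top_of_set base) U"
    unfolding U_def by (rule continuous_openin_preimage_gen) (auto intro!: continuous_intros)
  have memU: "v \<in> supp y" if "y \<in> S" "emb y \<in> U" for y
    using that vV by (auto simp: U_def supp_def emb_coord)
  have cvv: "c v v = \<one>" using vV by (simp add: V_def c_refl)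
  \<comment> \<open>Nonvanishing of the coordinate of \<open>(v, g)\<close> cuts this sheet out of
    \<open>cover\<close>; this yields both its openness and the disjointness of different
    sheets.\<close>
  have shU: "sheet v g ` U = cover \<inter> (\<lambda>s. apply_bcontfun s (code (v, g))) -` (- {0})" if g: "g \<in> carrier G" for g
  proof
    show "sheet v g ` U \<subseteq> cover \<inter> (\<lambda>s. apply_bcontfun s (code (v, g))) -` (- {0})"
      unfolding U using g vV
      by (auto simp: sheet_coord emb_coord cvv supp_def intro!: sheet_in_cover[of _ "supp _"] supp_in)
    show "cover \<inter> (\<lambda>s. apply_bcontfun s (code (v, g))) -` (- {0}) \<subseteq> sheet v g ` U"
    proof
      fix s assume s: "s \<in> cover \<inter> (\<lambda>s. apply_bcontfun s (code (v, g))) -` (- {0})"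
      then obtain v' g' y where y: "s = sheet v' g' (emb y)" "y \<in> S" "v' \<in> supp y" "g' \<in> carrier G"
        by (auto simp: cover_def)
      then have "g = g' \<otimes> c v' v" "y v \<noteq> 0" using s g vV by (auto simp: sheet_coord emb_coord split: if_splits)
      moreover from this have "s = sheet v (g' \<otimes> c v' v) (emb y)"
        unfolding y(1) using y by (intro sheet_change[of "supp y"] supp_in) (auto simp: supp_def)
      ultimately show "s \<in> sheet v g ` U" using y(2) by (auto simp: U supp_def)
    qed
  qed
  show "\<exists>T. z \<in> T \<and> openin (top_of_set base) T \<and> (\<exists>\<V>. \<Union>\<V> = cover \<inter> proj -` T \<and>
      (\<forall>u\<in>\<V>. openin (top_of_set cover) u) \<and> pairwise disjnt \<V> \<and> (\<forall>u\<in>\<V>. \<exists>q. homeomorphism u T proj q))"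
  proof (intro exI[of _ U] conjI exI[of _ "(\<lambda>g. sheet v g ` U) ` carrier G"])
    show "z \<in> U" using y0 v by (auto simp: U)
    show "openin (top_of_set base) U" by (rule Uopen)
    show "\<Union> ((\<lambda>g. sheet v g ` U) ` carrier G) = cover \<inter> proj -` U"
    proof
      show "\<Union> ((\<lambda>g. sheet v g ` U) ` carrier G) \<subseteq> cover \<inter> proj -` U"
      proof clarify
        fix g z assume g: "g \<in> carrier G" "z \<in> U"
        then obtain y where "z = emb y" by (auto simp: U)
        moreover have "sheet v g z \<in> cover" using shU[OF g(1)] g(2) by blast
        ultimately show "sheet v g z \<in> cover \<inter> proj -` U" using g by (simp add: proj_sheet)
      qed
      show "cover \<inter> proj -` U \<subseteq> \<Union> ((\<lambda>g. sheet v g ` U) ` carrier G)"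
      proof
        fix s assume s: "s \<in> cover \<inter> proj -` U"
        then obtain v' g' y where y: "s = sheet v' g' (emb y)" "y \<in> S" "v' \<in> supp y" "g' \<in> carrier G"
          by (auto simp: cover_def)
        then have yU: "emb y \<in> U" using s by (simp add: proj_sheet)
        then have "s = sheet v (g' \<otimes> c v' v) (emb y)"
          unfolding y(1) using y memU by (intro sheet_change[of "supp y"] supp_in) auto
        then show "s \<in> \<Union> ((\<lambda>g. sheet v g ` U) ` carrier G)" using yU y(4) c_closed by blast
      qed
    qed
    show "\<forall>u\<in>(\<lambda>g. sheet v g ` U) ` carrier G. openin (top_of_set cover) u"
    proof clarify
      fix g assume g: "g \<in> carrier G"
      show "openin (top_of_set cover) (sheet v g ` U)"
        unfolding shU[OF g] by (intro continuous_openin_preimage_gen) (auto intro!: continuous_intros)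
    qed
    show "pairwise disjnt ((\<lambda>g. sheet v g ` U) ` carrier G)"
    proof (rule pairwise_imageI)
      fix g h assume gh: "g \<in> carrier G" "h \<in> carrier G" "g \<noteq> h"
      have False if y: "s \<in> sheet v g ` U" "s \<in> sheet v h ` U" for s
      proof -
        have "apply_bcontfun s (code (v, g)) \<noteq> 0" using y(1) shU[OF gh(1)] by auto
        then show False using y(2) gh vV by (auto simp: sheet_coord cvv)
      qed
      then show "disjnt (sheet v g ` U) (sheet v h ` U)" by (auto simp: disjnt_iff)
    qed
    show "\<forall>u\<in>(\<lambda>g. sheet v g ` U) ` carrier G. \<exists>q. homeomorphism u U proj q"
    proof clarify
      fix g assume g: "g \<in> carrier G"
      have "homeomorphism (sheet v g ` U) U proj (sheet v g)"
        by (rule homeomorphismI) (use g in \<open>auto simp: U proj_sheet intro: continuous_proj continuous_sheet\<close>)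
      then show "\<exists>q. homeomorphism (sheet v g ` U) U proj q" by blast
    qed
  qed
qed

definition lifts :: "nat \<Rightarrow> nat \<Rightarrow> (real \<Rightarrow> nat \<Rightarrow> real) \<Rightarrow> 'c \<Rightarrow> bool"
  where "lifts u v p g \<longleftrightarrow> (\<forall>k\<in>carrier G. \<exists>q. joins cover (sheet u k (emb (p 0))) (sheet v (k \<otimes> g) (emb (p 1))) q
    \<and> (\<forall>t\<in>{0..1}. proj (q t) = emb (p t)))"

lemma lifts_join:
  assumes "lifts u v p g" "lifts v w q h" "joins S a b p" "joins S b d q" "g \<in> carrier G" "h \<in> carrier G"
  shows "lifts u w (p +++ q) (g \<otimes> h)"
  unfolding lifts_def
proof
  fix k assume k: "k \<in> carrier G"
  have pq: "p 1 = q 0" "(p +++ q) 0 = p 0" "(p +++ q) 1 = q 1"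
    using assms(3,4) by (auto simp: joins_def pathstart_def pathfinish_def joinpaths_def)
  obtain l where l: "joins cover (sheet u k (emb (p 0))) (sheet v (k \<otimes> g) (emb (p 1))) l"
    "\<And>t. t \<in> {0..1} \<Longrightarrow> proj (l t) = emb (p t)"
    using assms(1) k unfolding lifts_def by blast
  obtain m where m: "joins cover (sheet v (k \<otimes> g) (emb (q 0))) (sheet w (k \<otimes> g \<otimes> h) (emb (q 1))) m"
    "\<And>t. t \<in> {0..1} \<Longrightarrow> proj (m t) = emb (q t)"
    using assms(2,5) k unfolding lifts_def by (meson m_closed)
  have "joins cover (sheet u k (emb ((p +++ q) 0))) (sheet w (k \<otimes> (g \<otimes> h)) (emb ((p +++ q) 1))) (l +++ m)"
    using joins_join[OF l(1), of _ m] m(1) k assms(5,6) by (simp add: pq m_assoc)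
  moreover have "\<forall>t\<in>{0..1}. proj ((l +++ m) t) = emb ((p +++ q) t)"
    using l(2) m(2) by (auto simp: joinpaths_def)
  ultimately show "\<exists>q'. joins cover (sheet u k (emb ((p +++ q) 0))) (sheet w (k \<otimes> (g \<otimes> h)) (emb ((p +++ q) 1))) q'
      \<and> (\<forall>t\<in>{0..1}. proj (q' t) = emb ((p +++ q) t))" by blast
qed

lemma lifts_reversepath:
  assumes "lifts u v p g" "g \<in> carrier G"
  shows "lifts v u (reversepath p) (inv g)"
  unfolding lifts_def
proof
  fix k assume k: "k \<in> carrier G"
  then obtain l where l: "joins cover (sheet u (k \<otimes> inv g) (emb (p 0))) (sheet v (k \<otimes> inv g \<otimes> g) (emb (p 1))) l"
    "\<And>t. t \<in> {0..1} \<Longrightarrow> proj (l t) = emb (p t)"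
    using assms unfolding lifts_def by (meson m_closed inv_closed)
  have "joins cover (sheet v k (emb (reversepath p 0))) (sheet u (k \<otimes> inv g) (emb (reversepath p 1))) (reversepath l)"
    using joins_reversepath[OF l(1)] k assms(2) by (simp add: reversepath_def m_assoc)
  moreover have "\<forall>t\<in>{0..1}. proj (reversepath l t) = emb (reversepath p t)"
    using l(2) by (simp add: reversepath_def)
  ultimately show "\<exists>q. joins cover (sheet v k (emb (reversepath p 0))) (sheet u (k \<otimes> inv g) (emb (reversepath p 1))) q
      \<and> (\<forall>t\<in>{0..1}. proj (q t) = emb (reversepath p t))" by blast
qed

lemma lifts_in_simplex:
  assumes p: "joins S a b p" and \<sigma>: "\<sigma> \<in> K" "\<And>t. t \<in> {0..1} \<Longrightarrow> supp (p t) \<subseteq> \<sigma>" and uv: "u \<in> \<sigma>" "v \<in> \<sigma>"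
  shows "lifts u v p (c u v)"
  unfolding lifts_def
proof
  fix k assume k: "k \<in> carrier G"
  have pS: "p t \<in> S" if "t \<in> {0..1}" for t using p that by (auto simp: joins_def path_image_def)
  have "continuous_on {0..1} (\<lambda>t. sheet u k (emb (p t)))"
    using p by (intro continuous_on_compose2[OF continuous_sheet[of UNIV]] continuous_on_compose2[OF continuous_emb[of UNIV]])
      (auto simp: joins_def path_def)
  moreover have "sheet u k (emb (p t)) \<in> cover" if "t \<in> {0..1}" for t
    using pS[OF that] \<sigma>(1) \<sigma>(2)[OF that] uv k by (intro sheet_in_cover[of _ \<sigma>]) auto
  moreover have "sheet u k (emb (p 1)) = sheet v (k \<otimes> c u v) (emb (p 1))"
    using \<sigma>(1) \<sigma>(2)[of 1] uv k by (intro sheet_change[of \<sigma>]) auto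
  ultimately have "joins cover (sheet u k (emb (p 0))) (sheet v (k \<otimes> c u v) (emb (p 1))) (\<lambda>t. sheet u k (emb (p t)))"
    by (auto simp: joins_def path_def path_image_def pathstart_def pathfinish_def)
  then show "\<exists>q. joins cover (sheet u k (emb (p 0))) (sheet v (k \<otimes> c u v) (emb (p 1))) q
      \<and> (\<forall>t\<in>{0..1}. proj (q t) = emb (p t))" using k by (auto simp: proj_sheet)
qed

lemma lifts_edge: "{u, v} \<in> K \<Longrightarrow> lifts u v (seg (vtx u) (vtx v)) (c u v)"
  using supp_seg[of "vtx u" "vtx v"] by (intro lifts_in_simplex[OF joins_edge, of u v "{u, v}"]) auto

lemma lifts_T: "{v} \<in> K \<Longrightarrow> lifts r v (T v) \<one>"
proof (induction rule: tree_induct)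
  case root
  have "{r} \<in> K" using vertex_in x_in r_in by blast
  moreover have "lifts r r (T r) (c r r)"
    unfolding T_root using supp_seg[of x "vtx r"] x_in r_in
    by (intro lifts_in_simplex[OF joins_to_vertex, of x r "supp x"] supp_in) auto
  ultimately show ?case by (simp add: c_refl)
next
  case (step v)
  have "lifts (par v) v (seg (vtx (par v)) (vtx v)) \<one>"
    using lifts_edge[OF step(4)] c_tree[OF step(1,2)] by simp
  then show ?case
    using lifts_join[OF step(5) _ joins_T[OF step(3)] joins_edge[OF step(4)]] T_step[OF step(1,2)] by simp
qed

lemma lifts_via:
  assumes "{u, v} \<in> K"
  shows "lifts r r (via u (seg (vtx u) (vtx v)) v) (c u v)"
proof -
  have uv: "{u} \<in> K" "{v} \<in> K" using edge_vertices[OF assms] by auto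
  note j = joins_T[OF uv(1)] joins_edge[OF assms] joins_T[OF uv(2)]
  have "lifts r v (T u +++ seg (vtx u) (vtx v)) (\<one> \<otimes> c u v)"
    by (rule lifts_join[OF lifts_T[OF uv(1)] lifts_edge[OF assms] j(1,2)]) (auto simp: c_closed)
  then have "lifts r r (via u (seg (vtx u) (vtx v)) v) (\<one> \<otimes> c u v \<otimes> inv \<one>)"
    unfolding via_def
    by (rule lifts_join[OF _ lifts_reversepath[OF lifts_T[OF uv(2)]] joins_join[OF j(1,2)] joins_reversepath[OF j(3)]])
      (auto simp: c_closed)
  then show ?thesis using c_closed by simp
qed

text \<open>Lifts of homotopic loops with a common start end at the same point, and the label at
  \<open>r\<close> can be read off there because \<open>x r\<close> is nonzero.\<close>

lemma lifts_unique:
  assumes pq: "homotopic_paths S p q" "joins S x x p"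
    and g: "lifts r r p g" "lifts r r q h" "g \<in> carrier G" "h \<in> carrier G"
  shows "g = h"
proof -
  have q: "joins S x x q" using joins_homotopic pq by blast
  have ends: "p 0 = x" "p 1 = x" "q 0 = x" "q 1 = x"
    using pq(2) q by (auto simp: joins_def pathstart_def pathfinish_def)
  obtain l where l: "joins cover (sheet r \<one> (emb x)) (sheet r g (emb x)) l" "\<And>t. t \<in> {0..1} \<Longrightarrow> proj (l t) = emb (p t)"
    using g(1,3) ends unfolding lifts_def by (metis l_one one_closed)
  obtain m where m: "joins cover (sheet r \<one> (emb x)) (sheet r h (emb x)) m" "\<And>t. t \<in> {0..1} \<Longrightarrow> proj (m t) = emb (q t)"
    using g(2,4) ends unfolding lifts_def by (metis l_one one_closed)
  have hom: "homotopic_paths base (emb \<circ> p) (emb \<circ> q)"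
    by (rule homotopic_paths_continuous_image[OF pq(1) continuous_emb]) (auto simp: base_def)
  have "pathfinish l = pathfinish m"
  proof (rule covering_space_monodromy[OF covering _ _ _ _ hom])
    show "path (emb \<circ> p)" "path (emb \<circ> q)" "path_image (emb \<circ> p) \<subseteq> base" "path_image (emb \<circ> q) \<subseteq> base"
      using homotopic_paths_imp_path[OF hom] homotopic_paths_imp_subset[OF hom] by auto
  qed (use l m in \<open>auto simp: joins_def\<close>)
  then have eq: "sheet r g (emb x) = sheet r h (emb x)" using l(1) m(1) by (simp add: joins_def)
  have rV: "r \<in> V" using in_V x_in r_in by blast
  then have crr: "c r r = \<one>" by (simp add: V_def c_refl)
  have "apply_bcontfun (sheet r g (emb x)) (code (r, g)) \<noteq> 0"
    using rV r_in g by (simp add: sheet_coord emb_coord crr supp_def)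
  then show "g = h" unfolding eq using rV r_in g by (auto simp: sheet_coord crr split: if_splits)
qed

text \<open>Holonomy is well defined on classes by \<open>lifts_unique\<close>. It exists for every
  class, since the classes that have one include the edge classes and are closed under
  products.\<close>

theorem monodromy:
  obtains \<mu> where "\<mu> \<in> hom FG G" "\<And>u v. {u, v} \<in> K \<Longrightarrow> \<mu> (edge_class u v) = c u v"
proof -
  define R where "R A g \<longleftrightarrow> g \<in> carrier G \<and> (\<exists>p. joins S x x p \<and> A = loop_class S x p \<and> lifts r r p g)" for A g
  have edge: "R (edge_class u v) (c u v)" if uv: "{u, v} \<in> K" for u v
    unfolding R_def edge_class_def using edge_vertices[OF uv] lifts_via[OF uv] joins_via joins_edge[OF uv] c_closed
    by blast
  have mult: "R (A \<otimes>\<^bsub>FG\<^esub> A') (g \<otimes> h)" if AA: "R A g" "R A' h" for A A' g h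
  proof -
    obtain p q where pq: "A = loop_class S x p" "joins S x x p" "g \<in> carrier G" "lifts r r p g"
      "A' = loop_class S x q" "joins S x x q" "h \<in> carrier G" "lifts r r q h" using AA unfolding R_def by blast
    have "lifts r r (p +++ q) (g \<otimes> h)" using pq by (intro lifts_join) auto
    then show ?thesis
      unfolding R_def pq(1,5) mult_loop_class[OF pq(2,6)] using joins_join[OF pq(2,6)] pq(3,7) by blast
  qed
  have unique: "g = h" if AA: "R A g" "R A h" for A g h
  proof -
    obtain p q where pq: "A = loop_class S x p" "joins S x x p" "g \<in> carrier G" "lifts r r p g"
      "A = loop_class S x q" "joins S x x q" "h \<in> carrier G" "lifts r r q h" using AA unfolding R_def by blast
    then show ?thesis using lifts_unique[of p q g h] loop_class_eq_iff[OF pq(2,6)] by simp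
  qed
  have "carrier FG \<subseteq> {A. \<exists>g. R A g}"
    by (rule edge_classes_generate) (use edge mult in blast)+
  then have total: "\<exists>g. R A g" if "A \<in> carrier FG" for A using that by blast
  define \<mu> where "\<mu> A = (THE g. R A g)" for A
  have \<mu>: "\<mu> A = g" if "R A g" for A g
    unfolding \<mu>_def using that unique by blast
  show ?thesis
  proof
    show "\<mu> \<in> hom FG G"
    proof (rule homI)
      fix A assume "A \<in> carrier FG"
      then obtain g where g: "R A g" using total by blast
      then show "\<mu> A \<in> carrier G" using \<mu>[OF g] by (simp add: R_def)
      fix A' assume "A' \<in> carrier FG"
      then obtain h where h: "R A' h" using total by blast
      show "\<mu> (A \<otimes>\<^bsub>FG\<^esub> A') = \<mu> A \<otimes> \<mu> A'" using \<mu>[OF g] \<mu>[OF h] \<mu>[OF mult[OF g h]] by simp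
    qed
    show "\<mu> (edge_class u v) = c u v" if "{u, v} \<in> K" for u v using \<mu>[OF edge[OF that]] .
  qed
qed

end

section \<open>Determinants and orders of abelian groups\<close>

text \<open>The leading \<open>n\<close> by \<open>n\<close> minor of an unbounded array, so that
  the size can vary in inductions and rows can be replaced by function update.\<close>

definition fdet :: "nat \<Rightarrow> (nat \<Rightarrow> nat \<Rightarrow> 'a::comm_ring_1) \<Rightarrow> 'a"
  where "fdet n f = Determinant.det (mat n n (\<lambda>(i, j). f i j))"

lemma fdet_0 [simp]: "fdet 0 f = 1"
  by (simp add: fdet_def)

lemma fdet_addrow:
  assumes "l < n" "k \<noteq> l"
  shows "fdet n (\<lambda>i. if i = k then (\<lambda>j. f i j + a * f l j) else f i) = fdet n f"
proof -
  have "mat n n (\<lambda>(i, j). (if i = k then (\<lambda>j. f i j + a * f l j) else f i) j)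
      = addrow a k l (mat n n (\<lambda>(i, j). f i j))"
    using assms by (intro eq_matI) (auto simp: mat_addrow_gen_def)
  then show ?thesis
    unfolding fdet_def using det_addrow[OF assms, of "mat n n (\<lambda>(i, j). f i j)" a] by simp
qed

lemma fdet_swaprows:
  assumes "k < n" "l < n" "k \<noteq> l"
  shows "fdet n (f(k := f l, l := f k)) = - fdet n f"
proof -
  have "mat n n (\<lambda>(i, j). (f(k := f l, l := f k)) i j) = swaprows k l (mat n n (\<lambda>(i, j). f i j))"
    using assms by (intro eq_matI) (auto simp: mat_swaprows_def)
  moreover have "Determinant.det (swaprows k l (mat n n (\<lambda>(i, j). f i j))) = - fdet n f"
    unfolding fdet_def by (rule det_swaprows) (use assms in auto)
  ultimately show ?thesis
    unfolding fdet_def by (simp only:)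
qed

text \<open>The cofactors along the last row do not depend on that row, and the last of them is the
  previous minor.\<close>

lemma fdet_last_row:
  fixes f :: "nat \<Rightarrow> nat \<Rightarrow> 'a::comm_ring_1"
  obtains c where "c n = fdet n f"
    and "\<And>r. fdet (Suc n) (f(n := r)) = (\<Sum>j<Suc n. r j * c j)"
proof -
  define A where "A r = mat (Suc n) (Suc n) (\<lambda>(i, j). (f(n := r)) i j)" for r
  have A: "A r \<in> carrier_mat (Suc n) (Suc n)" for r by (simp add: A_def)
  have 1: "cofactor (A (\<lambda>_. 0)) n n = fdet n f"
    unfolding cofactor_def fdet_def
    by (auto simp: mat_delete_def A_def power_add[symmetric] intro!: arg_cong[where f = Determinant.det])
  have 2: "fdet (Suc n) (f(n := r)) = (\<Sum>j<Suc n. r j * cofactor (A (\<lambda>_. 0)) n j)" for r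
  proof -
    have "mat_delete (A r) n j = mat_delete (A (\<lambda>_. 0)) n j" for j
      by (intro eq_matI) (auto simp: mat_delete_def A_def)
    then have "cofactor (A r) n j = cofactor (A (\<lambda>_. 0)) n j" for j
      unfolding cofactor_def by simp
    then show ?thesis
      using laplace_expansion_row[OF A, of n r]
      by (simp add: fdet_def A_def[symmetric] del: sum.lessThan_Suc) (simp add: A_def del: sum.lessThan_Suc)
  qed
  show ?thesis using that[OF 1 2] .
qed

lemma fdet_last_col:
  fixes f :: "nat \<Rightarrow> nat \<Rightarrow> 'a::comm_ring_1"
  assumes "\<And>i. i < n \<Longrightarrow> f i n = 0"
  shows "fdet (Suc n) f = f n n * fdet n f"
proof -
  define A where "A = mat (Suc n) (Suc n) (\<lambda>(i, j). f i j)"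
  have A: "A \<in> carrier_mat (Suc n) (Suc n)" by (simp add: A_def)
  have "fdet (Suc n) f = (\<Sum>i<Suc n. A $$ (i, n) * cofactor A i n)"
    using laplace_expansion_column[OF A, of n] by (simp add: fdet_def A_def)
  also have "\<dots> = f n n * cofactor A n n"
    by (simp add: A_def assms)
  also have "cofactor A n n = fdet n f"
    unfolding cofactor_def fdet_def
    by (auto simp: mat_delete_def A_def power_add[symmetric] intro!: arg_cong[where f = Determinant.det])
  finally show ?thesis .
qed

lemma fdet_identical_rows:
  assumes "k < n" "l < n" "k \<noteq> l" "f k = f l"
  shows "fdet n f = 0"
proof -
  let ?A = "mat n n (\<lambda>(i, j). f i j)"
  have "row ?A k = row ?A l" using assms by (intro eq_vecI) auto
  then show ?thesis
    unfolding fdet_def using det_identical_rows[of ?A n k l] assms by simp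
qed

text \<open>The coefficients along the new row are cofactors, and one of them is the previous minor;
  so some admissible row has a nonzero product with them.\<close>

lemma nonzero_minor:
  fixes r :: "'i \<Rightarrow> nat \<Rightarrow> int"
  assumes ker: "\<And>c. \<lbrakk>\<And>i. i \<in> I \<Longrightarrow> (\<Sum>j<m. r i j * c j) = 0\<rbrakk> \<Longrightarrow> \<forall>j<m. c j = (0::int)"
    and "k \<le> m"
  shows "\<exists>\<rho>. (\<forall>i<k. \<rho> i \<in> I) \<and> fdet k (\<lambda>i. r (\<rho> i)) \<noteq> 0"
  using \<open>k \<le> m\<close>
proof (induction k)
  case (Suc k)
  then obtain \<rho> where \<rho>: "\<forall>i<k. \<rho> i \<in> I" "fdet k (\<lambda>i. r (\<rho> i)) \<noteq> 0" by auto
  obtain c where c: "c k = fdet k (\<lambda>i. r (\<rho> i))"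
    "\<And>x. fdet (Suc k) ((\<lambda>i. r (\<rho> i))(k := x)) = (\<Sum>j<Suc k. x j * c j)"
    using fdet_last_row by blast
  define c' where "c' j = (if j < Suc k then c j else 0)" for j
  have "c' k \<noteq> 0" "k < m" using c \<rho> Suc.prems by (auto simp: c'_def)
  then obtain i where i: "i \<in> I" "(\<Sum>j<m. r i j * c' j) \<noteq> 0" using ker[of c'] by blast
  have "(\<Sum>j<m. r i j * c' j) = (\<Sum>j<Suc k. r i j * c' j)"
    by (rule sum.mono_neutral_right) (use Suc.prems in \<open>auto simp: c'_def\<close>)
  also have "\<dots> = fdet (Suc k) ((\<lambda>i. r (\<rho> i))(k := r i))"
    unfolding c(2) by (intro sum.cong) (auto simp: c'_def)
  also have "(\<lambda>i. r (\<rho> i))(k := r i) = (\<lambda>j. r ((\<rho>(k := i)) j))" by auto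
  finally show ?case using i \<rho> by (intro exI[of _ "\<rho>(k := i)"]) auto
qed simp

text \<open>The projections of row \<open>k\<close> onto the first \<open>p\<close> rows are
  subtracted one at a time; this keeps the determinant, and the squared norm drops by that of each
  projection.\<close>

lemma gram_schmidt_step:
  fixes f :: "nat \<Rightarrow> nat \<Rightarrow> real"
  assumes "k < n" and "p \<le> k"
    and orth: "\<And>i i'. i < k \<Longrightarrow> i' < k \<Longrightarrow> i \<noteq> i' \<Longrightarrow> (\<Sum>j<n. f i j * f i' j) = 0"
  shows "\<exists>v. fdet n (f(k := v)) = fdet n f \<and> (\<Sum>j<n. (v j)\<^sup>2) \<le> (\<Sum>j<n. (f k j)\<^sup>2) \<and>
    (\<forall>i<p. (\<Sum>j<n. f i j * v j) = 0)"
  using \<open>p \<le> k\<close>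
proof (induction p)
  case 0
  show ?case by (intro exI[of _ "f k"]) simp
next
  case (Suc p)
  then obtain v where v: "fdet n (f(k := v)) = fdet n f" "(\<Sum>j<n. (v j)\<^sup>2) \<le> (\<Sum>j<n. (f k j)\<^sup>2)"
    "\<And>i. i < p \<Longrightarrow> (\<Sum>j<n. f i j * v j) = 0" by (metis Suc_leD)
  define q where "q = (\<Sum>j<n. (f p j)\<^sup>2)"
  define b where "b = (\<Sum>j<n. f p j * v j)"
  have q0: "q \<ge> 0" unfolding q_def by (intro sum_nonneg) auto
  have b0: "b = 0" if "q = 0"
  proof -
    have "\<forall>j\<in>{..<n}. (f p j)\<^sup>2 = 0"
      using that unfolding q_def by (subst (asm) sum_nonneg_eq_0_iff) auto
    then show ?thesis unfolding b_def by (intro sum.neutral) auto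
  qed
  \<comment> \<open>If \<open>q = 0\<close>, then also \<open>b = 0\<close> and division by zero
    gives \<open>a = 0\<close>; so \<open>a * q = - b\<close> holds in every case.\<close>
  define a where "a = - b / q"
  define w where "w j = v j + a * f p j" for j
  have aq: "a * q = - b" using b0 by (auto simp: a_def)
  have det: "fdet n (f(k := w)) = fdet n (f(k := v))"
  proof -
    have "f(k := w) = (\<lambda>i. if i = k then (\<lambda>j. (f(k := v)) i j + a * (f(k := v)) p j) else (f(k := v)) i)"
      using Suc.prems by (auto simp: w_def fun_eq_iff)
    then show ?thesis using fdet_addrow[of p n k "f(k := v)" a] Suc.prems assms by simp
  qed
  have w2: "(\<Sum>j<n. f i j * w j) = (\<Sum>j<n. f i j * v j) + a * (\<Sum>j<n. f i j * f p j)" for i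
    by (simp add: w_def algebra_simps sum.distrib sum_distrib_left)
  have "(\<Sum>j<n. (w j)\<^sup>2) = (\<Sum>j<n. (v j)\<^sup>2) + 2 * a * b + a\<^sup>2 * q"
    by (simp add: w_def b_def q_def algebra_simps power2_eq_square sum.distrib sum_distrib_left)
  also have "\<dots> = (\<Sum>j<n. (v j)\<^sup>2) - a\<^sup>2 * q"
  proof -
    have "2 * a * b = - 2 * (a\<^sup>2 * q)" using aq by (simp add: power2_eq_square algebra_simps)
    then show ?thesis by linarith
  qed
  finally have norm: "(\<Sum>j<n. (w j)\<^sup>2) \<le> (\<Sum>j<n. (f k j)\<^sup>2)" using v(2) q0 by (smt (verit) mult_nonneg_nonneg zero_le_power2)
  have orth': "(\<Sum>j<n. f i j * w j) = 0" if "i < Suc p" for i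
  proof (cases "i = p")
    case True
    then show ?thesis using w2[of p] aq by (simp add: b_def q_def power2_eq_square)
  next
    case False
    then show ?thesis using w2[of i] v(3)[of i] orth[of i p] that Suc.prems by simp
  qed
  have "fdet n (f(k := w)) = fdet n f" using det v(1) by (rule trans)
  then show ?case using norm orth' by blast
qed

text \<open>Once the rows are orthogonal, the matrix times its transpose is diagonal with the
  squared row norms as entries, and its determinant is the square of
  \<open>fdet n f\<close>.\<close>

lemma hadamard_inequality:
  fixes f :: "nat \<Rightarrow> nat \<Rightarrow> real"
  shows "(fdet n f)\<^sup>2 \<le> (\<Prod>i<n. \<Sum>j<n. (f i j)\<^sup>2)"
proof -
  have "\<exists>g. fdet n g = fdet n f \<and> (\<forall>i<n. (\<Sum>j<n. (g i j)\<^sup>2) \<le> (\<Sum>j<n. (f i j)\<^sup>2)) \<and>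
     (\<forall>i<k. \<forall>i'<k. i \<noteq> i' \<longrightarrow> (\<Sum>j<n. g i j * g i' j) = 0)" if "k \<le> n" for k
    using that
  proof (induction k)
    case 0
    show ?case by (intro exI[of _ f]) auto
  next
    case (Suc k)
    then obtain g where g: "fdet n g = fdet n f" "\<And>i. i < n \<Longrightarrow> (\<Sum>j<n. (g i j)\<^sup>2) \<le> (\<Sum>j<n. (f i j)\<^sup>2)"
      "\<And>i i'. i < k \<Longrightarrow> i' < k \<Longrightarrow> i \<noteq> i' \<Longrightarrow> (\<Sum>j<n. g i j * g i' j) = 0" by auto
    obtain v where v: "fdet n (g(k := v)) = fdet n g" "(\<Sum>j<n. (v j)\<^sup>2) \<le> (\<Sum>j<n. (g k j)\<^sup>2)"
      "\<And>i. i < k \<Longrightarrow> (\<Sum>j<n. g i j * v j) = 0"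
      using gram_schmidt_step[of k n k g] Suc.prems g(3) by auto
    have "(\<Sum>j<n. v j * g i j) = 0" if "i < k" for i
      using v(3)[OF that] by (simp add: mult.commute)
    then show ?case using g v order_trans[OF v(2) g(2)[of k]] Suc.prems
      by (intro exI[of _ "g(k := v)"] conjI) (auto simp: less_Suc_eq simp del: fun_upd_apply simp add: fun_upd_def[where b = v])
  qed
  from this[of n] obtain g where g: "fdet n g = fdet n f"
    "\<And>i. i < n \<Longrightarrow> (\<Sum>j<n. (g i j)\<^sup>2) \<le> (\<Sum>j<n. (f i j)\<^sup>2)"
    "\<And>i i'. i < n \<Longrightarrow> i' < n \<Longrightarrow> i \<noteq> i' \<Longrightarrow> (\<Sum>j<n. g i j * g i' j) = 0" by auto
  define B where "B = mat n n (\<lambda>(i, j). g i j)"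
  have B: "B \<in> carrier_mat n n" by (simp add: B_def)
  define C where "C = B * transpose_mat B"
  have C: "C \<in> carrier_mat n n" using B by (simp add: C_def)
  have Cij: "C $$ (i, j) = (\<Sum>k<n. g i k * g j k)" if "i < n" "j < n" for i j
    using that by (simp add: C_def B_def scalar_prod_def atLeast0LessThan)
  have "(fdet n f)\<^sup>2 = Determinant.det C"
    using g(1) det_mult[OF B, of "transpose_mat B"] B det_transpose[OF B]
    by (simp add: C_def fdet_def B_def[symmetric] power2_eq_square)
  also have "\<dots> = prod_list (diag_mat C)"
    by (rule det_upper_triangular[OF _ C]) (use C Cij g(3) in \<open>auto simp: upper_triangular_def\<close>)
  also have "\<dots> = (\<Prod>i<n. C $$ (i, i))"
    using C by (simp add: diag_mat_def prod.distinct_set_conv_list[symmetric] atLeast0LessThan)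
  also have "\<dots> = (\<Prod>i<n. \<Sum>j<n. (g i j)\<^sup>2)"
    by (intro prod.cong) (auto simp: Cij power2_eq_square)
  also have "\<dots> \<le> (\<Prod>i<n. \<Sum>j<n. (f i j)\<^sup>2)"
    using g(2) by (intro prod_mono) (auto intro: sum_nonneg)
  finally show ?thesis .
qed

lemma fdet_of_int: "fdet n (\<lambda>i j. real_of_int (f i j)) = real_of_int (fdet n f)"
proof -
  interpret of_int_hom: comm_ring_hom "of_int :: int \<Rightarrow> real"
    by unfold_locales auto
  have "mat n n (\<lambda>(i, j). real_of_int (f i j)) = map_mat real_of_int (mat n n (\<lambda>(i, j). f i j))"
    by (intro eq_matI) auto
  then show ?thesis unfolding fdet_def by simp
qed

section \<open>Abelian groups with generators subject to integer relations\<close>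

context comm_group
begin

lemma finprod_int_pow:
  assumes "finite A" "\<And>j. j \<in> A \<Longrightarrow> g j \<in> carrier G"
  shows "finprod G g A [^] (z::int) = finprod G (\<lambda>j. g j [^] z) A"
  using assms by (induction A) (auto simp: int_pow_mult_distrib m_comm Pi_def)

lemma finprod_inverse:
  assumes "finite A" "\<And>j. j \<in> A \<Longrightarrow> g j \<in> carrier G"
  shows "inv (finprod G g A) = finprod G (\<lambda>j. inv (g j)) A"
  using assms by (induction A) (auto simp: inv_mult Pi_def)

definition monomials :: "nat \<Rightarrow> (nat \<Rightarrow> 'a) \<Rightarrow> 'a set"
  where "monomials n g = range (\<lambda>k::nat \<Rightarrow> int. finprod G (\<lambda>j. g j [^] k j) {..<n})"

lemma monomialsI: "finprod G (\<lambda>j. g j [^] (k j::int)) {..<n} \<in> monomials n g"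
  by (auto simp: monomials_def)

lemma monomials_closed:
  assumes "\<And>j. j < n \<Longrightarrow> g j \<in> carrier G"
  shows "monomials n g \<subseteq> carrier G"
  using assms by (auto simp: monomials_def intro!: finprod_closed int_pow_closed)

lemma monomials_mult:
  assumes g: "\<And>j. j < n \<Longrightarrow> g j \<in> carrier G" and "x \<in> monomials n g" "y \<in> monomials n g"
  shows "x \<otimes> y \<in> monomials n g"
proof -
  obtain k l where k: "x = finprod G (\<lambda>j. g j [^] (k j::int)) {..<n}"
    "y = finprod G (\<lambda>j. g j [^] (l j::int)) {..<n}"
    using assms by (auto simp: monomials_def)
  have "x \<otimes> y = finprod G (\<lambda>j. g j [^] (k j + l j)) {..<n}"
  proof -
    have "finprod G (\<lambda>j. g j [^] (k j + l j)) {..<n} = finprod G (\<lambda>j. g j [^] k j \<otimes> g j [^] l j) {..<n}"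
      using g by (intro finprod_cong') (auto simp: int_pow_mult)
    also have "\<dots> = x \<otimes> y" unfolding k using g by (intro finprod_multf) auto
    finally show ?thesis by simp
  qed
  then show ?thesis using monomialsI[of g "\<lambda>j. k j + l j"] by simp
qed

lemma monomials_pow:
  assumes g: "\<And>j. j < n \<Longrightarrow> g j \<in> carrier G" and "x \<in> monomials n g"
  shows "x [^] (z::int) \<in> monomials n g"
proof -
  obtain k where k: "x = finprod G (\<lambda>j. g j [^] (k j::int)) {..<n}"
    using assms by (auto simp: monomials_def)
  have "x [^] z = finprod G (\<lambda>j. g j [^] (k j * z)) {..<n}"
    unfolding k by (subst finprod_int_pow) (auto simp: g int_pow_pow intro!: finprod_cong')
  then show ?thesis using monomialsI[of g "\<lambda>j. k j * z"] by simp
qed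

lemma monomials_Suc:
  assumes g: "\<And>j. j < Suc n \<Longrightarrow> g j \<in> carrier G"
  shows "monomials (Suc n) g = {x \<otimes> g n [^] (z::int) | x z. x \<in> monomials n g}" (is "_ = ?R")
proof
  have fs: "finprod G (\<lambda>j. g j [^] (k j::int)) {..<Suc n}
      = finprod G (\<lambda>j. g j [^] k j) {..<n} \<otimes> g n [^] k n" for k
    using g by (simp add: lessThan_Suc Pi_def m_comm)
  show "monomials (Suc n) g \<subseteq> ?R"
  proof
    fix y assume "y \<in> monomials (Suc n) g"
    then obtain k where "y = finprod G (\<lambda>j. g j [^] (k j::int)) {..<Suc n}"
      by (auto simp: monomials_def)
    then show "y \<in> ?R" unfolding fs using monomialsI by blast
  qed
  show "?R \<subseteq> monomials (Suc n) g"
  proof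
    fix y assume "y \<in> ?R"
    then obtain k and z :: int where y: "y = finprod G (\<lambda>j. g j [^] (k j::int)) {..<n} \<otimes> g n [^] z"
      by (auto simp: monomials_def)
    have "finprod G (\<lambda>j. g j [^] k j) {..<n} = finprod G (\<lambda>j. g j [^] ((k(n := z)) j)) {..<n}"
      by (intro finprod_cong') (auto simp: g)
    then have "y = finprod G (\<lambda>j. g j [^] ((k(n := z)) j)) {..<Suc n}"
      unfolding y fs by simp
    then show "y \<in> monomials (Suc n) g" by (metis monomialsI)
  qed
qed

text \<open>Euclid's algorithm on the last column reduces to a single nonzero entry in that column;
  then the determinant factors, and the last generator has that exponent modulo the others.\<close>

lemma card_monomials_le:
  fixes f :: "nat \<Rightarrow> nat \<Rightarrow> int"
  assumes "\<And>j. j < n \<Longrightarrow> g j \<in> carrier G"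
    and "\<And>i. i < n \<Longrightarrow> finprod G (\<lambda>j. g j [^] f i j) {..<n} = \<one>"
    and "fdet n f \<noteq> 0"
  shows "finite (monomials n g) \<and> int (card (monomials n g)) \<le> \<bar>fdet n f\<bar>"
  using assms
proof (induction n arbitrary: f)
  case 0
  then show ?case by (simp add: monomials_def)
next
  case (Suc n)
  note g = Suc.prems(1)
  from Suc.prems(2,3) show ?case
  proof (induction "\<Sum>i<Suc n. nat \<bar>f i n\<bar>" arbitrary: f rule: less_induct)
    case (less f)
    consider i i' where "i < Suc n" "i' < Suc n" "i \<noteq> i'" "f i n \<noteq> 0" "\<bar>f i n\<bar> \<le> \<bar>f i' n\<bar>"
      | i0 where "i0 < Suc n" "\<And>i. i < Suc n \<Longrightarrow> i \<noteq> i0 \<Longrightarrow> f i n = 0"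
      by (metis linorder_le_cases abs_ge_zero zero_less_Suc)
    then show ?case
    proof cases
      case 1
      \<comment> \<open>With this sign the entry of larger absolute value is reduced by the smaller
        one: a single subtraction in Euclid's algorithm, which decreases the measure.\<close>
      define a where "a = - sgn (f i n) * sgn (f i' n)"
      define f' where "f' = (\<lambda>k. if k = i' then (\<lambda>j. f i' j + a * f i j) else f k)"
      have det: "fdet (Suc n) f' = fdet (Suc n) f"
        unfolding f'_def using fdet_addrow[of i "Suc n" i' f a] 1 by (auto simp: if_distrib cong: if_cong)
      have "\<bar>f' i' n\<bar> < \<bar>f i' n\<bar>"
        using 1 by (auto simp: f'_def a_def sgn_if split: if_splits)
      then have "(\<Sum>k<Suc n. nat \<bar>f' k n\<bar>) < (\<Sum>k<Suc n. nat \<bar>f k n\<bar>)"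
        using 1 by (intro sum_strict_mono_ex1) (auto simp: f'_def)
      moreover have "finprod G (\<lambda>j. g j [^] f' k j) {..<Suc n} = \<one>" if k: "k < Suc n" for k
      proof (cases "k = i'")
        case True
        have "finprod G (\<lambda>j. g j [^] f' k j) {..<Suc n}
            = finprod G (\<lambda>j. g j [^] f i' j \<otimes> (g j [^] f i j) [^] a) {..<Suc n}"
          using g by (intro finprod_cong') (auto simp: f'_def True int_pow_mult int_pow_pow mult.commute)
        also have "\<dots> = finprod G (\<lambda>j. g j [^] f i' j) {..<Suc n}
            \<otimes> finprod G (\<lambda>j. g j [^] f i j) {..<Suc n} [^] a"
          using g by (subst finprod_multf) (auto intro!: arg_cong2[where f = "(\<otimes>)"] finprod_int_pow[symmetric])
        also have "\<dots> = \<one>" using less.prems(1) 1 by simp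
        finally show ?thesis .
      next
        case False
        then show ?thesis using less.prems(1)[OF k] by (simp add: f'_def)
      qed
      ultimately show ?thesis using less.hyps[of f'] less.prems(2) det by simp
    next
      case 2
      define f' where "f' = (if i0 = n then f else f(i0 := f n, n := f i0))"
      have det: "\<bar>fdet (Suc n) f'\<bar> = \<bar>fdet (Suc n) f\<bar>"
        using fdet_swaprows[of i0 "Suc n" n f] 2 by (auto simp: f'_def simp del: fun_upd_apply)
      have z: "f' i n = 0" if "i < n" for i using 2 that by (auto simp: f'_def)
      have rel: "finprod G (\<lambda>j. g j [^] f' k j) {..<Suc n} = \<one>" if k: "k < Suc n" for k
        using less.prems(1) 2 k by (auto simp: f'_def)
      have dd: "fdet (Suc n) f' = f' n n * fdet n f'" by (rule fdet_last_col) (rule z)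
      define d where "d = f' n n"
      have nz: "d \<noteq> 0" "fdet n f' \<noteq> 0" using dd det less.prems(2) by (auto simp: d_def)
      have fs: "finprod G (\<lambda>j. g j [^] (k j::int)) {..<Suc n}
          = finprod G (\<lambda>j. g j [^] k j) {..<n} \<otimes> g n [^] k n" for k
        using g by (simp add: lessThan_Suc Pi_def m_comm)
      have "finprod G (\<lambda>j. g j [^] f' k j) {..<n} = \<one>" if k: "k < n" for k
      proof -
        have "finprod G (\<lambda>j. g j [^] f' k j) {..<n} \<in> carrier G" using g by (auto intro!: finprod_closed)
        then show ?thesis using rel[of k] k unfolding fs by (simp add: z)
      qed
      then have IH: "finite (monomials n g)" "int (card (monomials n g)) \<le> \<bar>fdet n f'\<bar>"
        using Suc.IH[of f'] g nz by auto
      have gn: "g n \<in> carrier G" using g by simp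
      \<comment> \<open>The bottom relation expresses \<open>g n [^] d\<close> by the earlier
        generators, so exponents of \<open>g n\<close> matter only modulo \<open>d\<close>.\<close>
      have gd: "g n [^] d \<in> monomials n g"
      proof -
        let ?h = "finprod G (\<lambda>j. g j [^] f' n j) {..<n}"
        have h: "?h \<in> monomials n g" by (rule monomialsI)
        then have hc: "?h \<in> carrier G" using monomials_closed[of n g] g by auto
        have "?h \<otimes> g n [^] d = \<one>" using rel[of n] unfolding fs d_def by simp
        then have "g n [^] d = inv ?h" using hc gn by (metis int_pow_closed inv_equality m_comm)
        also have "inv ?h = ?h [^] (-1::int)" using hc by (simp add: int_pow_neg)
        finally show ?thesis using monomials_pow[OF _ h, of "-1"] g by simp
      qed
      have "monomials (Suc n) g \<subseteq> (\<lambda>(x, z). x \<otimes> g n [^] z) ` (monomials n g \<times> {0..<\<bar>d\<bar>})"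
      proof
        fix y assume "y \<in> monomials (Suc n) g"
        then obtain x and z :: int where y: "x \<in> monomials n g" "y = x \<otimes> g n [^] z"
          using monomials_Suc[OF g] by auto
        define q where "q = z div d"
        \<comment> \<open>For negative \<open>d\<close> the value \<open>z mod d\<close> lies
          between \<open>d\<close> and 0; if it is not 0, one \<open>d\<close> is subtracted to
          obtain a remainder in \<open>{0..<\<bar>d\<bar>}\<close>.\<close>
        define s where "s = (if z mod d \<ge> 0 then 0 else 1::int)"
        define r where "r = z mod d - s * d"
        have zr: "z = d * (q + s) + r" by (simp add: q_def r_def algebra_simps)
        have r: "r \<in> {0..<\<bar>d\<bar>}"
        proof (cases d "0::int" rule: linorder_cases)
          case less
          then have "d < z mod d" "z mod d \<le> 0" by auto
          moreover from this have "r = (if z mod d = 0 then 0 else z mod d - d)"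
            unfolding r_def s_def by (cases "z mod d = 0") (simp_all only: if_False if_True, simp_all)
          ultimately have "0 \<le> r" "r < - d" using less by (auto split: if_splits simp del: neg_mod_bound neg_mod_sign)
          then show ?thesis using less by simp
        next
          case greater
          then have "0 \<le> z mod d" "z mod d < d" by auto
          then show ?thesis using greater by (simp add: r_def s_def)
        qed (use nz in simp)
        have x: "x \<in> carrier G" using y monomials_closed[of n g] g by auto
        have "y = x \<otimes> ((g n [^] d) [^] (q + s) \<otimes> g n [^] r)"
          unfolding y(2) by (subst zr) (simp only: int_pow_mult[OF gn] int_pow_pow[OF gn])
        also have "\<dots> = (x \<otimes> (g n [^] d) [^] (q + s)) \<otimes> g n [^] r"
          using gn x by (simp add: m_assoc)
        finally have "y = (x \<otimes> (g n [^] d) [^] (q + s)) \<otimes> g n [^] r" .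
        moreover have "x \<otimes> (g n [^] d) [^] (q + s) \<in> monomials n g"
          using g y by (intro monomials_mult monomials_pow[OF _ gd]) auto
        ultimately show "y \<in> (\<lambda>(x, z). x \<otimes> g n [^] z) ` (monomials n g \<times> {0..<\<bar>d\<bar>})"
          using r by auto
      qed
      moreover have fin: "finite (monomials n g \<times> {0..<\<bar>d\<bar>})" using IH by auto
      ultimately have "finite (monomials (Suc n) g)"
        "card (monomials (Suc n) g) \<le> card (monomials n g \<times> {0..<\<bar>d\<bar>})"
        by (auto intro: finite_subset surj_card_le)
      moreover have "int (card (monomials n g \<times> {0..<\<bar>d\<bar>})) \<le> \<bar>fdet n f'\<bar> * \<bar>d\<bar>"
        using IH(2) by (simp add: card_cartesian_product mult_right_mono)
      moreover have "\<bar>fdet n f'\<bar> * \<bar>d\<bar> = \<bar>fdet (Suc n) f\<bar>"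
        using det dd by (simp add: d_def abs_mult mult.commute)
      ultimately show ?thesis by linarith
    qed
  qed
qed

text \<open>By the trivial kernel some \<open>n\<close> rows have a nonzero determinant, which
  bounds the order and is itself bounded by Hadamard's inequality. These rows are distinct, and
  since all weights are at least 1 the product extends to \<open>I\<close>.\<close>

lemma card_le_of_relations:
  fixes r :: "'i \<Rightarrow> nat \<Rightarrow> int"
  assumes g: "\<And>j. j < n \<Longrightarrow> g j \<in> carrier G"
    and gen: "carrier G \<subseteq> monomials n g"
    and I: "finite I"
    and rel: "\<And>i. i \<in> I \<Longrightarrow> finprod G (\<lambda>j. g j [^] r i j) {..<n} = \<one>"
    and ker: "\<And>c. \<lbrakk>\<And>i. i \<in> I \<Longrightarrow> (\<Sum>j<n. r i j * c j) = 0\<rbrakk> \<Longrightarrow> \<forall>j<n. c j = (0::int)"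
    and w: "\<And>i. i \<in> I \<Longrightarrow> (\<Sum>j<n. (r i j)\<^sup>2) \<le> w i" "\<And>i. i \<in> I \<Longrightarrow> 1 \<le> w i"
  shows "(real (card (carrier G)))\<^sup>2 \<le> (\<Prod>i\<in>I. real_of_int (w i))"
proof -
  obtain \<rho> where \<rho>: "\<And>i. i < n \<Longrightarrow> \<rho> i \<in> I" "fdet n (\<lambda>i. r (\<rho> i)) \<noteq> 0"
    using nonzero_minor[where I = I and m = n and r = r and k = n, OF ker] by auto
  have inj: "inj_on \<rho> {..<n}"
    using \<rho>(2) fdet_identical_rows[of _ n _ "\<lambda>i. r (\<rho> i)"] by (metis inj_onI lessThan_iff)
  have c: "finite (monomials n g) \<and> int (card (monomials n g)) \<le> \<bar>fdet n (\<lambda>i. r (\<rho> i))\<bar>"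
    by (rule card_monomials_le) (use g rel \<rho> in auto)
  then have "card (carrier G) \<le> card (monomials n g)" using gen by (intro card_mono) auto
  then have "real (card (carrier G)) \<le> \<bar>real_of_int (fdet n (\<lambda>i. r (\<rho> i)))\<bar>" using c by linarith
  then have "(real (card (carrier G)))\<^sup>2 \<le> (real_of_int (fdet n (\<lambda>i. r (\<rho> i))))\<^sup>2"
    by (rule power2_mono[of "real (card (carrier G))", simplified, rule_format])
  also have "\<dots> \<le> (\<Prod>i<n. \<Sum>j<n. (real_of_int (r (\<rho> i) j))\<^sup>2)"
    using hadamard_inequality[of n "\<lambda>i j. real_of_int (r (\<rho> i) j)"] by (simp add: fdet_of_int)
  also have "\<dots> \<le> (\<Prod>i<n. real_of_int (w (\<rho> i)))"
    using w(1)[OF \<rho>(1)] by (intro prod_mono) (auto intro!: sum_nonneg simp flip: of_int_power of_int_sum)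
  also have "\<dots> = (\<Prod>i\<in>\<rho> ` {..<n}. real_of_int (w i))"
    using inj by (simp add: prod.reindex)
  also have "\<dots> \<le> (\<Prod>i\<in>I. real_of_int (w i))"
    using \<rho>(1) I w(2) by (intro prod_mono2) (auto simp: order_trans[OF zero_le_one])
  finally show ?thesis .
qed

end

section \<open>The lower bound\<close>

context complex
begin

definition adj :: "nat rel" where "adj = {(u, v). {u, v} \<in> K}"

text \<open>Two vertices of a carrier are adjacent, so the open stars of reachable vertices are
  disjoint in \<open>S\<close> from those of unreachable ones; the two unions would separate
  \<open>S\<close>.\<close>

lemma connected_reachable:
  assumes con: "connected S" and x: "x \<in> S" "r \<in> supp x" and v: "{v} \<in> K"
  shows "(r, v) \<in> adj\<^sup>*"
proof (rule ccontr)
  assume nr: "(r, v) \<notin> adj\<^sup>*"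
  define A where "A = {u. {u} \<in> K \<and> (r, u) \<in> adj\<^sup>*}"
  define star where "star U = (\<Union>u\<in>U. {y :: nat \<Rightarrow> real. y u \<noteq> 0})" for U
  have open_star: "open (star U)" for U
  proof -
    have "open {y :: nat \<Rightarrow> real. y u \<noteq> 0}" for u
      by (intro open_Collect_neq continuous_on_const continuous_on_product_then_coordinatewise[where f = "\<lambda>y. y"] continuous_on_id)
    then show ?thesis unfolding star_def by (intro open_UN) auto
  qed
  have "star A \<inter> star ({u. {u} \<in> K} - A) \<inter> S = {}"
  proof -
    have False if y: "y \<in> S" "u \<in> A" "y u \<noteq> 0" "{w} \<in> K" "w \<notin> A" "y w \<noteq> 0" for y u w
    proof -
      have "{u, w} \<in> K" using y by (intro face[OF supp_in[OF y(1)]]) (auto simp: supp_def)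
      then have "(u, w) \<in> adj" by (simp add: adj_def)
      then show False using y(2,4,5) by (auto simp: A_def dest: rtrancl_into_rtrancl)
    qed
    then show ?thesis unfolding star_def by blast
  qed
  moreover have "S \<subseteq> star A \<union> star ({u. {u} \<in> K} - A)"
  proof
    fix y assume y: "y \<in> S"
    then obtain u where "u \<in> supp y" using supp_nonempty by blast
    then show "y \<in> star A \<union> star ({u. {u} \<in> K} - A)"
      using vertex_in[OF y, of u] by (auto simp: star_def supp_def)
  qed
  moreover have "r \<in> A" using vertex_in x by (auto simp: A_def)
  then have "x \<in> star A" using x by (auto simp: star_def supp_def)
  moreover have "vtx v \<in> star ({u. {u} \<in> K} - A)"
    using v nr by (auto simp: star_def A_def vtx_def)
  ultimately show False
    using connectedD[OF con open_star open_star, of A "{u. {u} \<in> K} - A"] x vtx_in[OF v] by blast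
qed

text \<open>Breadth-first search: \<open>depth\<close> is the edge distance from \<open>r\<close>,
  and a parent is a predecessor on a shortest path.\<close>

lemma spanning_tree:
  assumes con: "connected S" and x: "x \<in> S" "r \<in> supp x"
  obtains par depth where "tree_complex K x r par depth"
proof -
  define depth where "depth v = (LEAST n. (r, v) \<in> adj ^^ n)" for v
  have depth: "(r, v) \<in> adj ^^ depth v" if "{v} \<in> K" for v
    using connected_reachable[OF con x that] unfolding depth_def rtrancl_power by (rule LeastI_ex)
  have le: "depth v \<le> n" if "(r, v) \<in> adj ^^ n" for v n
    unfolding depth_def using that by (rule Least_le)
  have ex: "\<exists>u. {u, v} \<in> K \<and> depth v = Suc (depth u)" if v: "{v} \<in> K" "v \<noteq> r" for v
  proof -
    obtain n where n: "depth v = Suc n" using depth[OF v(1)] v(2) by (cases "depth v") auto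
    then obtain u where u: "(r, u) \<in> adj ^^ n" "(u, v) \<in> adj" using depth[OF v(1)] by auto
    then have uv: "{u, v} \<in> K" by (simp add: adj_def)
    then have "{u} \<in> K" using face by blast
    then have "(r, v) \<in> adj ^^ Suc (depth u)" using depth u(2) by auto
    then have "depth v \<le> Suc (depth u)" by (rule le)
    then have "depth v = Suc (depth u)" using le[OF u(1)] n by simp
    then show ?thesis using uv by blast
  qed
  define par where "par v = (SOME u. {u, v} \<in> K \<and> depth v = Suc (depth u))" for v
  have "tree_complex K x r par depth"
  proof
    show "x \<in> S" "r \<in> supp x" by fact+
    show "depth r = 0" using le[of r 0] by simp
    fix v assume "{v} \<in> K" "v \<noteq> r"
    then show "{par v, v} \<in> K \<and> depth v = Suc (depth (par v))"
      unfolding par_def by (rule someI_ex[OF ex])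
  qed
  then show ?thesis by (rule that)
qed

end

section \<open>The relation matrix of a complex\<close>

lemma int_eq_0_if_small_dvd:
  fixes a n :: int
  assumes "n dvd a" "\<bar>a\<bar> < n"
  shows "a = 0"
  using assms zdvd_imp_le[of n "\<bar>a\<bar>"] by (cases "a = 0") auto

lemma card_3_sorted:
  fixes \<sigma> :: "'a::linorder set"
  assumes "card \<sigma> = 3"
  obtains u v w where "\<sigma> = {u, v, w}" "u < v" "v < w"
proof -
  have "finite \<sigma>" using assms by (simp add: card_ge_0_finite)
  then obtain xs where xs: "length xs = 3" "sorted_wrt (<) xs" "set xs = \<sigma>"
    using assms by (intro that[of "sorted_list_of_set \<sigma>"]) auto
  then obtain u v w where "xs = [u, v, w]" by (auto simp: numeral_3_eq_3 length_Suc_conv)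
  then show thesis using that xs by auto
qed

lemma card_triangles_ge:
  fixes G (structure)
  assumes K: "finite_abstract_complex K" and con: "connected (geometric_realization K)"
    and x: "x \<in> geometric_realization K" and iso: "fundamental_group (geometric_realization K) x \<cong> G"
    and G: "comm_group G" "finite (carrier G)"
  shows "(real (order G))\<^sup>2 \<le> 3 ^ card {\<sigma> \<in> K. card \<sigma> = 3}"
proof -
  interpret G: comm_group G by (rule G(1))
  interpret complex K by unfold_locales (rule K)
  obtain r where r: "r \<in> supp x" using supp_nonempty[OF x] by blast
  obtain par depth where "tree_complex K x r par depth" using spanning_tree[OF con x r] .
  then interpret tree_complex K x r par depth .
  obtain \<phi> where \<phi>: "\<phi> \<in> iso FG G" using iso by (auto simp: is_iso_def)
  interpret \<phi>: group_hom FG G \<phi>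
    using \<phi> group_FG by (auto simp: group_hom_def group_hom_axioms_def iso_def G.group_axioms)
  have \<phi>_bij: "bij_betw \<phi> (carrier FG) (carrier G)" using \<phi> by (simp add: iso_def)
  define edges where "edges = {(u, v). u < v \<and> {u, v} \<in> K}"
  have "edges \<subseteq> {v. {v} \<in> K} \<times> {v. {v} \<in> K}" using edge_vertices by (auto simp: edges_def)
  then have "finite edges" by (rule finite_subset) (use finite_vertices in auto)
  then obtain e where e: "bij_betw e {..<card edges} edges"
    using ex_bij_betw_nat_finite[of edges] by (auto simp: atLeast0LessThan)
  define m where "m = card edges"
  define idx where "idx = the_inv_into {..<m} e"
  have idx: "idx p < m" "e (idx p) = p" if "p \<in> edges" for p
    using e that the_inv_into_into[of e "{..<m}" p] f_the_inv_into_f[of e "{..<m}" p]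
    unfolding idx_def m_def bij_betw_def by auto
  have idx_e: "idx (e j) = j" "e j \<in> edges" if "j < m" for j
    using e that the_inv_into_f_f[of e "{..<m}" j] unfolding idx_def m_def bij_betw_def by auto
  define a where "a u v = \<phi> (edge_class u v)" for u v
  have a_closed: "a u v \<in> carrier G" if "{u, v} \<in> K" for u v
    unfolding a_def using edge_class_closed[OF that] by simp
  have a_mult: "a u v \<otimes> a v w = a u w" if "{u, v, w} \<in> K" for u v w
  proof -
    have "{u, v} \<in> K" "{v, w} \<in> K" using face[OF that] by auto
    then show ?thesis unfolding a_def edge_class_mult[OF that, symmetric]
      by (simp add: edge_class_closed)
  qed
  have a_inv: "a v u = inv (a u v)" if "{u, v} \<in> K" for u v
    unfolding a_def edge_class_inv[OF that] using edge_class_closed[OF that] by simp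
  define g where "g j = (case e j of (u, v) \<Rightarrow> a u v)" for j
  have g_closed: "g j \<in> carrier G" if "j < m" for j
    using idx_e(2)[OF that] by (auto simp: g_def edges_def intro: a_closed)
  have g_idx: "g (idx (u, v)) = a u v" if "(u, v) \<in> edges" for u v
    using idx(2)[OF that] by (simp add: g_def)
  define \<delta> where "\<delta> p j = (if e j = p then 1 else 0 :: int)" for p j
  have \<delta>: "\<delta> p j = (if j = idx p then 1 else 0)" if "p \<in> edges" "j < m" for p j
    using idx idx_e that by (auto simp: \<delta>_def)
  have \<delta>_sum: "(\<Sum>j<m. \<delta> p j * f j) = f (idx p)" if "p \<in> edges" for p and f :: "nat \<Rightarrow> int"
  proof -
    have "(\<Sum>j<m. \<delta> p j * f j) = (\<Sum>j<m. if j = idx p then f j else 0)"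
      using that by (intro sum.cong) (auto simp: \<delta>)
    then show ?thesis using idx(1)[OF that] by simp
  qed
  have \<delta>_prod: "finprod G (\<lambda>j. g j [^] \<delta> p j) {..<m} = g (idx p)" if "p \<in> edges" for p
  proof -
    have "finprod G (\<lambda>j. g j [^] \<delta> p j) {..<m} = finprod G (\<lambda>j. if j = idx p then g j else \<one>) {..<m}"
      using that g_closed by (intro G.finprod_cong') (auto simp: \<delta>)
    also have "\<dots> = g (idx p)"
      using idx(1)[OF that] g_closed by (subst G.finprod_singleton_swap) auto
    finally show ?thesis .
  qed
  have \<delta>_pow_closed: "g j [^] (k :: int) \<in> carrier G" if "j < m" for j k using g_closed[OF that] by simp
  define mid where "mid \<sigma> = Min (\<sigma> - {Min \<sigma>})" for \<sigma> :: "nat set"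
  define Tri where "Tri = {\<sigma> \<in> K. card \<sigma> = 3}"
  \<comment> \<open>The singleton of a non-root vertex stands for the tree edge to its parent. All
    relations are thus indexed by simplices, and \<open>row\<close> tells the two kinds apart by
    cardinality.\<close>
  define Ver where "Ver = (\<lambda>v. {v}) ` ({v. {v} \<in> K} - {r})"
  define row where "row \<sigma> j = (if card \<sigma> = 3
      then \<delta> (Min \<sigma>, mid \<sigma>) j + \<delta> (mid \<sigma>, Max \<sigma>) j - \<delta> (Min \<sigma>, Max \<sigma>) j
      else \<delta> (min (par (Min \<sigma>)) (Min \<sigma>), max (par (Min \<sigma>)) (Min \<sigma>)) j)" for \<sigma> j
  define I where "I = Tri \<union> Ver"
  have finT: "finite Tri" using K by (simp add: Tri_def finite_abstract_complex_def)
  have finV: "finite Ver" using finite_vertices by (simp add: Ver_def)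
  have disj: "Tri \<inter> Ver = {}" by (auto simp: Tri_def Ver_def)
  have tri: "\<exists>u v w. \<sigma> = {u, v, w} \<and> u < v \<and> v < w \<and> row \<sigma> = (\<lambda>j. \<delta> (u, v) j + \<delta> (v, w) j - \<delta> (u, w) j)
      \<and> (u, v) \<in> edges \<and> (v, w) \<in> edges \<and> (u, w) \<in> edges \<and> {u, v, w} \<in> K"
    if \<sigma>: "\<sigma> \<in> Tri" for \<sigma>
  proof -
    have c3: "card \<sigma> = 3" and \<sigma>K: "\<sigma> \<in> K" using \<sigma> by (auto simp: Tri_def)
    obtain u v w where uvw: "\<sigma> = {u, v, w}" "u < v" "v < w" using card_3_sorted[OF c3] .
    have "Min \<sigma> = u" "Max \<sigma> = w" using uvw by (auto intro!: Min_eqI Max_eqI)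
    moreover have "\<sigma> - {u} = {v, w}" using uvw by auto
    then have "mid \<sigma> = v" using uvw \<open>Min \<sigma> = u\<close> by (auto simp: mid_def intro!: Min_eqI)
    ultimately have "row \<sigma> = (\<lambda>j. \<delta> (u, v) j + \<delta> (v, w) j - \<delta> (u, w) j)"
      using c3 by (auto simp: row_def)
    moreover have "{u, v} \<in> K" "{v, w} \<in> K" "{u, w} \<in> K" using face[OF \<sigma>K] uvw by auto
    ultimately show ?thesis using uvw \<sigma>K unfolding edges_def
      by (intro exI[of _ u] exI[of _ v] exI[of _ w]) auto
  qed
  have ver: "\<exists>v p. \<sigma> = {v} \<and> {v} \<in> K \<and> v \<noteq> r \<and> p \<in> edges \<and> row \<sigma> = \<delta> p \<and> (p = (par v, v) \<or> p = (v, par v))"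
    if \<sigma>: "\<sigma> \<in> Ver" for \<sigma>
  proof -
    obtain v where v: "\<sigma> = {v}" "{v} \<in> K" "v \<noteq> r" using \<sigma> by (auto simp: Ver_def)
    have pv: "{par v, v} \<in> K" "depth v = Suc (depth (par v))" using par[OF v(2,3)] by auto
    then have "par v \<noteq> v" by auto
    then show ?thesis using v pv
      by (intro exI[of _ v] exI[of _ "(min (par v) v, max (par v) v)"])
        (auto simp: row_def edges_def min_def max_def fun_eq_iff insert_commute)
  qed
  have rel: "finprod G (\<lambda>j. g j [^] row \<sigma> j) {..<m} = \<one>" if \<sigma>: "\<sigma> \<in> I" for \<sigma>
  proof (cases "\<sigma> \<in> Tri")
    case True
    then obtain u v w where uvw: "row \<sigma> = (\<lambda>j. \<delta> (u, v) j + \<delta> (v, w) j - \<delta> (u, w) j)"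
      "(u, v) \<in> edges" "(v, w) \<in> edges" "(u, w) \<in> edges" "{u, v, w} \<in> K" using tri by blast
    have eK: "{u, v} \<in> K" "{v, w} \<in> K" "{u, w} \<in> K" using uvw by (auto simp: edges_def)
    have "finprod G (\<lambda>j. g j [^] row \<sigma> j) {..<m}
        = finprod G (\<lambda>j. (g j [^] \<delta> (u, v) j \<otimes> g j [^] \<delta> (v, w) j) \<otimes> inv (g j [^] \<delta> (u, w) j)) {..<m}"
      using g_closed by (intro G.finprod_cong') (auto simp: uvw(1) G.int_pow_mult G.int_pow_diff)
    also have "\<dots> = (finprod G (\<lambda>j. g j [^] \<delta> (u, v) j) {..<m} \<otimes> finprod G (\<lambda>j. g j [^] \<delta> (v, w) j) {..<m})
        \<otimes> inv (finprod G (\<lambda>j. g j [^] \<delta> (u, w) j) {..<m})"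
      using g_closed by (subst G.finprod_inverse) (auto simp: G.finprod_multf Pi_def)
    also have "\<dots> = (a u v \<otimes> a v w) \<otimes> inv (a u w)"
      using uvw by (simp add: \<delta>_prod g_idx)
    also have "\<dots> = \<one>" using a_mult[OF uvw(5)] a_closed[OF eK(3)] by simp
    finally show ?thesis .
  next
    case False
    then have "\<sigma> \<in> Ver" using \<sigma> by (auto simp: I_def)
    then obtain v p where v: "{v} \<in> K" "v \<noteq> r" "p \<in> edges" "row \<sigma> = \<delta> p" "p = (par v, v) \<or> p = (v, par v)"
      using ver by blast
    have pv: "{par v, v} \<in> K" using par v by blast
    have "a (par v) v = \<one>" unfolding a_def edge_class_tree[OF v(1,2)] by simp
    moreover from this have "a v (par v) = \<one>" using a_inv[OF pv] by simp
    ultimately have "g (idx p) = \<one>" using v(3,5) g_idx by auto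
    then show ?thesis unfolding v(4) \<delta>_prod[OF v(3)] .
  qed
  have gen: "carrier G \<subseteq> G.monomials m g"
  proof -
    have edge: "a u v \<in> G.monomials m g" if uv: "{u, v} \<in> K" for u v
    proof -
      have lt: "a u v \<in> G.monomials m g" if "u < v" "{u, v} \<in> K" for u v
      proof -
        have p: "(u, v) \<in> edges" using that by (simp add: edges_def)
        have "finprod G (\<lambda>j. g j [^] \<delta> (u, v) j) {..<m} \<in> G.monomials m g" by (rule G.monomialsI)
        then show ?thesis unfolding \<delta>_prod[OF p] g_idx[OF p] .
      qed
      consider "u < v" | "v < u" | "u = v" by linarith
      then show ?thesis
      proof cases
        case 1
        then show ?thesis using lt uv by blast
      next
        case 2
        have vu: "{v, u} \<in> K" using uv by (simp add: insert_commute)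
        have "a v u [^] (-1 :: int) \<in> G.monomials m g"
          using lt[OF 2 vu] g_closed by (intro G.monomials_pow) auto
        also have "a v u [^] (-1 :: int) = a u v"
          using a_inv[OF vu] a_closed[OF vu] by (simp add: G.int_pow_neg)
        finally show ?thesis .
      next
        case 3
        have "a u u = \<one>" using edge_class_refl[of u] uv 3 by (simp add: a_def)
        moreover have "finprod G (\<lambda>j. g j [^] (0 :: int)) {..<m} \<in> G.monomials m g" by (rule G.monomialsI)
        ultimately show ?thesis using 3 by simp
      qed
    qed
    have "carrier FG \<subseteq> {A \<in> carrier FG. \<phi> A \<in> G.monomials m g}"
      using edge edge_class_closed g_closed
      by (intro edge_classes_generate) (auto simp: a_def intro!: G.monomials_mult)
    then have "\<phi> ` carrier FG \<subseteq> G.monomials m g" by blast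
    then show ?thesis using \<phi>_bij by (simp add: bij_betw_def)
  qed
  have ker: "\<forall>j<m. c j = (0 :: int)" if c: "\<And>\<sigma>. \<sigma> \<in> I \<Longrightarrow> (\<Sum>j<m. row \<sigma> j * c j) = 0" for c
  proof (intro allI impI)
    fix j0 assume j0: "j0 < m"
    \<comment> \<open>The antisymmetric extension of \<open>c\<close> to oriented edges: the
      triangle rows say that it is an integer cocycle, the other rows that it vanishes on the
      tree.\<close>
    define C where "C u v = (if u < v then c (idx (u, v)) else if v < u then - c (idx (v, u)) else 0)" for u v
    \<comment> \<open>Larger than \<open>order G * \<bar>c j0\<bar>\<close>, so that divisibility of
      \<open>order G * c j0\<close> by \<open>n\<close> forces it to be zero.\<close>
    define n where "n = order G * nat \<bar>c j0\<bar> + 1"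
    have C_anti: "C v u = - C u v" for u v by (auto simp: C_def)
    have C_lt: "C u v + C v w = C u w" if uvw: "{u, v, w} \<in> K" "u < v" "v < w" for u v w
    proof -
      have t: "{u, v, w} \<in> Tri" using uvw by (auto simp: Tri_def)
      obtain u' v' w' where *: "{u, v, w} = {u', v', w'}" "u' < v'" "v' < w'"
        "row {u, v, w} = (\<lambda>j. \<delta> (u', v') j + \<delta> (v', w') j - \<delta> (u', w') j)"
        "(u', v') \<in> edges" "(v', w') \<in> edges" "(u', w') \<in> edges" using tri[OF t] by blast
      have "u' = u" "v' = v" "w' = w" using *(1-3) uvw(2,3) by (auto simp: set_eq_iff) (metis less_asym less_trans nat_neq_iff)+
      moreover have "(\<Sum>j<m. row {u, v, w} j * c j) = 0" using c t by (auto simp: I_def)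
      ultimately have "c (idx (u, v)) + c (idx (v, w)) - c (idx (u, w)) = 0"
        using *(4-7) by (simp add: algebra_simps sum.distrib sum_subtractf \<delta>_sum[simplified mult.commute] \<delta>_sum)
      then show ?thesis using uvw by (simp add: C_def)
    qed
    have C_mult: "C u v + C v w = C u w" if uvw: "{u, v, w} \<in> K" for u v w
    proof -
      \<comment> \<open>\<open>C_lt\<close> treats increasing triples only; other orderings and
        repetitions follow by antisymmetry.\<close>
      have perm: "{u, w, v} \<in> K" "{v, u, w} \<in> K" "{v, w, u} \<in> K" "{w, u, v} \<in> K" "{w, v, u} \<in> K"
        using uvw by (simp_all add: insert_commute)
      show ?thesis
        using C_lt[OF uvw] C_lt[OF perm(1)] C_lt[OF perm(2)] C_lt[OF perm(3)] C_lt[OF perm(4)] C_lt[OF perm(5)]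
          C_anti[of u v] C_anti[of v w] C_anti[of u w] C_anti[of u u] C_anti[of v v]
        by (cases u v rule: linorder_cases; cases v w rule: linorder_cases; cases u w rule: linorder_cases) auto
    qed
    have C_tree: "C (par v) v = 0" if v: "{v} \<in> K" "v \<noteq> r" for v
    proof -
      have "{v} \<in> Ver" using v by (auto simp: Ver_def)
      then obtain p where p: "p \<in> edges" "row {v} = \<delta> p" "p = (par v, v) \<or> p = (v, par v)" using ver by blast
      have "c (idx p) = 0" using c[of "{v}"] \<open>{v} \<in> Ver\<close> p(1,2) by (simp add: I_def \<delta>_sum)
      then show ?thesis using p(1,3) by (auto simp: C_def edges_def)
    qed
    let ?Z = "integer_mod_group n"
    have n0: "0 < n" by (simp add: n_def)
    interpret cocycle K x r par depth ?Z "\<lambda>u v. C u v mod int n"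
    proof (intro cocycle.intro cocycle_axioms.intro)
      show "tree_complex K x r par depth" by unfold_locales
      show "group ?Z" by simp
      show "finite (carrier ?Z)" using n0 by (simp add: carrier_integer_mod_group)
      show "C u v mod int n \<in> carrier ?Z" for u v using n0 by (simp add: carrier_integer_mod_group)
      show "(C u v mod int n) \<otimes>\<^bsub>?Z\<^esub> (C v w mod int n) = C u w mod int n" if "{u, v, w} \<in> K" for u v w
        using C_mult[OF that] by (simp add: mod_simps)
      show "C (par v) v mod int n = \<one>\<^bsub>?Z\<^esub>" if "{v} \<in> K" "v \<noteq> r" for v
        using C_tree[OF that] by simp
    qed
    obtain \<mu> where \<mu>: "\<mu> \<in> hom FG ?Z" "\<And>u v. {u, v} \<in> K \<Longrightarrow> \<mu> (edge_class u v) = C u v mod int n"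
      using monodromy by blast
    interpret \<mu>: group_hom FG ?Z \<mu>
      using \<mu>(1) group_FG by (auto simp: group_hom_def group_hom_axioms_def)
    obtain u v where uv: "e j0 = (u, v)" "(u, v) \<in> edges" using idx_e(2)[OF j0] by (cases "e j0") auto
    then have uvK: "{u, v} \<in> K" "u < v" by (auto simp: edges_def)
    let ?A = "edge_class u v"
    have A: "?A \<in> carrier FG" using edge_class_closed uvK by blast
    \<comment> \<open>\<open>FG\<close> is finite, so the images of edge classes in
      \<open>?Z\<close> are killed by \<open>order G\<close>.\<close>
    have "order FG = order G" using \<phi>_bij by (simp add: order_def bij_betw_same_card)
    then have "?A [^]\<^bsub>FG\<^esub> order G = \<one>\<^bsub>FG\<^esub>"
      using group.pow_order_eq_1[OF group_FG A] by simp
    then have "\<mu> ?A [^]\<^bsub>?Z\<^esub> order G = \<one>\<^bsub>?Z\<^esub>" using A \<mu>.hom_nat_pow[OF A, of "order G"] by simp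
    then have "int (order G) * (C u v mod int n) mod int n = 0"
      using \<mu>(2)[OF uvK(1)] by (simp add: pow_integer_mod_group)
    then have "int n dvd int (order G) * C u v" by (simp add: mod_simps dvd_eq_mod_eq_0)
    moreover have "C u v = c j0" using uv uvK idx_e(1)[OF j0] by (simp add: C_def)
    ultimately have "int n dvd int (order G) * c j0" by simp
    moreover have "\<bar>int (order G) * c j0\<bar> < int n" by (simp add: n_def abs_mult)
    ultimately have "int (order G) * c j0 = 0" by (rule int_eq_0_if_small_dvd)
    moreover have "order G > 0" using G(2) by (simp add: G.order_gt_0_iff_finite)
    ultimately show "c j0 = 0" by simp
  qed
  define w where "w \<sigma> = (if \<sigma> \<in> Tri then 3 else 1 :: int)" for \<sigma>
  have norm: "(\<Sum>j<m. (row \<sigma> j)\<^sup>2) \<le> w \<sigma>" if \<sigma>: "\<sigma> \<in> I" for \<sigma>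
  proof (cases "\<sigma> \<in> Tri")
    case True
    then obtain u v w' where uvw: "u < v" "v < w'" "row \<sigma> = (\<lambda>j. \<delta> (u, v) j + \<delta> (v, w') j - \<delta> (u, w') j)"
      "(u, v) \<in> edges" "(v, w') \<in> edges" "(u, w') \<in> edges" using tri by blast
    \<comment> \<open>The three edges are distinct, so in each column at most one term is nonzero,
      and its square is 1.\<close>
    have "(\<Sum>j<m. (row \<sigma> j)\<^sup>2) = (\<Sum>j<m. \<delta> (u, v) j * 1 + \<delta> (v, w') j * 1 + \<delta> (u, w') j * 1)"
      using uvw(1,2) by (intro sum.cong) (auto simp: uvw(3) \<delta>_def)
    also have "\<dots> = 3" unfolding sum.distrib using uvw by (simp only: \<delta>_sum)
    finally show ?thesis using True by (simp add: w_def)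
  next
    case False
    then have "\<sigma> \<in> Ver" using \<sigma> by (auto simp: I_def)
    then obtain p where p: "p \<in> edges" "row \<sigma> = \<delta> p" using ver by blast
    have "(\<Sum>j<m. (row \<sigma> j)\<^sup>2) = (\<Sum>j<m. \<delta> p j * 1)"
      by (intro sum.cong) (auto simp: p(2) \<delta>_def)
    also have "\<dots> = 1" using p(1) by (simp only: \<delta>_sum)
    finally show ?thesis using False by (simp add: w_def)
  qed
  have "(real (card (carrier G)))\<^sup>2 \<le> (\<Prod>\<sigma>\<in>I. real_of_int (w \<sigma>))"
    by (rule G.card_le_of_relations[OF g_closed gen _ rel ker norm]) (auto simp: I_def finT finV w_def)
  also have "\<dots> = (\<Prod>\<sigma>\<in>Tri. real_of_int (w \<sigma>)) * (\<Prod>\<sigma>\<in>Ver. real_of_int (w \<sigma>))"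
    unfolding I_def using finT finV disj by (rule prod.union_disjoint)
  also have "(\<Prod>\<sigma>\<in>Ver. real_of_int (w \<sigma>)) = 1"
    using disj by (intro prod.neutral) (auto simp: w_def)
  also have "(\<Prod>\<sigma>\<in>Tri. real_of_int (w \<sigma>)) = 3 ^ card Tri" by (simp add: w_def)
  finally show ?thesis by (simp add: order_def Tri_def)
qed

section \<open>The upper bound\<close>

lemma (in tree_complex) connected_S: "connected S"
proof (rule path_connected_imp_connected)
  have to: "\<exists>p. joins S x y p" if y: "y \<in> S" for y
  proof -
    obtain v where v: "v \<in> supp y" using supp_nonempty[OF y] by blast
    show ?thesis using joins_join[OF joins_T[OF vertex_in[OF y v]] joins_from_vertex[OF y v]] by blast
  qed
  show "path_connected S"
    unfolding path_connected_def
  proof (intro ballI)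
    fix y z assume "y \<in> S" "z \<in> S"
    then obtain p q where "joins S x y p" "joins S x z q" using to by blast
    then have "joins S y z (reversepath p +++ q)" by (blast intro: joins_join joins_reversepath)
    then show "\<exists>g. path g \<and> path_image g \<subseteq> S \<and> pathstart g = y \<and> pathfinish g = z"
      unfolding joins_def by blast
  qed
qed

text \<open>\<open>enc\<close> numbers the vertices, three copies of the group, because simplices
  are sets of naturals.\<close>

locale relation_complex = group G for G :: "('a, 'b) monoid_scheme" (structure) +
  fixes Rel :: "('a \<times> 'a) set" and enc :: "nat \<times> 'a \<Rightarrow> nat"
  assumes Rel: "Rel \<subseteq> carrier G \<times> carrier G" "finite Rel" and finG: "finite (carrier G)"
    and enc: "inj_on enc ({0, 1, 2} \<times> carrier G)"
begin

definition X where "X a = enc (0, a)"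
definition Y where "Y a = enc (1, a)"
definition Z where "Z a = enc (2, a)"

lemma enc_fold: "enc (0, a) = X a" "enc (Suc 0, a) = Y a" "enc (2, a) = Z a"
  by (simp_all add: X_def Y_def Z_def)

text \<open>The cells of \<open>(a, b)\<close> triangulate a triangle with corners \<open>X \<one>\<close>, \<open>Y \<one>\<close>, \<open>Z \<one>\<close> and side midpoints
  \<open>X a\<close>, \<open>Y b\<close>, \<open>Z (a \<otimes> b)\<close>. When one of these elements is \<open>\<one>\<close>, the midpoint merges with a corner and
  a triangle degenerates.\<close>

definition cells :: "'a \<times> 'a \<Rightarrow> nat set set"
  where "cells = (\<lambda>(a, b). {{X \<one>, X a, Z (a \<otimes> b)}, {X a, Y b, Y \<one>}, {Y b, Z (a \<otimes> b), Z \<one>}, {X a, Y b, Z (a \<otimes> b)}})"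

text \<open>The two extra edges attach the corners \<open>Y \<one>\<close> and
  \<open>Z \<one>\<close> to \<open>X \<one>\<close> even if no cell contains two corners.\<close>

definition facets :: "nat set set"
  where "facets = {{X \<one>, Y \<one>}, {X \<one>, Z \<one>}} \<union> (\<Union>p\<in>Rel. cells p)"

definition K :: "nat set set"
  where "K = {\<sigma>. \<sigma> \<noteq> {} \<and> (\<exists>\<tau>\<in>facets. \<sigma> \<subseteq> \<tau>)}"

definition triangles :: "('a \<times> 'a) set \<Rightarrow> nat set set"
  where "triangles R = {\<tau>. card \<tau> = 3 \<and> (\<exists>p\<in>R. \<tau> \<in> cells p)}"

lemma finite_facets: "finite facets"
  using Rel by (auto simp: facets_def cells_def)

lemma facet_card: "\<tau> \<in> facets \<Longrightarrow> finite \<tau> \<and> card \<tau> \<le> 3"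
  by (auto simp: facets_def cells_def card_insert_if)

lemma complex_K: "finite_abstract_complex K"
proof -
  have "K \<subseteq> (\<Union>\<tau>\<in>facets. Pow \<tau>)" by (auto simp: K_def)
  moreover have "finite (\<Union>\<tau>\<in>facets. Pow \<tau>)" using finite_facets facet_card by (intro finite_UN_I) auto
  ultimately have "finite K" by (rule finite_subset)
  moreover have "finite \<sigma>" if "\<sigma> \<in> K" for \<sigma> using that facet_card by (auto simp: K_def intro: finite_subset)
  ultimately show ?thesis unfolding finite_abstract_complex_def K_def by blast
qed

lemma card_K: "\<sigma> \<in> K \<Longrightarrow> card \<sigma> \<le> 3"
  using facet_card unfolding K_def by (auto intro: order_trans[OF card_mono])

lemma card_pair_neq_3 [simp]: "card {p, q} \<noteq> 3"
  by (cases "p = q") auto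

lemma triangles_K: "{\<sigma> \<in> K. card \<sigma> = 3} \<subseteq> triangles Rel"
proof
  fix \<sigma> assume "\<sigma> \<in> {\<sigma> \<in> K. card \<sigma> = 3}"
  then obtain \<tau> where \<tau>: "\<tau> \<in> facets" "\<sigma> \<subseteq> \<tau>" "card \<sigma> = 3" by (auto simp: K_def)
  then have "\<sigma> = \<tau>" using facet_card[OF \<tau>(1)] by (intro card_seteq) auto
  moreover have "\<tau> \<noteq> {X \<one>, Y \<one>}" "\<tau> \<noteq> {X \<one>, Z \<one>}" using \<tau>(3) \<open>\<sigma> = \<tau>\<close> by auto
  ultimately show "\<sigma> \<in> triangles Rel" using \<tau> by (auto simp: triangles_def facets_def)
qed

lemma triangles_union: "triangles (R \<union> R') = triangles R \<union> triangles R'"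
  by (auto simp: triangles_def)

lemma triangles_insert: "triangles (insert p R) = triangles {p} \<union> triangles R"
  by (auto simp: triangles_def)

lemma finite_triangles: "finite R \<Longrightarrow> finite (triangles R)"
  by (rule finite_subset[of _ "\<Union>p\<in>R. cells p"]) (auto simp: triangles_def cells_def)

lemma card_triangles_union: "card (triangles (R \<union> R')) \<le> card (triangles R) + card (triangles R')"
  unfolding triangles_union by (rule card_Un_le)

lemma card_triangles_insert: "card (triangles (insert p R)) \<le> card (triangles {p}) + card (triangles R)"
  unfolding triangles_insert[of p R] by (rule card_Un_le)

lemma card_triangles_1: "card (triangles {(a, b)}) \<le> 4"
proof -
  have "card (triangles {(a, b)}) \<le> card (cells (a, b))"
    by (rule card_mono) (auto simp: triangles_def cells_def)
  also have "\<dots> \<le> 4" by (auto simp: cells_def card_insert_if)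
  finally show ?thesis .
qed

text \<open>One corner cell shrinks to an edge: the first in \<open>cells (a, b)\<close> if
  \<open>a = \<one>\<close>, the second if \<open>b = \<one>\<close>, the third if
  \<open>a \<otimes> b = \<one>\<close>. For the pair \<open>(\<one>, \<one>)\<close> all three
  shrink.\<close>

lemma card_triangles_unit:
  assumes "a \<in> carrier G" "b \<in> carrier G" "a = \<one> \<or> b = \<one> \<or> a \<otimes> b = \<one>"
  shows "card (triangles {(a, b)}) \<le> 3"
proof -
  have "\<exists>\<tau>\<in>cells (a, b). card \<tau> \<noteq> 3"
    using assms by (auto simp: cells_def card_insert_if)
  then obtain \<tau> where \<tau>: "\<tau> \<in> cells (a, b)" "card \<tau> \<noteq> 3" by blast
  have "card (triangles {(a, b)}) \<le> card (cells (a, b) - {\<tau>})"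
    using \<tau> by (intro card_mono) (auto simp: triangles_def cells_def)
  also have "\<dots> = card (cells (a, b)) - 1" using \<tau> by simp
  also have "\<dots> \<le> 3" by (auto simp: cells_def card_insert_if)
  finally show ?thesis .
qed

lemma card_triangles_one: "card (triangles {(\<one>, \<one>)}) \<le> 1"
proof -
  have "triangles {(\<one>, \<one>)} \<subseteq> {{X \<one>, Y \<one>, Z \<one>}}"
    by (auto simp: triangles_def cells_def)
  then have "card (triangles {(\<one>, \<one>)}) \<le> card {{X \<one>, Y \<one>, Z \<one>}}" by (intro card_mono) auto
  then show ?thesis by simp
qed

section \<open>Spanning tree and tautological cocycle of the tripartite complex\<close>

definition dec where "dec = the_inv_into ({0, 1, 2} \<times> carrier G) enc"

lemma dec_simps [simp]:
  assumes "a \<in> carrier G"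
  shows "dec (X a) = (0, a)" "dec (Y a) = (1, a)" "dec (Z a) = (2, a)"
  using assms the_inv_into_f_f[OF enc] unfolding dec_def X_def Y_def Z_def by auto

text \<open>A tree of height at most 2: vertices hang on the corner of their kind, and the corners
  \<open>Y \<one>\<close> and \<open>Z \<one>\<close> on \<open>X \<one>\<close>.\<close>

definition par where "par v = (if snd (dec v) = \<one> then X \<one> else enc (fst (dec v), \<one>))"

definition depth :: "nat \<Rightarrow> nat"
  where "depth v = (if fst (dec v) = 0 then 0 else 1) + (if snd (dec v) = \<one> then 0 else 1)"

text \<open>An edge from \<open>X a\<close> to \<open>Y b\<close> carries \<open>a\<close>, from \<open>Y b\<close> to \<open>Z d\<close> it carries \<open>b\<close>, and from \<open>X a\<close> to
  \<open>Z d\<close> it carries \<open>d\<close>; edges between vertices of the same kind carry \<open>\<one>\<close>.\<close>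

definition coc where "coc u v = (let (i, a) = dec u; (j, b) = dec v in
   if a \<notin> carrier G \<or> b \<notin> carrier G \<or> i = j then \<one>
   else if (i, j) = (0, 1) \<or> (i, j) = (1, 2) then a
   else if (i, j) = (0, 2) then b
   else if (i, j) = (2, 0) then inv a
   else inv b)"

lemma coc_closed: "coc u v \<in> carrier G"
  by (auto simp: coc_def Let_def split: prod.splits)

lemma coc_simps:
  assumes "a \<in> carrier G" "b \<in> carrier G"
  shows "coc (X a) (X b) = \<one>" "coc (Y a) (Y b) = \<one>" "coc (Z a) (Z b) = \<one>"
    "coc (X a) (Y b) = a" "coc (Y a) (Z b) = a" "coc (X a) (Z b) = b"
    "coc (Y a) (X b) = inv b" "coc (Z a) (Y b) = inv b" "coc (Z a) (X b) = inv a"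
  using assms by (auto simp: coc_def)

lemma Rel_closed: "(a, b) \<in> Rel \<Longrightarrow> a \<in> carrier G \<and> b \<in> carrier G"
  using Rel by auto

lemma facet_cases:
  assumes "\<tau> \<in> facets"
  obtains "\<tau> = {X \<one>, Y \<one>}" | "\<tau> = {X \<one>, Z \<one>}"
  | a b where "(a, b) \<in> Rel" "a \<in> carrier G" "b \<in> carrier G" "\<tau> = {X \<one>, X a, Z (a \<otimes> b)}"
  | a b where "(a, b) \<in> Rel" "a \<in> carrier G" "b \<in> carrier G" "\<tau> = {X a, Y b, Y \<one>}"
  | a b where "(a, b) \<in> Rel" "a \<in> carrier G" "b \<in> carrier G" "\<tau> = {Y b, Z (a \<otimes> b), Z \<one>}"
  | a b where "(a, b) \<in> Rel" "a \<in> carrier G" "b \<in> carrier G" "\<tau> = {X a, Y b, Z (a \<otimes> b)}"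
proof -
  have "\<tau> = {X \<one>, Y \<one>} \<or> \<tau> = {X \<one>, Z \<one>} \<or> (\<exists>a b. (a, b) \<in> Rel \<and> \<tau> \<in> cells (a, b))"
    using assms by (auto simp: facets_def)
  then show thesis
  proof (elim disjE exE conjE)
    fix a b assume ab: "(a, b) \<in> Rel" "\<tau> \<in> cells (a, b)"
    then show thesis
      using that(3-6)[OF ab(1)] Rel_closed[OF ab(1)] by (auto simp: cells_def)
  qed (use that in auto)
qed

text \<open>On each facet the cocycle is the coboundary of a potential, which settles the cocycle
  identity at once for all orderings and repetitions of vertices.\<close>

lemma facet_potential:
  assumes "\<tau> \<in> facets"
  shows "\<exists>f. \<forall>u\<in>\<tau>. f u \<in> carrier G \<and> (\<forall>v\<in>\<tau>. coc u v = inv (f u) \<otimes> f v)"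
  using assms
proof (cases rule: facet_cases)
  case 1
  then show ?thesis by (intro exI[of _ "\<lambda>_. \<one>"]) (auto simp: coc_simps)
next
  case 2
  then show ?thesis by (intro exI[of _ "\<lambda>_. \<one>"]) (auto simp: coc_simps)
next
  case (3 a b)
  then show ?thesis
    by (intro exI[of _ "\<lambda>v. if fst (dec v) = 0 then \<one> else a \<otimes> b"]) (auto simp: coc_simps)
next
  case (4 a b)
  then show ?thesis
    by (intro exI[of _ "\<lambda>v. if fst (dec v) = 0 then \<one> else a"]) (auto simp: coc_simps)
next
  case (5 a b)
  then show ?thesis
    by (intro exI[of _ "\<lambda>v. if fst (dec v) = 1 then \<one> else b"]) (auto simp: coc_simps)
next
  case (6 a b)
  then have "inv (a \<otimes> b) \<otimes> a = inv b" "inv a \<otimes> (a \<otimes> b) = b"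
    by (simp_all add: inv_mult_group m_assoc) (simp add: m_assoc[symmetric])
  then show ?thesis using 6
    by (intro exI[of _ "\<lambda>v. if fst (dec v) = 0 then \<one> else if fst (dec v) = 1 then a else a \<otimes> b"])
      (auto simp: coc_simps)
qed

lemma coc_mult:
  assumes "{u, v, w} \<in> K"
  shows "coc u v \<otimes> coc v w = coc u w"
proof -
  obtain \<tau> where \<tau>: "\<tau> \<in> facets" "u \<in> \<tau>" "v \<in> \<tau>" "w \<in> \<tau>" using assms by (auto simp: K_def)
  obtain f where "\<forall>u\<in>\<tau>. f u \<in> carrier G \<and> (\<forall>v\<in>\<tau>. coc u v = inv (f u) \<otimes> f v)"
    using facet_potential[OF \<tau>(1)] by blast
  then show ?thesis using \<tau> by (simp add: m_assoc) (simp add: m_assoc[symmetric])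
qed

lemma K_I: "\<tau> \<in> facets \<Longrightarrow> \<sigma> \<subseteq> \<tau> \<Longrightarrow> \<sigma> \<noteq> {} \<Longrightarrow> \<sigma> \<in> K"
  by (auto simp: K_def)

lemma base_facets: "{X \<one>, Y \<one>} \<in> facets" "{X \<one>, Z \<one>} \<in> facets"
  by (auto simp: facets_def)

lemma Rel_facets:
  assumes "(a, b) \<in> Rel"
  shows "{X \<one>, X a, Z (a \<otimes> b)} \<in> facets" "{X a, Y b, Y \<one>} \<in> facets"
    "{Y b, Z (a \<otimes> b), Z \<one>} \<in> facets" "{X a, Y b, Z (a \<otimes> b)} \<in> facets"
  using assms by (auto simp: facets_def cells_def)

lemma vertex_cases:
  assumes "{v} \<in> K"
  obtains "v = X \<one>" | "v = Y \<one>" | "v = Z \<one>"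
  | a b where "(a, b) \<in> Rel" "v = X a" | a b where "(a, b) \<in> Rel" "v = Y b"
  | a b where "(a, b) \<in> Rel" "v = Z (a \<otimes> b)"
  using assms unfolding K_def facets_def cells_def by auto

lemma tree_edge:
  assumes "{v} \<in> K" "v \<noteq> X \<one>"
  shows "{par v, v} \<in> K \<and> depth v = Suc (depth (par v)) \<and> coc (par v) v = \<one>"
  using assms(1)
proof (cases rule: vertex_cases)
  case (4 a b)
  then have "a \<in> carrier G" "a \<noteq> \<one>" using Rel_closed assms(2) by auto
  then show ?thesis using 4 K_I[OF Rel_facets(1)[OF 4(1)], of "{X \<one>, X a}"]
    by (auto simp: par_def depth_def coc_simps enc_fold)
next
  case (5 a b)
  then have "b \<in> carrier G" using Rel_closed by auto
  then show ?thesis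
    using 5 K_I[OF Rel_facets(2)[OF 5(1)], of "{Y \<one>, Y b}"] K_I[OF base_facets(1), of "{X \<one>, Y \<one>}"]
    by (cases "b = \<one>") (auto simp: par_def depth_def coc_simps enc_fold)
next
  case (6 a b)
  then have "a \<otimes> b \<in> carrier G" using Rel_closed by auto
  then show ?thesis
    using 6 K_I[OF Rel_facets(3)[OF 6(1)], of "{Z \<one>, Z (a \<otimes> b)}"] K_I[OF base_facets(2), of "{X \<one>, Z \<one>}"]
    by (cases "a \<otimes> b = \<one>") (auto simp: par_def depth_def coc_simps enc_fold)
qed (use assms(2) K_I[OF base_facets(1), of "{X \<one>, Y \<one>}"] K_I[OF base_facets(2), of "{X \<one>, Z \<one>}"] in
    \<open>auto simp: par_def depth_def coc_simps\<close>)

lemma vertex_X1: "{X \<one>} \<in> K"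
  using K_I[OF base_facets(1)] by blast

text \<open>Supplies the monodromy homomorphism from \<open>FG\<close> back to
  \<open>G\<close>.\<close>

sublocale cocycle K "vtx (X \<one>)" "X \<one>" par depth G coc
proof (intro cocycle.intro cocycle_axioms.intro tree_complex.intro tree_complex_axioms.intro)
  show KC: "complex K" by unfold_locales (rule complex_K)
  show "vtx (X \<one>) \<in> geometric_realization K" using complex.vtx_in[OF KC vertex_X1] .
  show "X \<one> \<in> supp (vtx (X \<one>))" by simp
  show "depth (X \<one>) = 0" by (simp add: depth_def)
  show "{par v, v} \<in> K \<and> depth v = Suc (depth (par v))" if "{v} \<in> K" "v \<noteq> X \<one>" for v
    using tree_edge[OF that] by blast
  show "coc (par v) v = \<one>" if "{v} \<in> K" "v \<noteq> X \<one>" for v using tree_edge[OF that] by blast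
qed (fact is_group finG coc_closed coc_mult)+

section \<open>Edge classes of the tripartite complex\<close>

definition A where "A a = edge_class (X a) (Y \<one>)"
definition B where "B b = edge_class (Y b) (Z \<one>)"
definition D where "D d = edge_class (X \<one>) (Z d)"

lemma ec_mult:
  assumes "\<tau> \<in> facets" "u \<in> \<tau>" "v \<in> \<tau>" "w \<in> \<tau>"
  shows "edge_class u v \<otimes>\<^bsub>FG\<^esub> edge_class v w = edge_class u w"
  using assms by (intro edge_class_mult K_I[OF assms(1)]) auto

lemma ec_closed:
  assumes "\<tau> \<in> facets" "u \<in> \<tau>" "v \<in> \<tau>"
  shows "edge_class u v \<in> carrier FG"
  using assms by (intro edge_class_closed K_I[OF assms(1)]) auto

lemma ec_inv:
  assumes "\<tau> \<in> facets" "u \<in> \<tau>" "v \<in> \<tau>"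
  shows "edge_class v u = inv\<^bsub>FG\<^esub> edge_class u v"
  using assms by (intro edge_class_inv K_I[OF assms(1)]) auto

lemma ec_refl:
  assumes "\<tau> \<in> facets" "u \<in> \<tau>"
  shows "edge_class u u = \<one>\<^bsub>FG\<^esub>"
  using assms by (intro edge_class_refl K_I[OF assms(1)]) auto

interpretation FG: group FG by (rule group_FG)

lemma ec_base: "edge_class (X \<one>) (Y \<one>) = \<one>\<^bsub>FG\<^esub>" "edge_class (X \<one>) (Z \<one>) = \<one>\<^bsub>FG\<^esub>"
proof -
  have v: "{Y \<one>} \<in> K" "{Z \<one>} \<in> K" using K_I[OF base_facets(1)] K_I[OF base_facets(2)] by blast+
  have n: "Y \<one> \<noteq> X \<one>" "Z \<one> \<noteq> X \<one>" using dec_simps[OF one_closed] by (metis prod.inject zero_neq_one zero_neq_numeral)+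
  have "par (Y \<one>) = X \<one>" "par (Z \<one>) = X \<one>" by (simp_all add: par_def)
  then show "edge_class (X \<one>) (Y \<one>) = \<one>\<^bsub>FG\<^esub>" "edge_class (X \<one>) (Z \<one>) = \<one>\<^bsub>FG\<^esub>"
    using edge_class_tree[OF v(1) n(1)] edge_class_tree[OF v(2) n(2)] by simp_all
qed

text \<open>These edges belong to the tree, unless they degenerate to a vertex.\<close>

lemma ec_leaf:
  assumes "(a, b) \<in> Rel"
  shows "edge_class (X \<one>) (X a) = \<one>\<^bsub>FG\<^esub>" "edge_class (Y \<one>) (Y b) = \<one>\<^bsub>FG\<^esub>"
    "edge_class (Z \<one>) (Z (a \<otimes> b)) = \<one>\<^bsub>FG\<^esub>"
proof -
  note f = Rel_facets[OF assms]
  have c: "a \<in> carrier G" "b \<in> carrier G" "a \<otimes> b \<in> carrier G" using Rel_closed[OF assms] by auto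
  have v: "{X a} \<in> K" "{Y b} \<in> K" "{Z (a \<otimes> b)} \<in> K" using K_I[OF f(4)] by blast+
  have n: "Y b \<noteq> X \<one>" "Z (a \<otimes> b) \<noteq> X \<one>"
    using dec_simps[OF one_closed] dec_simps[OF c(2)] dec_simps[OF c(3)]
    by (metis prod.inject zero_neq_one zero_neq_numeral)+
  show "edge_class (X \<one>) (X a) = \<one>\<^bsub>FG\<^esub>"
  proof (cases "a = \<one>")
    case True
    then show ?thesis using ec_refl[OF f(1)] by simp
  next
    case False
    then have "X a \<noteq> X \<one>" using c(1) by (metis dec_simps(1) one_closed prod.inject)
    then show ?thesis using edge_class_tree[OF v(1)] False c(1) by (simp add: par_def enc_fold)
  qed
  show "edge_class (Y \<one>) (Y b) = \<one>\<^bsub>FG\<^esub>"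
  proof (cases "b = \<one>")
    case True
    then show ?thesis using ec_refl[OF f(2)] by simp
  next
    case False
    then show ?thesis using edge_class_tree[OF v(2) n(1)] c by (simp add: par_def enc_fold)
  qed
  show "edge_class (Z \<one>) (Z (a \<otimes> b)) = \<one>\<^bsub>FG\<^esub>"
  proof (cases "a \<otimes> b = \<one>")
    case True
    then show ?thesis using ec_refl[OF f(3), of "Z \<one>"] by simp
  next
    case False
    then show ?thesis using edge_class_tree[OF v(3) n(2)] c by (simp add: par_def enc_fold)
  qed
qed

text \<open>The corner cells identify the sides of the central cell with classes depending on one
  element each, since the edges from corners to midpoints are trivial by \<open>ec_leaf\<close>. So
  relations that share an element in the same position share its class.\<close>

lemma ec_values:
  assumes "(a, b) \<in> Rel"
  shows "edge_class (X a) (Y b) = A a" "edge_class (X a) (Z (a \<otimes> b)) = D (a \<otimes> b)"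
    "edge_class (Y b) (Z (a \<otimes> b)) = B b" "A a \<in> carrier FG" "B b \<in> carrier FG" "D (a \<otimes> b) \<in> carrier FG"
proof -
  note f = Rel_facets[OF assms] and l = ec_leaf[OF assms]
  show c: "A a \<in> carrier FG" "B b \<in> carrier FG" "D (a \<otimes> b) \<in> carrier FG"
    unfolding A_def B_def D_def
    using ec_closed[OF f(2), of "X a" "Y \<one>"] ec_closed[OF f(3), of "Y b" "Z \<one>"]
      ec_closed[OF f(1), of "X \<one>" "Z (a \<otimes> b)"] by auto
  have "A a \<otimes>\<^bsub>FG\<^esub> edge_class (Y \<one>) (Y b) = edge_class (X a) (Y b)"
    unfolding A_def by (rule ec_mult[OF f(2)]) auto
  then show "edge_class (X a) (Y b) = A a" using l c by simp
  have "edge_class (X \<one>) (X a) \<otimes>\<^bsub>FG\<^esub> edge_class (X a) (Z (a \<otimes> b)) = D (a \<otimes> b)"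
    unfolding D_def by (rule ec_mult[OF f(1)]) auto
  moreover have "edge_class (X a) (Z (a \<otimes> b)) \<in> carrier FG" by (rule ec_closed[OF f(1)]) auto
  ultimately show "edge_class (X a) (Z (a \<otimes> b)) = D (a \<otimes> b)" using l by simp
  have "B b \<otimes>\<^bsub>FG\<^esub> edge_class (Z \<one>) (Z (a \<otimes> b)) = edge_class (Y b) (Z (a \<otimes> b))"
    unfolding B_def by (rule ec_mult[OF f(3)]) auto
  then show "edge_class (Y b) (Z (a \<otimes> b)) = B b" using l c by simp
qed

lemma relation:
  assumes "(a, b) \<in> Rel"
  shows "A a \<otimes>\<^bsub>FG\<^esub> B b = D (a \<otimes> b)"
  using ec_mult[OF Rel_facets(4)[OF assms], of "X a" "Y b" "Z (a \<otimes> b)"] ec_values[OF assms] by simp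

lemma A_one: "A \<one> = \<one>\<^bsub>FG\<^esub>" and D_one: "D \<one> = \<one>\<^bsub>FG\<^esub>"
  by (simp_all add: A_def D_def ec_base)

text \<open>By \<open>relation\<close>, agreement on \<open>A\<close> and \<open>B\<close> extends
  to \<open>D\<close>; then each facet has agreement on edges joining its vertices, and inverses and
  constant edges follow.\<close>

lemma edge_class_eq_hom:
  assumes \<theta>: "\<theta> \<in> hom G FG" and AB: "\<And>a b. (a, b) \<in> Rel \<Longrightarrow> A a = \<theta> a \<and> B b = \<theta> b"
    and uv: "{u, v} \<in> K"
  shows "edge_class u v = \<theta> (coc u v)"
proof -
  interpret \<theta>: group_hom G FG \<theta>
    using \<theta> group_FG is_group by (auto simp: group_hom_def group_hom_axioms_def)
  obtain \<tau> where \<tau>: "\<tau> \<in> facets" "u \<in> \<tau>" "v \<in> \<tau>" using uv by (auto simp: K_def)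
  have inv: "edge_class q p = \<theta> (coc q p)" if "edge_class p q = \<theta> (coc p q)" "p \<in> \<tau>" "q \<in> \<tau>" for p q
  proof -
    have "{p, q} \<in> K" using K_I[OF \<tau>(1), of "{p, q}"] that(2,3) by simp
    then have "coc q p = inv (coc p q)" by (rule c_inv)
    then show ?thesis using ec_inv[OF \<tau>(1) that(2,3)] that(1) coc_closed by simp
  qed
  have refl: "edge_class p p = \<theta> (coc p p)" if "p \<in> \<tau>" for p
  proof -
    have "{p} \<in> K" using K_I[OF \<tau>(1), of "{p}"] that by simp
    then show ?thesis using ec_refl[OF \<tau>(1) that] c_refl by simp
  qed
  have D\<theta>: "D (a \<otimes> b) = \<theta> (a \<otimes> b)" if "(a, b) \<in> Rel" for a b
    using relation[OF that] AB[OF that] Rel_closed[OF that] by simp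
  have three: ?thesis if pqs: "\<tau> = {p, q, s}" and "edge_class p q = \<theta> (coc p q)" "edge_class q s = \<theta> (coc q s)"
    "edge_class p s = \<theta> (coc p s)" for p q s
    using \<tau>(2,3) that refl[of p] refl[of q] refl[of s] inv[of p q] inv[of q s] inv[of p s] by auto
  from \<tau>(1) show ?thesis
  proof (cases rule: facet_cases)
    case 1
    have "edge_class (X \<one>) (Y \<one>) = \<theta> (coc (X \<one>) (Y \<one>))" by (simp add: ec_base coc_simps)
    then show ?thesis using 1 \<tau> refl inv by blast
  next
    case 2
    have "edge_class (X \<one>) (Z \<one>) = \<theta> (coc (X \<one>) (Z \<one>))" by (simp add: ec_base coc_simps)
    then show ?thesis using 2 \<tau> refl inv by blast
  next
    case (3 a b)
    have "edge_class (X \<one>) (X a) = \<theta> (coc (X \<one>) (X a))"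
      "edge_class (X a) (Z (a \<otimes> b)) = \<theta> (coc (X a) (Z (a \<otimes> b)))"
      "edge_class (X \<one>) (Z (a \<otimes> b)) = \<theta> (coc (X \<one>) (Z (a \<otimes> b)))"
      using 3 ec_leaf[OF 3(1)] ec_values[OF 3(1)] D\<theta>[OF 3(1)] by (simp_all add: coc_simps D_def[symmetric])
    then show ?thesis using 3(4) by (intro three)
  next
    case (4 a b)
    have "edge_class (X a) (Y b) = \<theta> (coc (X a) (Y b))"
      "edge_class (Y \<one>) (Y b) = \<theta> (coc (Y \<one>) (Y b))"
      "edge_class (X a) (Y \<one>) = \<theta> (coc (X a) (Y \<one>))"
      using 4 ec_leaf[OF 4(1)] ec_values[OF 4(1)] AB[OF 4(1)] by (simp_all add: coc_simps A_def[symmetric])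
    then show ?thesis
      using 4(4) inv[of "Y \<one>" "Y b"] by (intro three[of "X a" "Y b" "Y \<one>"]) auto
  next
    case (5 a b)
    have "edge_class (Y b) (Z (a \<otimes> b)) = \<theta> (coc (Y b) (Z (a \<otimes> b)))"
      "edge_class (Z \<one>) (Z (a \<otimes> b)) = \<theta> (coc (Z \<one>) (Z (a \<otimes> b)))"
      "edge_class (Y b) (Z \<one>) = \<theta> (coc (Y b) (Z \<one>))"
      using 5 ec_leaf[OF 5(1)] ec_values[OF 5(1)] AB[OF 5(1)] by (simp_all add: coc_simps B_def[symmetric])
    then show ?thesis
      using 5(4) inv[of "Z \<one>" "Z (a \<otimes> b)"] by (intro three[of "Y b" "Z (a \<otimes> b)" "Z \<one>"]) auto
  next
    case (6 a b)
    have "edge_class (X a) (Y b) = \<theta> (coc (X a) (Y b))"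
      "edge_class (Y b) (Z (a \<otimes> b)) = \<theta> (coc (Y b) (Z (a \<otimes> b)))"
      "edge_class (X a) (Z (a \<otimes> b)) = \<theta> (coc (X a) (Z (a \<otimes> b)))"
      using 6 ec_values[OF 6(1)] AB[OF 6(1)] D\<theta>[OF 6(1)] by (simp_all add: coc_simps)
    then show ?thesis using 6(4) by (intro three)
  qed
qed

lemma hom_surj:
  assumes \<theta>: "\<theta> \<in> hom G FG" and AB: "\<And>a b. (a, b) \<in> Rel \<Longrightarrow> A a = \<theta> a \<and> B b = \<theta> b"
  shows "\<theta> ` carrier G = carrier FG"
proof
  show "\<theta> ` carrier G \<subseteq> carrier FG" using \<theta> by (auto simp: hom_def)
  show "carrier FG \<subseteq> \<theta> ` carrier G"
  proof (rule edge_classes_generate)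
    show "edge_class u v \<in> \<theta> ` carrier G" if "{u, v} \<in> K" for u v
      using edge_class_eq_hom[OF \<theta> AB that] coc_closed by blast
    show "P \<otimes>\<^bsub>FG\<^esub> Q \<in> \<theta> ` carrier G" if PQ: "P \<in> \<theta> ` carrier G" "Q \<in> \<theta> ` carrier G" for P Q
    proof -
      obtain a b where "P = \<theta> a" "Q = \<theta> b" "a \<in> carrier G" "b \<in> carrier G" using PQ by auto
      then have "P \<otimes>\<^bsub>FG\<^esub> Q = \<theta> (a \<otimes> b)" using \<theta> by (simp add: hom_mult)
      then show ?thesis using \<open>a \<in> carrier G\<close> \<open>b \<in> carrier G\<close> by blast
    qed
  qed
qed

end

text \<open>Binary expansion: from the class of the \<open>b\<close>-th power of a generator, three more relations
  give the class of its \<open>2b\<close>-th or \<open>(2b + 1)\<close>-th power.\<close>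

fun chain :: "('a, 'b) monoid_scheme \<Rightarrow> 'a \<Rightarrow> nat \<Rightarrow> ('a \<times> 'a) set"
  where "chain G g n = (if n \<le> 1 then {(\<one>\<^bsub>G\<^esub>, \<one>\<^bsub>G\<^esub>), (inv\<^bsub>G\<^esub> g, g), (\<one>\<^bsub>G\<^esub>, g)}
    else chain G g (n div 2) \<union> {(g [^]\<^bsub>G\<^esub> (n div 2), \<one>\<^bsub>G\<^esub>),
      (if even n then (\<one>\<^bsub>G\<^esub>, g [^]\<^bsub>G\<^esub> (n div 2)) else (inv\<^bsub>G\<^esub> g, g [^]\<^bsub>G\<^esub> (n div 2 + 1))),
      (g [^]\<^bsub>G\<^esub> (n div 2), g [^]\<^bsub>G\<^esub> (n - n div 2))})"

declare chain.simps [simp del]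

lemma finite_chain: "finite (chain G g n)"
  by (induction G g n rule: chain.induct) (subst chain.simps, auto)

lemma chain_base: "(\<one>\<^bsub>G\<^esub>, \<one>\<^bsub>G\<^esub>) \<in> chain G g n" "(inv\<^bsub>G\<^esub> g, g) \<in> chain G g n" "(\<one>\<^bsub>G\<^esub>, g) \<in> chain G g n"
  by (induction G g n rule: chain.induct) (subst chain.simps, auto)+

lemma (in group) chain_closed: "g \<in> carrier G \<Longrightarrow> chain G g n \<subseteq> carrier G \<times> carrier G"
proof (induction n rule: less_induct)
  case (less n)
  then show ?case
    using less.IH[of "n div 2"] by (subst chain.simps) (auto split: if_splits)
qed

section \<open>Edge classes along a doubling chain, and its cost\<close>

context relation_complex
begin

interpretation FG: group FG by (rule group_FG)

text \<open>As \<open>A \<one>\<close> and \<open>D \<one>\<close> are trivial, the pair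
  \<open>(\<one>, \<one>)\<close> gives the first equation, \<open>(inv g, g)\<close> the one for
  \<open>inv g\<close> and \<open>(\<one>, g)\<close> the last.\<close>

lemma base_values:
  assumes "chain G g n \<subseteq> Rel"
  shows "B \<one> = \<one>\<^bsub>FG\<^esub>" "B g \<in> carrier FG" "A (inv g) = inv\<^bsub>FG\<^esub> B g" "D g = B g"
proof -
  have R: "(\<one>, \<one>) \<in> Rel" "(inv g, g) \<in> Rel" "(\<one>, g) \<in> Rel"
    using subsetD[OF assms chain_base(1)] subsetD[OF assms chain_base(2)] subsetD[OF assms chain_base(3)] by auto
  have g: "g \<in> carrier G" using Rel_closed[OF R(3)] by simp
  show B: "B g \<in> carrier FG" using ec_values[OF R(3)] by simp
  show "B \<one> = \<one>\<^bsub>FG\<^esub>" using relation[OF R(1)] ec_values[OF R(1)] by (simp add: A_one D_one)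
  show "D g = B g" using relation[OF R(3)] B g by (simp add: A_one)
  have "A (inv g) \<otimes>\<^bsub>FG\<^esub> B g = \<one>\<^bsub>FG\<^esub>" using relation[OF R(2)] g by (simp add: D_one)
  then show "A (inv g) = inv\<^bsub>FG\<^esub> B g" using FG.inv_equality B ec_values[OF R(2)] by (simp add: FG.inv_equality)
qed

text \<open>One choice of exponents suffices: a homomorphism sending \<open>g\<close> to
  \<open>B g\<close> then agrees with \<open>A\<close> and \<open>B\<close> on the two entries,
  whatever the order of \<open>g\<close>.\<close>

definition power_pair :: "'a \<Rightarrow> 'a \<times> 'a \<Rightarrow> bool"
  where "power_pair g p \<longleftrightarrow> (\<exists>(k::int) (l::int). p = (g [^] k, g [^] l) \<and>
    A (g [^] k) = B g [^]\<^bsub>FG\<^esub> k \<and> B (g [^] l) = B g [^]\<^bsub>FG\<^esub> l)"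

lemma power_pairI:
  "p = (g [^] (k::int), g [^] (l::int)) \<Longrightarrow> A (g [^] k) = B g [^]\<^bsub>FG\<^esub> k \<Longrightarrow> B (g [^] l) = B g [^]\<^bsub>FG\<^esub> l \<Longrightarrow> power_pair g p"
  unfolding power_pair_def by blast

text \<open>With \<open>b = n div 2\<close>, the first new pair carries the value of
  \<open>D (g [^] b)\<close> over to \<open>A (g [^] b)\<close>, the second determines
  \<open>B (g [^] (n - b))\<close> from it, and the third multiplies the two. For odd
  \<open>n\<close> the second pair uses \<open>A (inv g)\<close> to gain a factor.\<close>

lemma chain_values:
  assumes "chain G g n \<subseteq> Rel" "1 \<le> n"
  shows "D (g [^] n) = B g [^]\<^bsub>FG\<^esub> n \<and> (\<forall>p\<in>chain G g n. power_pair g p)"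
  using assms
proof (induction n rule: less_induct)
  case (less n)
  note base = base_values[OF less.prems(1)]
  have g: "g \<in> carrier G" using Rel_closed chain_base(3) less.prems(1) by (metis subsetD)
  let ?\<gamma> = "B g"
  note \<gamma> = base(2)
  show ?case
  proof (cases "n \<le> 1")
    case True
    then have n: "n = 1" using less.prems by simp
    have "power_pair g (\<one>, \<one>)" using base A_one by (intro power_pairI[of _ _ 0 0]) auto
    moreover have "power_pair g (inv g, g)"
      using base g by (intro power_pairI[of _ _ "-1" 1]) (auto simp: int_pow_neg FG.int_pow_neg)
    moreover have "power_pair g (\<one>, g)" using base A_one g by (intro power_pairI[of _ _ 0 1]) auto
    moreover have "chain G g n = {(\<one>, \<one>), (inv g, g), (\<one>, g)}" using n by (subst chain.simps) simp
    ultimately show ?thesis using base g n by simp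
  next
    case False
    define b where "b = n div 2"
    have b: "1 \<le> b" "b < n" using False by (auto simp: b_def)
    have ch: "chain G g n = chain G g b \<union> {(g [^] b, \<one>),
        (if even n then (\<one>, g [^] b) else (inv g, g [^] (b + 1))), (g [^] b, g [^] (n - b))}"
      using False by (subst chain.simps) (simp add: b_def)
    have sub: "chain G g b \<subseteq> Rel" and R1: "(g [^] b, \<one>) \<in> Rel" and R3: "(g [^] b, g [^] (n - b)) \<in> Rel"
      and R2: "(if even n then (\<one>, g [^] b) else (inv g, g [^] (b + 1))) \<in> Rel"
      using less.prems(1) ch by auto
    have IH: "D (g [^] b) = ?\<gamma> [^]\<^bsub>FG\<^esub> b" "\<forall>p\<in>chain G g b. power_pair g p"
      using less.IH[OF b(2) sub b(1)] by auto
    have Ab: "A (g [^] b) = ?\<gamma> [^]\<^bsub>FG\<^esub> b"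
      using relation[OF R1] ec_values[OF R1] base IH(1) g by simp
    have Bnb: "B (g [^] (n - b)) = ?\<gamma> [^]\<^bsub>FG\<^esub> (n - b) \<and> power_pair g (if even n then (\<one>, g [^] b) else (inv g, g [^] (b + 1)))"
    proof (cases "even n")
      case True
      then have nb: "n - b = b" by (auto simp: b_def)
      have R: "(\<one>, g [^] b) \<in> Rel" using R2 True by simp
      have "B (g [^] b) = ?\<gamma> [^]\<^bsub>FG\<^esub> b"
        using relation[OF R] ec_values[OF R] IH(1) g by (simp add: A_one)
      then show ?thesis using True nb A_one
        by (auto intro!: power_pairI[of _ _ 0 "int b"] simp: int_pow_int)
    next
      case False
      then have nb: "n - b = b + 1" unfolding b_def by presburger
      have R: "(inv g, g [^] (b + 1)) \<in> Rel" using R2 False by simp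
      have "inv g \<otimes> g [^] (b + 1) = g [^] b"
      proof -
        have "g [^] (b + 1) = g \<otimes> g [^] b" using g nat_pow_Suc2 by simp
        then show ?thesis using g by (simp add: m_assoc[symmetric])
      qed
      then have "inv\<^bsub>FG\<^esub> ?\<gamma> \<otimes>\<^bsub>FG\<^esub> B (g [^] (b + 1)) = ?\<gamma> [^]\<^bsub>FG\<^esub> b"
        using relation[OF R] base(3) IH(1) by simp
      then have "B (g [^] (b + 1)) = ?\<gamma> \<otimes>\<^bsub>FG\<^esub> ?\<gamma> [^]\<^bsub>FG\<^esub> b"
        using FG.inv_solve_left[of ?\<gamma> "B (g [^] (b + 1))"] \<gamma> ec_values(5)[OF R]
        by (metis FG.inv_solve_left FG.nat_pow_closed)
      then have "B (g [^] (b + 1)) = ?\<gamma> [^]\<^bsub>FG\<^esub> (b + 1)"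
        using FG.nat_pow_Suc2[OF \<gamma>, of b] by simp
      moreover from this have "power_pair g (inv g, g [^] (b + 1))"
        using base(3) g \<gamma>
        by (intro power_pairI[of _ _ "-1" "int (b + 1)"], unfold int_pow_int) (simp_all add: int_pow_neg FG.int_pow_neg)
      ultimately show ?thesis using False nb by simp
    qed
    have "g [^] b \<otimes> g [^] (n - b) = g [^] n" "?\<gamma> [^]\<^bsub>FG\<^esub> b \<otimes>\<^bsub>FG\<^esub> ?\<gamma> [^]\<^bsub>FG\<^esub> (n - b) = ?\<gamma> [^]\<^bsub>FG\<^esub> n"
      using g \<gamma> b by (simp_all add: nat_pow_mult FG.nat_pow_mult)
    then have Dn: "D (g [^] n) = ?\<gamma> [^]\<^bsub>FG\<^esub> n" using relation[OF R3] Ab Bnb by simp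
    have "power_pair g (g [^] b, \<one>)"
      using Ab base(1) by (intro power_pairI[of _ _ "int b" 0]) (auto simp: int_pow_int)
    moreover have "power_pair g (g [^] b, g [^] (n - b))"
      using Ab Bnb by (intro power_pairI[of _ _ "int b" "int (n - b)"]) (auto simp: int_pow_int)
    ultimately show ?thesis unfolding ch using Dn IH(2) Bnb by blast
  qed
qed

text \<open>The base pairs cost 1 + 3 + 3 = 7, a step 3 + 3 + 4 = 10 or, for odd \<open>n\<close>, 3
  + 4 + 4 = 11. At \<open>n = 2\<close> the total 17 is 14 + 3, and later each halving lowers the
  logarithm by at least 1, so that 14 pays for 11. The case \<open>n = 1\<close> exceeds the formula
  and is kept apart.\<close>

lemma card_triangles_chain:
  assumes g: "g \<in> carrier G" and "1 \<le> n"
  shows "(n = 1 \<longrightarrow> card (triangles (chain G g n)) \<le> 7) \<and>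
    (2 \<le> n \<longrightarrow> real (card (triangles (chain G g n))) \<le> 14 * log 2 (real n) + 3)"
  using assms(2)
proof (induction n rule: less_induct)
  case (less n)
  show ?case
  proof (cases "n = 1")
    case True
    have "card (triangles {(\<one>, \<one>), (inv g, g), (\<one>, g)})
        \<le> card (triangles {(\<one>, \<one>)}) + (card (triangles {(inv g, g)}) + card (triangles {(\<one>, g)}))"
      using card_triangles_insert[of "(\<one>, \<one>)" "{(inv g, g), (\<one>, g)}"] card_triangles_insert[of "(inv g, g)" "{(\<one>, g)}"]
      by linarith
    also have "\<dots> \<le> 1 + (3 + 3)"
      using g by (intro add_mono card_triangles_one card_triangles_unit) auto
    also have "{(\<one>, \<one>), (inv g, g), (\<one>, g)} = chain G g n" using True by (subst chain.simps) simp
    finally show ?thesis using True by simp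
  next
    case False
    define b where "b = n div 2"
    have b: "1 \<le> b" "b < n" "2 * b \<le> n" using False less.prems by (auto simp: b_def)
    let ?p = "if even n then (\<one>, g [^] b) else (inv g, g [^] (b + 1))"
    have ch: "chain G g n = chain G g b \<union> {(g [^] b, \<one>), ?p, (g [^] b, g [^] (n - b))}"
      using False less.prems by (subst chain.simps) (simp add: b_def)
    have p: "card (triangles {?p}) \<le> (if even n then 3 else 4)"
      using g card_triangles_unit[of \<one> "g [^] b"] card_triangles_1[of "inv g" "g [^] (b + 1)"] by auto
    have "card (triangles {(g [^] b, \<one>), ?p, (g [^] b, g [^] (n - b))})
      \<le> card (triangles {(g [^] b, \<one>)}) + (card (triangles {?p}) + card (triangles {(g [^] b, g [^] (n - b))}))"
      using card_triangles_insert[of "(g [^] b, \<one>)" "{?p, (g [^] b, g [^] (n - b))}"]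
        card_triangles_insert[of ?p "{(g [^] b, g [^] (n - b))}"] by linarith
    also have "\<dots> \<le> 3 + ((if even n then 3 else 4) + 4)"
      using g p by (intro add_mono card_triangles_unit card_triangles_1) auto
    finally have step: "card (triangles (chain G g n)) \<le> card (triangles (chain G g b)) + (if even n then 10 else 11)"
      unfolding ch using card_triangles_union[of "chain G g b" "{(g [^] b, \<one>), ?p, (g [^] b, g [^] (n - b))}"]
      by (auto split: if_splits)
    have "real (card (triangles (chain G g n))) \<le> 14 * log 2 (real n) + 3"
    proof (cases "b = 1")
      case True
      then have c: "card (triangles (chain G g b)) \<le> 7" using less.IH[OF b(2,1)] by simp
      have "n = 2 \<or> n = 3" using True False less.prems unfolding b_def by presburger
      then show ?thesis
      proof
        assume n: "n = 2"
        then have "real (card (triangles (chain G g n))) \<le> 17" using step c by simp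
        also have "17 = 14 * log 2 (real n) + 3" by (simp add: n)
        finally show ?thesis .
      next
        assume n: "n = 3"
        then have "real (card (triangles (chain G g n))) \<le> 18" using step c by simp
        \<comment> \<open>The bound 18 for \<open>n = 3\<close> thus reduces to
          \<open>2 ^ 15 \<le> 3 ^ 14\<close>.\<close>
        also have "15 \<le> 14 * log 2 (3 :: real)"
        proof -
          have "15 = log 2 (2 ^ 15 :: real)" by (subst log_pow_cancel) simp_all
          also have "\<dots> \<le> log 2 (3 ^ 14)" by (intro log_mono) auto
          also have "\<dots> = 14 * log 2 3" by (subst log_nat_power) simp_all
          finally show ?thesis .
        qed
        then have "18 \<le> 14 * log 2 (real n) + 3" by (simp add: n)
        finally show ?thesis .
      qed
    next
      case False
      then have "real (card (triangles (chain G g b))) \<le> 14 * log 2 (real b) + 3" using less.IH[OF b(2,1)] b(1) by simp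
      then have "real (card (triangles (chain G g n))) \<le> 14 * (log 2 (real b) + 1) + 3"
        using step by (simp split: if_splits)
      also have "log 2 (real b) + 1 = log 2 (real (2 * b))" using b(1) by (simp add: log_mult)
      also have "\<dots> \<le> log 2 (real n)" using b by (intro log_mono) auto
      finally show ?thesis by simp
    qed
    then show ?thesis using False by simp
  qed
qed

end

section \<open>From commuting generators to the direct sum\<close>

lemma power_prod_group_hom:
  assumes "group_hom G H h" "\<And>i. i < s \<Longrightarrow> g i \<in> carrier G"
  shows "h (power_prod G g s k) = power_prod H (\<lambda>i. h (g i)) s k"
proof -
  interpret group_hom G H h by (rule assms(1))
  show ?thesis using assms(2)
  proof (induction s)
    case (Suc s)
    then have "power_prod G g s k \<in> carrier G" by (intro G.power_prod_closed) auto
    then show ?case using Suc by (simp add: hom_int_pow)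
  qed simp
qed

lemma (in group) power_prod_unit:
  assumes "\<And>i. i < s \<Longrightarrow> g i \<in> carrier G" "i < s" "\<And>j. j < s \<Longrightarrow> k j = (if j = i then 1 else 0)"
  shows "power_prod G g s k = g i"
proof -
  have "power_prod G g t k = (if i < t then g i else \<one>)" if "t \<le> s" for t
    using that assms by (induction t) (auto simp: less_Suc_eq)
  then show ?thesis using assms(2) by simp
qed

lemma comm_group_cyclic_sum: "comm_group (cyclic_sum ns)"
  by (rule group.group_comm_groupI[OF group_cyclic_sum]) (auto simp: add.commute)

definition cyclic_unit :: "nat list \<Rightarrow> nat \<Rightarrow> nat \<Rightarrow> int"
  where "cyclic_unit ns i = (\<lambda>j\<in>{..<length ns}. if j = i then 1 else 0)"

text \<open>The coordinates of an element are its exponents in the standard generators; this makes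
  \<open>\<mu>\<close> a left inverse of \<open>\<theta>\<close> below.\<close>

lemma power_prod_cyclic_unit:
  assumes "\<forall>n\<in>set ns. 0 < n" and x: "x \<in> carrier (cyclic_sum ns)"
  shows "power_prod (cyclic_sum ns) (cyclic_unit ns) (length ns) x = x"
proof -
  have x': "x i = (if i < length ns then x i else undefined)" "i < length ns \<Longrightarrow> 0 \<le> x i \<and> x i < int (ns ! i)" for i
    using x unfolding carrier_cyclic_sum[OF assms(1)] by (auto simp: PiE_iff extensional_def)
  have "power_prod (cyclic_sum ns) (cyclic_unit ns) t x = (\<lambda>i\<in>{..<length ns}. if i < t then x i else 0)"
    if "t \<le> length ns" for t
    using that
  proof (induction t)
    case (Suc t)
    have "cyclic_unit ns t [^]\<^bsub>cyclic_sum ns\<^esub> x t = cyclic_unit ns t [^]\<^bsub>cyclic_sum ns\<^esub> nat (x t)"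
      using x'(2)[of t] Suc.prems by (metis Suc_le_eq int_nat_eq int_pow_int)
    also have "\<dots> = (\<lambda>i\<in>{..<length ns}. if i = t then x i else 0)"
      using x'(2)[of t] Suc.prems by (auto simp: nat_pow_cyclic_sum cyclic_unit_def fun_eq_iff)
    finally show ?case using Suc x'(2) by (auto simp: fun_eq_iff less_Suc_eq)
  qed (auto simp: fun_eq_iff)
  moreover have "x i = undefined" if "\<not> i < length ns" for i using x'(1)[of i] that by simp
  ultimately show ?thesis by (auto simp: fun_eq_iff restrict_def)
qed

text \<open>The classes of the generators satisfy the relations of the direct sum, which yields
  \<open>\<theta>\<close> from \<open>G\<close> to \<open>FG\<close>; it is onto by
  \<open>hom_surj\<close> and injective because the monodromy \<open>\<mu>\<close> inverts
  it.\<close>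

lemma exists_small_complex:
  assumes ns: "\<forall>n\<in>set ns. 2 \<le> n"
  shows "\<exists>K. finite_abstract_complex K \<and> (\<forall>\<sigma>\<in>K. card \<sigma> \<le> 3) \<and> connected (geometric_realization K)
    \<and> has_fundamental_group K (cyclic_sum ns) \<and>
    real (card {\<sigma> \<in> K. card \<sigma> = 3}) \<le>
      14 * log 2 (real (prod_list ns)) + 7 * (real (length ns))\<^sup>2 - 4 * real (length ns)"
proof -
  define s where "s = length ns"
  define G where "G = cyclic_sum ns"
  define g where "g = cyclic_unit ns"
  have pos: "\<forall>n\<in>set ns. 0 < n" using ns by force
  interpret G: comm_group G unfolding G_def by (rule comm_group_cyclic_sum)
  have fin: "finite (carrier G)" unfolding G_def by (rule card_cyclic_sum[OF pos])
  have ns2: "2 \<le> ns ! i" if "i < s" for i using ns that by (simp add: s_def)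
  have g_closed: "g i \<in> carrier G" if "i < s" for i
    using ns2 that unfolding G_def carrier_cyclic_sum[OF pos] g_def cyclic_unit_def s_def
    by (auto simp: less_le_trans[of _ 2] intro: order_less_le_trans[of _ 2])
  have g_pow: "g i [^]\<^bsub>G\<^esub> (ns ! i) = \<one>\<^bsub>G\<^esub>" if "i < s" for i
    unfolding G_def g_def nat_pow_cyclic_sum by (auto simp: cyclic_unit_def fun_eq_iff)
  \<comment> \<open>Both pairs have the product of \<open>g i\<close> and \<open>g j\<close> in
    second place. They evaluate \<open>B\<close> of it to the product of the two generator classes
    in either order, so these classes commute.\<close>
  define pairs where "pairs i j = {(inv\<^bsub>G\<^esub> g i, g i \<otimes>\<^bsub>G\<^esub> g j), (inv\<^bsub>G\<^esub> g j, g i \<otimes>\<^bsub>G\<^esub> g j)}" for i j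
  define Rel where "Rel = (\<Union>i<s. chain G (g i) (ns ! i)) \<union> (\<Union>i<s. \<Union>j<i. pairs i j)"
  have Rel_carrier: "Rel \<subseteq> carrier G \<times> carrier G"
    using G.chain_closed[OF g_closed] g_closed unfolding Rel_def pairs_def by fastforce
  have Rel_finite: "finite Rel" by (auto simp: Rel_def pairs_def finite_chain)
  have "\<exists>enc::nat \<times> (nat \<Rightarrow> int) \<Rightarrow> nat. inj_on enc ({0, 1, 2} \<times> carrier G)"
    using finite_imp_inj_to_nat_seg[of "{0, 1, 2::nat} \<times> carrier G"] fin by auto
  then obtain enc :: "nat \<times> (nat \<Rightarrow> int) \<Rightarrow> nat" where enc: "inj_on enc ({0, 1, 2} \<times> carrier G)" by blast
  interpret relation_complex G Rel enc
    by (intro relation_complex.intro relation_complex_axioms.intro G.is_group Rel_carrier Rel_finite fin enc)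
  interpret FG: group FG by (rule group_FG)
  define \<gamma> where "\<gamma> i = B (g i)" for i
  have sub: "chain G (g i) (ns ! i) \<subseteq> Rel" if "i < s" for i using that by (auto simp: Rel_def)
  have vals: "D (g i [^]\<^bsub>G\<^esub> (ns ! i)) = \<gamma> i [^]\<^bsub>FG\<^esub> (ns ! i)"
    "\<And>p. p \<in> chain G (g i) (ns ! i) \<Longrightarrow> power_pair (g i) p" if "i < s" for i
    using chain_values[OF sub[OF that]] ns2[OF that] by (auto simp: \<gamma>_def)
  note base = base_values[OF sub, folded \<gamma>_def]
  \<comment> \<open>This power of \<open>g i\<close> is trivial in \<open>G\<close>, so the chain
    ends at the corner \<open>Z \<one>\<close>, and \<open>D \<one>\<close> is trivial.\<close>
  have \<gamma>_pow: "\<gamma> i [^]\<^bsub>FG\<^esub> (ns ! i) = \<one>\<^bsub>FG\<^esub>" if "i < s" for i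
    using vals(1)[OF that] g_pow[OF that] D_one by simp
  have pair_values: "B (g i \<otimes>\<^bsub>G\<^esub> g j) = \<gamma> i \<otimes>\<^bsub>FG\<^esub> \<gamma> j \<and> B (g i \<otimes>\<^bsub>G\<^esub> g j) = \<gamma> j \<otimes>\<^bsub>FG\<^esub> \<gamma> i"
    if ij: "j < i" "i < s" for i j
  proof -
    have js: "j < s" using ij by simp
    note gi = g_closed[OF ij(2)] and gj = g_closed[OF js]
    have R: "(inv\<^bsub>G\<^esub> g i, g i \<otimes>\<^bsub>G\<^esub> g j) \<in> Rel" "(inv\<^bsub>G\<^esub> g j, g i \<otimes>\<^bsub>G\<^esub> g j) \<in> Rel"
      using ij by (auto simp: Rel_def pairs_def)
    have W: "B (g i \<otimes>\<^bsub>G\<^esub> g j) \<in> carrier FG" using ec_values[OF R(1)] by simp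
    have "inv\<^bsub>G\<^esub> g i \<otimes>\<^bsub>G\<^esub> (g i \<otimes>\<^bsub>G\<^esub> g j) = g j" using gi gj by (simp add: G.m_assoc[symmetric])
    then have "inv\<^bsub>FG\<^esub> \<gamma> i \<otimes>\<^bsub>FG\<^esub> B (g i \<otimes>\<^bsub>G\<^esub> g j) = \<gamma> j"
      using relation[OF R(1)] base(3)[OF ij(2)] base(4)[OF js] by simp
    then have 1: "B (g i \<otimes>\<^bsub>G\<^esub> g j) = \<gamma> i \<otimes>\<^bsub>FG\<^esub> \<gamma> j"
      using FG.inv_solve_left[of "\<gamma> j" "\<gamma> i" "B (g i \<otimes>\<^bsub>G\<^esub> g j)"] base(2)[OF ij(2)] base(2)[OF js] W by auto
    have "inv\<^bsub>G\<^esub> g j \<otimes>\<^bsub>G\<^esub> (g i \<otimes>\<^bsub>G\<^esub> g j) = g i" using gi gj by (simp add: G.m_comm[of "g i"] G.m_assoc[symmetric])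
    then have "inv\<^bsub>FG\<^esub> \<gamma> j \<otimes>\<^bsub>FG\<^esub> B (g i \<otimes>\<^bsub>G\<^esub> g j) = \<gamma> i"
      using relation[OF R(2)] base(3)[OF js] base(4)[OF ij(2)] by simp
    then have "B (g i \<otimes>\<^bsub>G\<^esub> g j) = \<gamma> j \<otimes>\<^bsub>FG\<^esub> \<gamma> i"
      using FG.inv_solve_left[of "\<gamma> i" "\<gamma> j" "B (g i \<otimes>\<^bsub>G\<^esub> g j)"] base(2)[OF ij(2)] base(2)[OF js] W by auto
    with 1 show ?thesis by simp
  qed
  have comm: "\<gamma> i \<otimes>\<^bsub>FG\<^esub> \<gamma> j = \<gamma> j \<otimes>\<^bsub>FG\<^esub> \<gamma> i" if "i < s" "j < s" for i j
    using pair_values[of i j] pair_values[of j i] that by (cases i j rule: linorder_cases) auto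
  define \<theta> where "\<theta> = power_prod FG \<gamma> s"
  have \<theta>: "\<theta> \<in> hom G FG"
    unfolding \<theta>_def
    by (rule FG.power_prod_hom[of ns \<gamma>, folded G_def s_def]) (use base(2) \<gamma>_pow comm in auto)
  interpret \<theta>: group_hom G FG \<theta>
    using \<theta> group_FG G.is_group by (auto simp: group_hom_def group_hom_axioms_def)
  have \<theta>_g: "\<theta> (g i) = \<gamma> i" if "i < s" for i
    unfolding \<theta>_def using that base(2) by (intro FG.power_prod_unit) (auto simp: g_def cyclic_unit_def s_def)
  have AB: "A a = \<theta> a \<and> B b = \<theta> b" if ab: "(a, b) \<in> Rel" for a b
  proof -
    consider i where "i < s" "(a, b) \<in> chain G (g i) (ns ! i)" | i j where "i < s" "j < i" "(a, b) \<in> pairs i j"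
      using ab by (auto simp: Rel_def)
    then show ?thesis
    proof cases
      case 1
      then obtain k l :: int where "a = g i [^]\<^bsub>G\<^esub> k" "b = g i [^]\<^bsub>G\<^esub> l"
        "A a = \<gamma> i [^]\<^bsub>FG\<^esub> k" "B b = \<gamma> i [^]\<^bsub>FG\<^esub> l"
        using vals(2)[OF 1] by (auto simp: power_pair_def \<gamma>_def)
      then show ?thesis using g_closed[OF 1(1)] \<theta>_g[OF 1(1)] by (simp add: \<theta>.hom_int_pow)
    next
      case 2
      then have j: "j < s" by simp
      have "a = inv\<^bsub>G\<^esub> g i \<or> a = inv\<^bsub>G\<^esub> g j" "b = g i \<otimes>\<^bsub>G\<^esub> g j" using 2(3) by (auto simp: pairs_def)
      then show ?thesis
        using pair_values[OF 2(2,1)] base(3)[OF 2(1)] base(3)[OF j] g_closed[OF 2(1)] g_closed[OF j] \<theta>_g[OF 2(1)] \<theta>_g[OF j]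
        by auto
    qed
  qed
  have surj: "\<theta> ` carrier G = carrier FG" using \<theta> AB by (rule hom_surj)
  obtain \<mu> where \<mu>: "\<mu> \<in> hom FG G" "\<And>u v. {u, v} \<in> K \<Longrightarrow> \<mu> (edge_class u v) = coc u v"
    using monodromy by blast
  interpret \<mu>: group_hom FG G \<mu>
    using \<mu>(1) group_FG G.is_group by (auto simp: group_hom_def group_hom_axioms_def)
  \<comment> \<open>\<open>\<gamma> i\<close> is the class of the edge from \<open>Y (g i)\<close>
    to \<open>Z \<one>\<close>, which carries the label \<open>g i\<close>.\<close>
  have \<mu>\<gamma>: "\<mu> (\<gamma> i) = g i" if "i < s" for i
  proof -
    have "(\<one>\<^bsub>G\<^esub>, g i) \<in> Rel" using subsetD[OF sub[OF that] chain_base(3)] .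
    then have "{Y (g i), Z \<one>\<^bsub>G\<^esub>} \<in> K" using Rel_facets(3) by (intro K_I[of "{Y (g i), Z (\<one>\<^bsub>G\<^esub> \<otimes>\<^bsub>G\<^esub> g i), Z \<one>\<^bsub>G\<^esub>}"]) auto
    then show ?thesis unfolding \<gamma>_def B_def using \<mu>(2) g_closed[OF that] by (simp add: coc_simps)
  qed
  have "\<mu> (\<theta> y) = y" if y: "y \<in> carrier G" for y
  proof -
    have "\<mu> (\<theta> y) = power_prod G (\<lambda>i. \<mu> (\<gamma> i)) s y"
      unfolding \<theta>_def using base(2) by (intro power_prod_group_hom \<mu>.group_hom_axioms) auto
    also have "\<dots> = power_prod G g s y" by (rule power_prod_cong) (auto simp: \<mu>\<gamma>)
    also have "\<dots> = y" using power_prod_cyclic_unit[OF pos] y unfolding G_def g_def s_def by blast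
    finally show ?thesis .
  qed
  then have "inj_on \<theta> (carrier G)" by (rule inj_on_inverseI)
  then have "\<theta> \<in> iso G FG" using \<theta> surj by (simp add: iso_def bij_betw_def)
  then have "FG \<cong> G" using G.iso_sym by (auto simp: is_iso_def)
  then have fg: "has_fundamental_group K G"
    unfolding has_fundamental_group_def using x_in by blast
  have pair_card: "card (triangles (pairs i j)) \<le> 8" for i j
    using card_triangles_insert[of "(inv\<^bsub>G\<^esub> g i, g i \<otimes>\<^bsub>G\<^esub> g j)" "{(inv\<^bsub>G\<^esub> g j, g i \<otimes>\<^bsub>G\<^esub> g j)}"]
      card_triangles_1[of "inv\<^bsub>G\<^esub> g i" "g i \<otimes>\<^bsub>G\<^esub> g j"] card_triangles_1[of "inv\<^bsub>G\<^esub> g j" "g i \<otimes>\<^bsub>G\<^esub> g j"]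
    unfolding pairs_def by linarith
  have chain_card: "real (card (triangles (chain G (g i) (ns ! i)))) \<le> 14 * log 2 (real (ns ! i)) + 3"
    if "i < s" for i
    using card_triangles_chain[OF g_closed[OF that], of "ns ! i"] ns2[OF that] by simp
  have UN: "card (triangles (\<Union>i<t. R i)) \<le> (\<Sum>i<t. card (triangles (R i)))" for R :: "nat \<Rightarrow> _" and t
  proof (induction t)
    case (Suc t)
    then show ?case using card_triangles_union[of "\<Union>i<t. R i" "R t"] by (simp add: lessThan_Suc Un_commute)
  qed (simp add: triangles_def)
  have "card {\<sigma> \<in> K. card \<sigma> = 3} \<le> card (triangles Rel)"
    by (rule card_mono[OF finite_triangles[OF Rel_finite] triangles_K])
  also have "\<dots> \<le> (\<Sum>i<s. card (triangles (chain G (g i) (ns ! i)))) + (\<Sum>i<s. \<Sum>j<i. card (triangles (pairs i j)))"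
    unfolding Rel_def
    by (intro order_trans[OF card_triangles_union] add_mono UN order_trans[OF UN] sum_mono)
  finally have "real (card {\<sigma> \<in> K. card \<sigma> = 3})
      \<le> (\<Sum>i<s. real (card (triangles (chain G (g i) (ns ! i))))) + (\<Sum>i<s. \<Sum>j<i. real (card (triangles (pairs i j))))"
    by (simp flip: of_nat_sum of_nat_add)
  also have "\<dots> \<le> (\<Sum>i<s. 14 * log 2 (real (ns ! i)) + 3) + (\<Sum>i<s. \<Sum>j<i. 8)"
    using chain_card pair_card by (intro add_mono sum_mono) auto
  also have "(\<Sum>i<s. \<Sum>j<i. 8 :: real) = 4 * (real s)\<^sup>2 - 4 * real s"
    by (induction s) (auto simp: power2_eq_square algebra_simps)
  also have "(\<Sum>i<s. 14 * log 2 (real (ns ! i)) + 3) = 14 * log 2 (real (prod_list ns)) + 3 * real s"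
  proof -
    have "(\<Sum>i<s. log 2 (real (ns ! i))) = log 2 (real (prod_list ns))"
    proof -
      have "log 2 (real (prod_list ns)) = log 2 (\<Prod>i<s. real (ns ! i))"
        by (simp add: s_def prod.list_conv_set_nth atLeast0LessThan)
      also have "\<dots> = (\<Sum>i<s. log 2 (real (ns ! i)))"
        using ns2 by (subst log_def, subst ln_prod) (force simp: log_def sum_divide_distrib)+
      finally show ?thesis by simp
    qed
    then show ?thesis by (simp add: sum.distrib sum_distrib_left[symmetric])
  qed
  also have "14 * log 2 (real (prod_list ns)) + 3 * real s + (4 * (real s)\<^sup>2 - 4 * real s)
      \<le> 14 * log 2 (real (prod_list ns)) + 7 * (real s)\<^sup>2 - 4 * real s"
  proof -
    have "real s \<le> (real s)\<^sup>2" by (cases s) (auto simp: power2_eq_square)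
    then show ?thesis by simp
  qed
  finally show ?thesis
    using complex_K card_K connected_S fg unfolding G_def s_def by blast
qed

theorem theorem4p1:
  fixes G :: "('a, 'b) monoid_scheme" and s :: nat
  assumes "comm_group G" and "finite (carrier G)"
    and "s = num_invariant_factors G"
  shows "2 * log 3 (real (order G)) \<le> real (simplicial_complexity G) \<and>
         real (simplicial_complexity G) \<le>
           14 * log 2 (real (order G)) + 7 * (real s)\<^sup>2 - 4 * real s"
proof -
  interpret comm_group G by (rule assms(1))
  obtain ns where ns: "invariant_factors G ns" using invariant_factors_exist[OF assms(2)] by blast
  have s: "s = length ns" using num_invariant_factors_eq[OF is_group ns] assms(3) by simp
  have ns2: "\<forall>n\<in>set ns. 2 \<le> n" and iso: "G \<cong> cyclic_sum ns" using ns by (auto simp: invariant_factors_def)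
  have order: "order G = prod_list ns"
  proof -
    have "order G = order (cyclic_sum ns)"
      using iso by (auto simp: order_def is_iso_def iso_def intro: bij_betw_same_card)
    also have "\<dots> = prod_list ns" unfolding order_def by (rule card_cyclic_sum) (use ns2 in force)
    finally show ?thesis .
  qed
  define P where "P n \<longleftrightarrow> (\<exists>K. finite_abstract_complex K \<and> (\<forall>\<sigma>\<in>K. card \<sigma> \<le> 3) \<and>
    connected (geometric_realization K) \<and> has_fundamental_group K G \<and> card {\<sigma>\<in>K. card \<sigma> = 3} = n)" for n
  have \<kappa>: "simplicial_complexity G = (LEAST n. P n)" by (simp add: simplicial_complexity_def P_def)
  obtain K where K: "finite_abstract_complex K" "\<forall>\<sigma>\<in>K. card \<sigma> \<le> 3" "connected (geometric_realization K)"
    "has_fundamental_group K (cyclic_sum ns)"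
    "real (card {\<sigma> \<in> K. card \<sigma> = 3}) \<le>
      14 * log 2 (real (prod_list ns)) + 7 * (real (length ns))\<^sup>2 - 4 * real (length ns)"
    using exists_small_complex[OF ns2] by blast
  have "cyclic_sum ns \<cong> G" using iso iso_sym by blast
  then have "has_fundamental_group K G" using K(4) iso_trans unfolding has_fundamental_group_def by blast
  then have PK: "P (card {\<sigma> \<in> K. card \<sigma> = 3})" using K unfolding P_def by blast
  then have upper: "simplicial_complexity G \<le> card {\<sigma> \<in> K. card \<sigma> = 3}" unfolding \<kappa> by (rule Least_le)
  \<comment> \<open>The complex just obtained shows that the minimum is over a nonempty set, so it
    is attained by some complex \<open>L\<close>.\<close>
  have "P (simplicial_complexity G)" unfolding \<kappa> using PK by (rule LeastI)
  then obtain L where L: "finite_abstract_complex L" "connected (geometric_realization L)"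
    "has_fundamental_group L G" "card {\<sigma> \<in> L. card \<sigma> = 3} = simplicial_complexity G" unfolding P_def by blast
  then obtain x where "x \<in> geometric_realization L" "fundamental_group (geometric_realization L) x \<cong> G"
    unfolding has_fundamental_group_def by blast
  then have lower: "(real (order G))\<^sup>2 \<le> 3 ^ simplicial_complexity G"
    using card_triangles_ge[OF L(1,2) _ _ assms(1,2)] L(4) by metis
  have "order G > 0" using assms(2) by (simp add: order_gt_0_iff_finite)
  then have "2 * log 3 (real (order G)) = log 3 ((real (order G))\<^sup>2)" by (simp add: log_nat_power)
  also have "\<dots> \<le> log 3 (3 ^ simplicial_complexity G)"
    using lower \<open>order G > 0\<close> by (intro log_mono) auto
  also have "\<dots> = real (simplicial_complexity G)" by (rule log_pow_cancel) auto
  finally show ?thesis using upper K(5) by (simp add: s order)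
qed

end
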